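(* Let $\mathcal{M}$ be a factor of type ${\rm II}_1$ with normalized trace $\tau$. Let $\alpha:[0,1]\to[0,1]$ be a monotone increasing continuous function with $\alpha(0)=0$ and $\alpha(1)=1$, and let $\varphi_\alpha$ be the non-linear trace of the Choquet type associated with $\alpha$. Let $(a_n)_{n\ge 1}$ be an operator norm bounded sequence in $\mathcal{M}_{s.a.}$, and put $s_n=a_1+a_2+\cdots+a_n$. (1) Assume that $\alpha$ is concave. Fix $k\in\{1,2,3,\dots\}$. Suppose that there is a constant $C(k)\in\mathbb{R}$ such that for any mutually different $i_1,i_2,\dots,i_k\in\{1,2,3,\dots\}$, $$\varphi_\alpha\big(\mathrm{Re}(a_{i_1}a_{i_2}\cdots a_{i_k})\big)\le C(k).$$ Then $$\limsup_{n\to\infty}\varphi_\alpha\Big(\big(\tfrac{s_n}{n}\big)^k\Big)\le C(k).$$ (2) Assume that $\alpha$ is convex. Fix $k\in\{1,2,3,\dots\}$. Suppose that there is a constant $\hat C(k)\in\mathbb{R}$ such that for any mutually different $i_1,i_2,\dots,i_k\in\{1,2,3,\dots\}$, $$\varphi_\alpha\big(\mathrm{Re}(a_{i_1}a_{i_2}\cdots a_{i_k})\big)\ge \hat C(k).$$ Then $$\liminf_{n\to\infty}\varphi_\alpha\Big(\big(\tfrac{s_n}{n}\big)^k\Big)\ge \hat C(k).$$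
   Context: $\tau$ is the faithful normal tracial state on the type ${\rm II}_1$ factor $\mathcal{M}$, so $\tau(I)=1$. $\mathcal{M}_{s.a.}$ is the set of self-adjoint operators in $\mathcal{M}$, $\mathcal{M}^+$ the set of positive operators. $\mathrm{Re}(x)=\frac12(x+x^* )$. For $a\in\mathcal{M}^+$, $e_{(s,\infty)}(a)$ denotes the spectral projection of $a$ for $(s,\infty)$, and $$\varphi_\alpha(a):=\int_0^\infty \alpha\big(\tau(e_{(s,\infty)}(a))\big)\,ds .$$ For $a\in\mathcal{M}_{s.a.}$, $\varphi_\alpha(a)$ denotes the translatable extension: choose a real number $c$ with $a+cI\ge 0$ and put $\varphi_\alpha(a):=\varphi_\alpha(a+cI)-c$; this does not depend on the choice of $c$ and agrees with the previous definition on $\mathcal{M}^+$. *)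

theory Defs
  imports "HOL-Analysis.Analysis"
begin

section \<open>Complex Hilbert spaces\<close>

text \<open>The inner product is conjugate-linear in the first and linear in the second argument.\<close>

class complex_hilbert_space = banach +
  fixes scaleC :: "complex \<Rightarrow> 'a \<Rightarrow> 'a" (infixr "*\<^sub>C" 75)
    and cinner :: "'a \<Rightarrow> 'a \<Rightarrow> complex"
  assumes scaleC_add_right: "c *\<^sub>C (x + y) = c *\<^sub>C x + c *\<^sub>C y"
    and scaleC_add_left: "(c + d) *\<^sub>C x = c *\<^sub>C x + d *\<^sub>C x"
    and scaleC_scaleC: "c *\<^sub>C d *\<^sub>C x = (c * d) *\<^sub>C x"
    and scaleC_of_real: "complex_of_real r *\<^sub>C x = r *\<^sub>R x"
    and cinner_commute: "cinner x y = cnj (cinner y x)"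
    and cinner_add_right: "cinner x (y + z) = cinner x y + cinner x z"
    and cinner_scaleC_right: "cinner x (c *\<^sub>C y) = c * cinner x y"
    and cinner_self: "cinner x x = complex_of_real ((norm x)\<^sup>2)"

instantiation complex :: complex_hilbert_space
begin

definition scaleC_complex :: "complex \<Rightarrow> complex \<Rightarrow> complex"
  where "scaleC_complex c x = c * x"

definition cinner_complex :: "complex \<Rightarrow> complex \<Rightarrow> complex"
  where "cinner_complex x y = cnj x * y"

instance
proof
  fix x :: complex
  show "cinner x x = complex_of_real ((norm x)\<^sup>2)"
    by (metis cinner_complex_def complex_norm_square mult.commute)
qed (simp_all add: scaleC_complex_def cinner_complex_def algebra_simps scaleR_conv_of_real)

end


section \<open>Operators on a Hilbert space\<close>

text \<open>
  The elements of the type \<^typ>\<open>'h \<Rightarrow>\<^sub>L 'h\<close> are the bounded \<^emph>\<open>real\<close>-linear maps; the bounded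
  operators in the sense of complex Hilbert space theory are those in the following set.
\<close>

definition bounded_ops :: "('h::complex_hilbert_space \<Rightarrow>\<^sub>L 'h) set"
  where "bounded_ops = {a :: 'h \<Rightarrow>\<^sub>L 'h. \<forall>c x. a (c *\<^sub>C x) = c *\<^sub>C a x}"

definition scalar_op :: "complex \<Rightarrow> 'h::complex_hilbert_space \<Rightarrow>\<^sub>L 'h"
  where "scalar_op c = Blinfun (\<lambda>x. c *\<^sub>C x)"

definition adj :: "('h::complex_hilbert_space \<Rightarrow>\<^sub>L 'h) \<Rightarrow> 'h \<Rightarrow>\<^sub>L 'h"
  where "adj a = (THE b :: 'h \<Rightarrow>\<^sub>L 'h. \<forall>x y. cinner (b x) y = cinner x (a y))"

definition Re_op :: "('h::complex_hilbert_space \<Rightarrow>\<^sub>L 'h) \<Rightarrow> 'h \<Rightarrow>\<^sub>L 'h"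
  where "Re_op a = (1/2) *\<^sub>R (a + adj a)"

definition positive_op :: "('h::complex_hilbert_space \<Rightarrow>\<^sub>L 'h) \<Rightarrow> bool"
  where "positive_op a \<longleftrightarrow> a \<in> bounded_ops \<and> (\<forall>x. cinner x (a x) \<in> \<real>\<^sub>\<ge>\<^sub>0)"

definition le_op :: "('h::complex_hilbert_space \<Rightarrow>\<^sub>L 'h) \<Rightarrow> ('h \<Rightarrow>\<^sub>L 'h) \<Rightarrow> bool"
  where "le_op a b \<longleftrightarrow> positive_op (b - a)"

definition projection_op :: "('h::complex_hilbert_space \<Rightarrow>\<^sub>L 'h) \<Rightarrow> bool"
  where "projection_op p \<longleftrightarrow> p \<in> bounded_ops \<and> adj p = p \<and> p o\<^sub>L p = p"

definition power_op :: "('h::complex_hilbert_space \<Rightarrow>\<^sub>L 'h) \<Rightarrow> nat \<Rightarrow> 'h \<Rightarrow>\<^sub>L 'h"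
  where "power_op a k = (((o\<^sub>L) a) ^^ k) id_blinfun"

definition prod_ops :: "('h::complex_hilbert_space \<Rightarrow>\<^sub>L 'h) list \<Rightarrow> 'h \<Rightarrow>\<^sub>L 'h"
  where "prod_ops as = foldr (o\<^sub>L) as id_blinfun"


section \<open>Spectral projections\<close>

definition projection_valued_measure :: "(real set \<Rightarrow> 'h::complex_hilbert_space \<Rightarrow>\<^sub>L 'h) \<Rightarrow> bool"
  where "projection_valued_measure E \<longleftrightarrow>
    (\<forall>B\<in>sets borel. projection_op (E B)) \<and>
    E {} = 0 \<and> E UNIV = id_blinfun \<and>
    (\<forall>A\<in>sets borel. \<forall>B\<in>sets borel. E (A \<inter> B) = E A o\<^sub>L E B) \<and>
    (\<forall>B :: nat \<Rightarrow> real set. range B \<subseteq> sets borel \<longrightarrow> disjoint_family B \<longrightarrow>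
      (\<forall>x. (\<lambda>n. E (B n) x) sums E (\<Union>n. B n) x))"

definition scalar_spectral_measure ::
    "(real set \<Rightarrow> 'h::complex_hilbert_space \<Rightarrow>\<^sub>L 'h) \<Rightarrow> 'h \<Rightarrow> real measure"
  where "scalar_spectral_measure E x =
    measure_of UNIV (sets borel) (\<lambda>B. ennreal (Re (cinner x (E B x))))"

text \<open>
  The operator identity \<open>a = \<integral> t dE(t)\<close> is expressed through the quadratic forms of both sides,
  which determine an operator on a complex Hilbert space by polarization.
\<close>

definition is_spectral_measure ::
    "('h::complex_hilbert_space \<Rightarrow>\<^sub>L 'h) \<Rightarrow> (real set \<Rightarrow> 'h \<Rightarrow>\<^sub>L 'h) \<Rightarrow> bool"
  where "is_spectral_measure a E \<longleftrightarrow>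
    projection_valued_measure E \<and>
    (\<exists>R. E {-R..R} = id_blinfun) \<and>
    (\<forall>x. cinner x (a x) = complex_of_real (\<integral>t. t \<partial>scalar_spectral_measure E x))"

text \<open>Only meaningful for self-adjoint \<open>a\<close> and Borel sets \<open>B\<close>.\<close>

definition spectral_projection ::
    "real set \<Rightarrow> ('h::complex_hilbert_space \<Rightarrow>\<^sub>L 'h) \<Rightarrow> 'h \<Rightarrow>\<^sub>L 'h"
  where "spectral_projection B a = (THE p. \<exists>E. is_spectral_measure a E \<and> p = E B)"


section \<open>Factors of type II_1 and their traces\<close>

definition commutant :: "('h::complex_hilbert_space \<Rightarrow>\<^sub>L 'h) set \<Rightarrow> ('h \<Rightarrow>\<^sub>L 'h) set"
  where "commutant S = {b \<in> bounded_ops. \<forall>a\<in>S. a o\<^sub>L b = b o\<^sub>L a}"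

definition von_neumann_algebra :: "('h::complex_hilbert_space \<Rightarrow>\<^sub>L 'h) set \<Rightarrow> bool"
  where "von_neumann_algebra M \<longleftrightarrow>
    M \<subseteq> bounded_ops \<and> (\<forall>a\<in>M. adj a \<in> M) \<and> commutant (commutant M) = M"

definition factor :: "('h::complex_hilbert_space \<Rightarrow>\<^sub>L 'h) set \<Rightarrow> bool"
  where "factor M \<longleftrightarrow> von_neumann_algebra M \<and>
    (id_blinfun :: 'h \<Rightarrow>\<^sub>L 'h) \<noteq> 0 \<and> M \<inter> commutant M = range scalar_op"

definition mvn_equivalent ::
    "('h::complex_hilbert_space \<Rightarrow>\<^sub>L 'h) set \<Rightarrow> ('h \<Rightarrow>\<^sub>L 'h) \<Rightarrow> ('h \<Rightarrow>\<^sub>L 'h) \<Rightarrow> bool"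
  where "mvn_equivalent M p q \<longleftrightarrow> (\<exists>v\<in>M. adj v o\<^sub>L v = p \<and> v o\<^sub>L adj v = q)"

definition finite_projection ::
    "('h::complex_hilbert_space \<Rightarrow>\<^sub>L 'h) set \<Rightarrow> ('h \<Rightarrow>\<^sub>L 'h) \<Rightarrow> bool"
  where "finite_projection M p \<longleftrightarrow> p \<in> M \<and> projection_op p \<and>
    (\<forall>q\<in>M. projection_op q \<longrightarrow> le_op q p \<longrightarrow> mvn_equivalent M p q \<longrightarrow> q = p)"

definition abelian_projection ::
    "('h::complex_hilbert_space \<Rightarrow>\<^sub>L 'h) set \<Rightarrow> ('h \<Rightarrow>\<^sub>L 'h) \<Rightarrow> bool"
  where "abelian_projection M p \<longleftrightarrow> p \<in> M \<and> projection_op p \<and>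
    (\<forall>a\<in>M. \<forall>b\<in>M. (p o\<^sub>L a o\<^sub>L p) o\<^sub>L (p o\<^sub>L b o\<^sub>L p) = (p o\<^sub>L b o\<^sub>L p) o\<^sub>L (p o\<^sub>L a o\<^sub>L p))"

definition type_II1_factor :: "('h::complex_hilbert_space \<Rightarrow>\<^sub>L 'h) set \<Rightarrow> bool"
  where "type_II1_factor M \<longleftrightarrow> factor M \<and> finite_projection M id_blinfun \<and>
    (\<forall>p. abelian_projection M p \<longrightarrow> p = 0)"

definition self_adjoints :: "('h::complex_hilbert_space \<Rightarrow>\<^sub>L 'h) set \<Rightarrow> ('h \<Rightarrow>\<^sub>L 'h) set"
  where "self_adjoints M = {a \<in> M. adj a = a}"

definition state_on ::
    "('h::complex_hilbert_space \<Rightarrow>\<^sub>L 'h) set \<Rightarrow> (('h \<Rightarrow>\<^sub>L 'h) \<Rightarrow> complex) \<Rightarrow> bool"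
  where "state_on M \<tau> \<longleftrightarrow>
    (\<forall>a\<in>M. \<forall>b\<in>M. \<tau> (a + b) = \<tau> a + \<tau> b) \<and>
    (\<forall>c. \<forall>a\<in>M. \<tau> (scalar_op c o\<^sub>L a) = c * \<tau> a) \<and>
    (\<forall>a\<in>M. positive_op a \<longrightarrow> \<tau> a \<in> \<real>\<^sub>\<ge>\<^sub>0) \<and>
    \<tau> id_blinfun = 1"

text \<open>
  Normality: \<open>\<tau>\<close> preserves suprema of upward directed sets (equivalently, of increasing nets) of
  self-adjoint elements of \<open>M\<close>.
\<close>

definition normal_on ::
    "('h::complex_hilbert_space \<Rightarrow>\<^sub>L 'h) set \<Rightarrow> (('h \<Rightarrow>\<^sub>L 'h) \<Rightarrow> complex) \<Rightarrow> bool"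
  where "normal_on M \<tau> \<longleftrightarrow>
    (\<forall>D a. D \<subseteq> self_adjoints M \<longrightarrow> D \<noteq> {} \<longrightarrow>
      (\<forall>x\<in>D. \<forall>y\<in>D. \<exists>z\<in>D. le_op x z \<and> le_op y z) \<longrightarrow>
      a \<in> self_adjoints M \<longrightarrow> (\<forall>x\<in>D. le_op x a) \<longrightarrow>
      (\<forall>b\<in>self_adjoints M. (\<forall>x\<in>D. le_op x b) \<longrightarrow> le_op a b) \<longrightarrow>
      Re (\<tau> a) = (SUP x\<in>D. Re (\<tau> x)))"

definition faithful_normal_tracial_state ::
    "('h::complex_hilbert_space \<Rightarrow>\<^sub>L 'h) set \<Rightarrow> (('h \<Rightarrow>\<^sub>L 'h) \<Rightarrow> complex) \<Rightarrow> bool"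
  where "faithful_normal_tracial_state M \<tau> \<longleftrightarrow>
    state_on M \<tau> \<and> normal_on M \<tau> \<and>
    (\<forall>a\<in>M. \<forall>b\<in>M. \<tau> (a o\<^sub>L b) = \<tau> (b o\<^sub>L a)) \<and>
    (\<forall>a\<in>M. positive_op a \<longrightarrow> \<tau> a = 0 \<longrightarrow> a = 0)"


section \<open>Non-linear traces of Choquet type\<close>

definition choquet_trace_pos ::
    "(('h::complex_hilbert_space \<Rightarrow>\<^sub>L 'h) \<Rightarrow> complex) \<Rightarrow> (real \<Rightarrow> real) \<Rightarrow> ('h \<Rightarrow>\<^sub>L 'h) \<Rightarrow> real"
  where "choquet_trace_pos \<tau> \<alpha> a =
    (LBINT s:{0..}. \<alpha> (Re (\<tau> (spectral_projection {s<..} a))))"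

text \<open>The translatable extension to self-adjoint operators; the value does not depend on the choice
  of \<open>c\<close>.\<close>

definition choquet_trace ::
    "(('h::complex_hilbert_space \<Rightarrow>\<^sub>L 'h) \<Rightarrow> complex) \<Rightarrow> (real \<Rightarrow> real) \<Rightarrow> ('h \<Rightarrow>\<^sub>L 'h) \<Rightarrow> real"
  where "choquet_trace \<tau> \<alpha> a =
    (let c = (SOME c. positive_op (a + c *\<^sub>R id_blinfun))
     in choquet_trace_pos \<tau> \<alpha> (a + c *\<^sub>R id_blinfun) - c)"

end

theory Submission imports Defs "HOL-Probability.Distribution_Functions" begin

text \<open>
  Take \<open>\<alpha>\<close> concave. Approximate a self-adjoint \<open>c\<close> by a staircase of its spectral projections
  \<open>p\<^sub>j\<close>, with steps \<open>q\<^sub>j = p\<^sub>j - p\<^sub>j\<^sub>+\<^sub>1\<close>, and weight each step by the slope of \<open>\<alpha>\<close> between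
  \<open>\<tau>(p\<^sub>j\<^sub>+\<^sub>1)\<close> and \<open>\<tau>(p\<^sub>j)\<close>. Summation by parts shows that the normalised positive functional
  \<open>T = \<tau>(\<cdot> h)\<close> with density \<open>h = \<Sum>\<^sub>j w\<^sub>j q\<^sub>j\<close> satisfies \<open>T c \<approx> \<phi>\<^sub>\<alpha>(c)\<close>, while concavity gives
  \<open>T e \<le> \<alpha>(\<tau> e)\<close> for every projection \<open>e\<close> and hence \<open>T a \<le> \<phi>\<^sub>\<alpha>(a)\<close> for every self-adjoint \<open>a\<close>.
  For \<open>c = (s\<^sub>n/n)\<^sup>k\<close>, the average of \<open>Re(a\<^sub>i\<^sub>1 \<cdots> a\<^sub>i\<^sub>k)\<close> over all index tuples, \<open>T c\<close> is therefore at
  most \<open>C(k)\<close> plus a bounded contribution of the tuples with repetitions, whose proportion tends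
  to 0. The convex case is the same argument for \<open>-\<alpha>\<close>, since monotonicity of \<open>\<alpha>\<close> is needed only
  for \<open>T \<ge> 0\<close> and for the Riemann sums of \<open>\<phi>\<^sub>\<alpha>\<close>; the sign is carried by \<open>\<sigma> = \<plusminus>1\<close>.

  The spectral theorem behind \<open>spectral_projection\<close> is obtained from the projections onto the
  kernels of \<open>(a - s)\<^sup>+\<close>; they form a right-continuous resolution of the identity, and their
  distribution functions are extended to Borel sets by a Dynkin argument.
\<close>


text \<open>The obstacle is that \<open>choquet_trace\<close> is not additive, so it cannot be
  evaluated term by term on an average of products. For concave \<alpha> it is an upper envelope of
  positive linear functionals, and the proof exploits exactly this: one functional, chosen for the
  operator at hand and a given tolerance, lies below the Choquet trace everywhere and almost meets
  it at that operator. An approximate contact is enough, because the final bound does not mention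
  the functional and the tolerance is arbitrary. The density h need not commute with the operators
  it is tested on; positivity of \<tau>(a h) for positive a is where the trace property enters.

  Much of the development serves \<open>spectral_projection\<close>. It is a definite description
  over all spectral measures, so it has a usable value only once one exists and all of them agree on
  the half lines \<open>{s<..}\<close>. The link is \<open>spectral_cut\<close>, a description of
  \<open>E {..s}\<close> by quadratic forms alone: hermitian operators are determined by their
  forms, so identities and order relations between them become statements about real
  numbers.\<close>

section \<open>Inner products and the Cauchy--Schwarz inequality\<close>

lemma cinner_add_left: "cinner (x + y) z = cinner x z + cinner y (z::'h::complex_hilbert_space)"
  by (metis cinner_add_right cinner_commute complex_cnj_add)

lemma cinner_scaleC_left: "cinner (c *\<^sub>C x) y = cnj c * cinner x (y::'h::complex_hilbert_space)"
  by (metis cinner_commute cinner_scaleC_right complex_cnj_mult)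

lemma cinner_scaleR_right: "cinner x (r *\<^sub>R y) = of_real r * cinner x (y::'h::complex_hilbert_space)"
  by (metis cinner_scaleC_right scaleC_of_real)

lemma cinner_scaleR_left: "cinner (r *\<^sub>R x) y = of_real r * cinner x (y::'h::complex_hilbert_space)"
  by (metis cinner_scaleC_left complex_cnj_complex_of_real scaleC_of_real)

lemma Re_cinner_self: "Re (cinner x x) = (norm (x::'h::complex_hilbert_space))\<^sup>2"
  by (simp add: cinner_self)

lemma Re_cinner_commute: "Re (cinner x y) = Re (cinner y (x::'h::complex_hilbert_space))"
  by (subst cinner_commute) simp

lemma norm_add_square:
  "(norm (x + y))\<^sup>2 = (norm x)\<^sup>2 + 2 * Re (cinner x y) + (norm (y::'h::complex_hilbert_space))\<^sup>2"
  unfolding Re_cinner_self[symmetric]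
  using Re_cinner_commute[of x y] by (simp add: cinner_add_left cinner_add_right)

lemma norm_scaleC: "norm (c *\<^sub>C x) = cmod c * norm (x::'h::complex_hilbert_space)"
proof -
  have "complex_of_real ((norm (c *\<^sub>C x))\<^sup>2) = cnj c * c * complex_of_real ((norm x)\<^sup>2)"
    by (simp only: cinner_self[symmetric] cinner_scaleC_left cinner_scaleC_right mult.assoc)
       (simp add: mult.left_commute)
  also have "\<dots> = complex_of_real ((cmod c * norm x)\<^sup>2)"
    by (simp add: complex_norm_square power_mult_distrib mult.commute del: of_real_power)
  finally show ?thesis
    by (smt (verit) of_real_eq_iff norm_ge_zero power2_eq_imp_eq mult_nonneg_nonneg)
qed

text \<open>A nonnegative quadratic polynomial has no positive discriminant. Later uses with
  \<open>p = 0\<close> force the linear coefficient to vanish, which is how first-order conditions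
  at a minimum are extracted.\<close>

lemma quadratic_form_Cauchy_Schwarz:
  fixes p q r :: real
  assumes "\<And>t. 0 \<le> p + 2 * t * q + t\<^sup>2 * r" "0 \<le> p" "0 \<le> r"
  shows "q\<^sup>2 \<le> p * r"
proof (cases "r = 0")
  case True
  have "q = 0"
  proof (rule ccontr)
    assume "q \<noteq> 0"
    \<comment> \<open>At this point the affine function \<open>p + 2 * t * q\<close> equals
      -1.\<close>
    then show False using assms(1)[of "-(p + 1) / (2 * q)"] True by (simp add: field_simps)
  qed
  then show ?thesis using True by simp
next
  case False
  then have "r > 0" using assms by simp
  then show ?thesis using assms(1)[of "- q / r"] by (simp add: field_simps power2_eq_square)
qed

lemma Re_cinner_le_norm: "\<bar>Re (cinner x y)\<bar> \<le> norm x * norm (y::'h::complex_hilbert_space)"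
proof -
  have "(Re (cinner x y))\<^sup>2 \<le> (norm x)\<^sup>2 * (norm y)\<^sup>2"
  proof (rule quadratic_form_Cauchy_Schwarz)
    fix t :: real
    have "0 \<le> (norm (x + t *\<^sub>R y))\<^sup>2" by simp
    also have "\<dots> = (norm x)\<^sup>2 + 2 * t * Re (cinner x y) + t\<^sup>2 * (norm y)\<^sup>2"
      by (simp add: norm_add_square cinner_scaleR_right power_mult_distrib)
    finally show "0 \<le> (norm x)\<^sup>2 + 2 * t * Re (cinner x y) + t\<^sup>2 * (norm y)\<^sup>2" .
  qed auto
  then show ?thesis
    by (metis abs_le_square_iff abs_mult abs_norm_cancel power_mult_distrib)
qed

text \<open>The constant 2 comes from bounding real and imaginary part separately. It is not sharp,
  but some constant is all that \<open>bounded_bilinear\<close> asks for.\<close>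

lemma norm_cinner_le: "cmod (cinner x y) \<le> 2 * (norm x * norm (y::'h::complex_hilbert_space))"
proof -
  have "Im (cinner x y) = - Re (cinner x (\<i> *\<^sub>C y))"
    by (simp add: cinner_scaleC_right)
  then have "\<bar>Im (cinner x y)\<bar> \<le> norm x * norm y"
    using Re_cinner_le_norm[of x "\<i> *\<^sub>C y"] by (simp add: norm_scaleC)
  then show ?thesis using Re_cinner_le_norm[of x y] cmod_le[of "cinner x y"] by linarith
qed

lemma bounded_bilinear_cinner: "bounded_bilinear (cinner :: 'h::complex_hilbert_space \<Rightarrow> _)"
  by unfold_locales
    (auto simp: cinner_add_left cinner_add_right cinner_scaleR_left cinner_scaleR_right
      scaleR_conv_of_real intro!: exI[of _ 2] order.trans[OF norm_cinner_le])

interpretation cinner: bounded_bilinear "cinner :: 'h::complex_hilbert_space \<Rightarrow> _"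
  by (rule bounded_bilinear_cinner)

lemma cinner_eqI:
  assumes "\<And>y. cinner x y = cinner (x'::'h::complex_hilbert_space) y" shows "x = x'"
proof -
  have "cinner (x - x') (x - x') = 0" using assms by (simp add: cinner.diff_left)
  then show ?thesis by (simp add: cinner_self)
qed

lemma bounded_linear_scaleC: "bounded_linear (\<lambda>x::'h::complex_hilbert_space. c *\<^sub>C x)"
proof (rule bounded_linear_intro[where K = "cmod c"])
  fix r and x :: 'h
  have "c *\<^sub>C complex_of_real r *\<^sub>C x = complex_of_real r *\<^sub>C c *\<^sub>C x"
    by (simp add: scaleC_scaleC mult.commute)
  then show "c *\<^sub>C r *\<^sub>R x = r *\<^sub>R c *\<^sub>C x" by (simp add: scaleC_of_real)
qed (auto simp: scaleC_add_right norm_scaleC)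

lemmas scaleC_diff_right = linear_diff[OF bounded_linear.linear[OF bounded_linear_scaleC]]
  and scaleC_scaleR_right = linear_scale[OF bounded_linear.linear[OF bounded_linear_scaleC]]
  and scaleC_zero_right = linear_0[OF bounded_linear.linear[OF bounded_linear_scaleC]]
  and tendsto_scaleC = bounded_linear.tendsto[OF bounded_linear_scaleC]

lemma scalar_op_apply [simp]: "scalar_op c x = c *\<^sub>C x"
  unfolding scalar_op_def by (simp add: bounded_linear_Blinfun_apply bounded_linear_scaleC)

section \<open>The projection theorem and adjoints\<close>

text \<open>Minimise \<open>\<parallel>x\<parallel>\<^sup>2 - 2 f x\<close> over the subspace; the parallelogram law makes minimising sequences
  Cauchy.\<close>

lemma Riesz_representation_real:
  fixes f :: "'h::complex_hilbert_space \<Rightarrow> real"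
  assumes S: "subspace S" "closed S" and f: "bounded_linear f"
  shows "\<exists>z\<in>S. \<forall>y\<in>S. Re (cinner z y) = f y"
proof -
  interpret f: bounded_linear f by (rule f)
  obtain K where K: "\<And>x. norm (f x) \<le> norm x * K" using f.bounded by blast
  define J where "J x = (norm x)\<^sup>2 - 2 * f x" for x
  have lb: "- K\<^sup>2 \<le> J x" for x
  proof -
    have "0 \<le> (norm x - K)\<^sup>2" by simp
    then have "2 * (norm x * K) - K\<^sup>2 \<le> (norm x)\<^sup>2" by (simp add: power2_diff)
    then show ?thesis unfolding J_def using K[of x] by (simp add: abs_le_iff)
  qed
  define m where "m = (INF x\<in>S. J x)"
  have bdd: "bdd_below (J ` S)" using lb by (auto intro!: bdd_belowI2)
  have S0: "0 \<in> S" using S(1) by (rule subspace_0)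
  have m_le: "m \<le> J x" if "x \<in> S" for x
    unfolding m_def by (rule cINF_lower[OF bdd that])
  define mid where "mid x y = (1/2) *\<^sub>R (x + y)" for x y :: 'h
  have norm_mid: "(norm (mid x y))\<^sup>2 = (norm (x + y))\<^sup>2 / 4" for x y
    unfolding mid_def norm_scaleR by (simp add: power_divide)
  have f_mid: "f (mid x y) = (f x + f y) / 2" for x y
    unfolding mid_def f.scaleR f.add by simp
  have par: "J x + J y = 2 * J (mid x y) + (norm (x - y))\<^sup>2 / 2" for x y
    using norm_add_square[of x y] norm_add_square[of x "-y"]
    by (simp add: J_def norm_mid f_mid cinner.minus_right field_simps)
  have mid: "mid x y \<in> S" if "x \<in> S" "y \<in> S" for x y
    unfolding mid_def using S(1) that by (intro subspace_add subspace_scale)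
  have close: "(norm (x - y))\<^sup>2 \<le> 2 * (J x - m) + 2 * (J y - m)" if "x \<in> S" "y \<in> S" for x y
    using par[of x y] m_le[OF mid[OF that]] by argo
  have "\<exists>x\<in>S. J x < m + 1 / real (Suc n)" for n
    using cINF_less_iff[OF _ bdd, of "m + 1 / real (Suc n)"] S0 unfolding m_def by auto
  then obtain X where X: "\<And>n. X n \<in> S" "\<And>n. J (X n) < m + 1 / real (Suc n)" by metis
  have "Cauchy X"
  proof (rule CauchyI)
    fix e :: real assume "e > 0"
    then obtain N where N: "1 / real (Suc N) < e\<^sup>2 / 4"
      using reals_Archimedean[of "e\<^sup>2 / 4"] by (auto simp: inverse_eq_divide)
    have "norm (X p - X q) < e" if "p \<ge> N" "q \<ge> N" for p q
    proof -
      have "1 / real (Suc p) \<le> 1 / real (Suc N)" "1 / real (Suc q) \<le> 1 / real (Suc N)"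
        using that by (auto simp: frac_le)
      then have "(norm (X p - X q))\<^sup>2 < e\<^sup>2"
        using close[OF X(1) X(1), of p q] X(2)[of p] X(2)[of q] N by argo
      then show ?thesis using \<open>e > 0\<close> by (simp add: power2_less_imp_less)
    qed
    then show "\<exists>M. \<forall>p\<ge>M. \<forall>q\<ge>M. norm (X p - X q) < e" by blast
  qed
  then obtain z where z: "X \<longlonglongrightarrow> z" using convergent_eq_Cauchy[of X] by (auto simp: convergent_def)
  have zS: "z \<in> S" using closed_sequentially[OF S(2) _ z] X(1) by blast
  have "(\<lambda>n. J (X n)) \<longlonglongrightarrow> J z"
    unfolding J_def by (intro tendsto_intros z f.tendsto)
  moreover have "(\<lambda>n. m + 1 / real (Suc n)) \<longlonglongrightarrow> m"
    using tendsto_add[OF tendsto_const LIMSEQ_inverse_real_of_nat, of m] by (simp add: inverse_eq_divide)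
  ultimately have Jz: "J z \<le> m"
    by (rule LIMSEQ_le) (use X(2) less_imp_le in blast)
  have "Re (cinner z y) = f y" if y: "y \<in> S" for y
  proof -
    \<comment> \<open>First variation: minimality of \<open>z\<close> along the line
      \<open>z + t y\<close> gives a nonnegative quadratic in \<open>t\<close> without constant
      term, so its linear coefficient is 0.\<close>
    have "(Re (cinner z y) - f y)\<^sup>2 \<le> 0 * (norm y)\<^sup>2"
    proof (rule quadratic_form_Cauchy_Schwarz)
      fix t :: real
      have "z + t *\<^sub>R y \<in> S" using S(1) zS y by (simp add: subspace_add subspace_scale)
      then have "J z \<le> J (z + t *\<^sub>R y)" using order.trans[OF Jz m_le] by blast
      then show "0 \<le> 0 + 2 * t * (Re (cinner z y) - f y) + t\<^sup>2 * (norm y)\<^sup>2"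
        unfolding J_def
        by (simp add: norm_add_square f.add f.scaleR cinner_scaleR_right power_mult_distrib algebra_simps)
    qed auto
    then show ?thesis by simp
  qed
  then show ?thesis using zS by blast
qed

lemma bounded_opsD: "a \<in> bounded_ops \<Longrightarrow> a (c *\<^sub>C x) = c *\<^sub>C a x"
  by (simp add: bounded_ops_def)

text \<open>One statement for two constructions: with \<open>S = UNIV\<close> the operator
  \<open>b\<close> is the adjoint of \<open>a\<close>, and with \<open>a = id_blinfun\<close> it is
  the orthogonal projection onto \<open>S\<close>.\<close>

lemma Riesz_operator:
  fixes a :: "'h::complex_hilbert_space \<Rightarrow>\<^sub>L 'h"
  assumes S: "subspace S" "closed S" "\<And>x c. x \<in> S \<Longrightarrow> c *\<^sub>C x \<in> S" and a: "a \<in> bounded_ops"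
  shows "\<exists>b\<in>bounded_ops. \<forall>x. blinfun_apply b x \<in> S \<and> (\<forall>y\<in>S. cinner (b x) y = cinner x (a y))"
proof -
  have "\<exists>z\<in>S. \<forall>y\<in>S. cinner z y = cinner x (a y)" for x
  proof -
    have "bounded_linear (\<lambda>y. Re (cinner x (a y)))"
      by (intro bounded_linear_compose[OF bounded_linear_Re]
            bounded_linear_compose[OF cinner.bounded_linear_right] blinfun.bounded_linear_right)
    then obtain z where z: "z \<in> S" "\<And>y. y \<in> S \<Longrightarrow> Re (cinner z y) = Re (cinner x (a y))"
      using Riesz_representation_real[OF S(1,2)] by blast
    \<comment> \<open>The identity of real parts, applied also to i times \<open>y\<close>, yields
      the imaginary parts. Here \<open>S\<close> has to be a complex subspace.\<close>
    have "cinner z y = cinner x (a y)" if "y \<in> S" for y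
      using z(2)[OF that] z(2)[OF S(3)[OF that], of "\<i>"] a
      by (simp add: bounded_opsD cinner_scaleC_right complex_eq_iff)
    then show ?thesis using z by blast
  qed
  then obtain B where BS: "\<And>x. B x \<in> S" and B: "\<And>x y. y \<in> S \<Longrightarrow> cinner (B x) y = cinner x (a y)"
    by metis
  have uniq: "u = v" if "u \<in> S" "v \<in> S" "\<And>y. y \<in> S \<Longrightarrow> cinner u y = cinner v y" for u v
  proof -
    have "cinner (u - v) (u - v) = 0"
      using that(3)[of "u - v"] S(1) that(1,2) by (simp add: cinner.diff_left subspace_diff)
    then show ?thesis by (simp add: cinner_self)
  qed
  have add: "B (x + y) = B x + B y" for x y
    by (rule uniq) (auto simp: BS B subspace_add[OF S(1)] cinner_add_left)
  have scaleC: "B (c *\<^sub>C x) = c *\<^sub>C B x" for c x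
    by (rule uniq) (auto simp: BS B S(3) cinner_scaleC_left)
  have "bounded_linear B"
  proof (rule bounded_linear_intro[where K = "norm a"])
    show "B (r *\<^sub>R x) = r *\<^sub>R B x" for r x using scaleC[of "of_real r" x] by (simp add: scaleC_of_real)
    fix x
    have "(norm (B x))\<^sup>2 = Re (cinner x (a (B x)))"
      using B[OF BS, of x x] by (metis Re_cinner_self)
    also have "\<dots> \<le> norm x * norm (a (B x))" using Re_cinner_le_norm[of x "a (B x)"] by linarith
    also have "\<dots> \<le> norm x * (norm a * norm (B x))"
      by (intro mult_left_mono norm_blinfun) auto
    finally have "norm (B x) * norm (B x) \<le> (norm x * norm a) * norm (B x)"
      by (simp add: power2_eq_square mult.assoc)
    then show "norm (B x) \<le> norm x * norm a"
      by (metis mult_right_le_imp_le norm_ge_zero less_eq_real_def mult_nonneg_nonneg)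
  qed (rule add)
  then have "blinfun_apply (Blinfun B) = B" by (rule bounded_linear_Blinfun_apply)
  then show ?thesis using BS B scaleC by (intro bexI[of _ "Blinfun B"]) (auto simp: bounded_ops_def)
qed

lemma blinfun_cinner_eqI:
  fixes a b :: "'h::complex_hilbert_space \<Rightarrow>\<^sub>L 'h"
  assumes "\<And>x y. cinner (a x) y = cinner (b x) y" shows "a = b"
  using assms by (metis blinfun_eqI cinner_eqI)

lemma adj_eqI:
  fixes a b :: "'h::complex_hilbert_space \<Rightarrow>\<^sub>L 'h"
  assumes "\<And>x y. cinner (b x) y = cinner x (a y)"
  shows "adj a = b"
  unfolding adj_def
proof (rule the_equality)
  fix b' :: "'h \<Rightarrow>\<^sub>L 'h" assume b': "\<forall>x y. cinner (b' x) y = cinner x (a y)"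
  show "b' = b"
    by (rule blinfun_cinner_eqI) (use assms b' in simp)
qed (use assms in blast)

lemma adj:
  assumes "a \<in> bounded_ops"
  shows "cinner (adj a x) y = cinner x (a y)" and "adj a \<in> bounded_ops"
proof -
  obtain b where b: "b \<in> bounded_ops" "\<And>x y. cinner (blinfun_apply b x) y = cinner x (a y)"
    using Riesz_operator[of UNIV, OF _ _ _ assms] by auto
  then have "adj a = b" by (intro adj_eqI)
  then show "cinner (adj a x) y = cinner x (a y)" "adj a \<in> bounded_ops" using b by auto
qed

lemma adj_right: "a \<in> bounded_ops \<Longrightarrow> cinner x (adj a y) = cinner (a x) y"
  by (metis adj(1) cinner_commute)

section \<open>Hermitian operators\<close>

text \<open>Symmetry is put in terms of the inner product, because \<open>adj\<close> is a definite
  description; \<open>hermitian_iff_adj\<close> reconciles the two.\<close>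

definition hermitian :: "('h::complex_hilbert_space \<Rightarrow>\<^sub>L 'h) \<Rightarrow> bool"
  where "hermitian a \<longleftrightarrow> a \<in> bounded_ops \<and> (\<forall>x y. cinner (a x) y = cinner x (a y))"

text \<open>Taking the real part loses nothing for hermitian operators
  (\<open>hermitian_cinner_eq\<close>), and for a general bounded operator it yields the form of its
  real part (\<open>hermitian_Re_op\<close>).\<close>

definition quad_form :: "('h::complex_hilbert_space \<Rightarrow>\<^sub>L 'h) \<Rightarrow> 'h \<Rightarrow> real"
  where "quad_form a x = Re (cinner x (a x))"

lemma hermitian_iff_adj: "hermitian a \<longleftrightarrow> a \<in> bounded_ops \<and> adj a = a"
  unfolding hermitian_def using adj(1) adj_eqI by metis

lemma hermitianD: "hermitian a \<Longrightarrow> cinner (a x) y = cinner x (a y)"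
  and hermitian_bounded_ops: "hermitian a \<Longrightarrow> a \<in> bounded_ops"
  by (auto simp: hermitian_def)

lemma hermitian_cinner_eq: "hermitian a \<Longrightarrow> cinner x (a x) = of_real (quad_form a x)"
  unfolding quad_form_def
  by (metis cinner_commute hermitianD complex_cnj_cancel_iff complex_is_Real_iff Reals_cnj_iff of_real_Re)

lemma positive_op_iff: "hermitian a \<Longrightarrow> positive_op a \<longleftrightarrow> (\<forall>x. 0 \<le> quad_form a x)"
  unfolding positive_op_def using hermitian_cinner_eq[of a]
  by (auto simp: hermitian_bounded_ops complex_nonneg_Reals_iff)

lemma bounded_ops_intros [intro]:
  "id_blinfun \<in> bounded_ops" "0 \<in> bounded_ops"
  "a \<in> bounded_ops \<Longrightarrow> b \<in> bounded_ops \<Longrightarrow> a + b \<in> bounded_ops"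
  "a \<in> bounded_ops \<Longrightarrow> b \<in> bounded_ops \<Longrightarrow> a - b \<in> bounded_ops"
  "a \<in> bounded_ops \<Longrightarrow> r *\<^sub>R a \<in> bounded_ops"
  "a \<in> bounded_ops \<Longrightarrow> b \<in> bounded_ops \<Longrightarrow> a o\<^sub>L b \<in> bounded_ops"
  by (auto simp: bounded_ops_def blinfun.bilinear_simps scaleC_add_right scaleC_diff_right scaleC_scaleR_right
      scaleC_zero_right)

lemma hermitian_intros [intro]:
  "hermitian id_blinfun" "hermitian 0"
  "hermitian a \<Longrightarrow> hermitian b \<Longrightarrow> hermitian (a + b)"
  "hermitian a \<Longrightarrow> hermitian b \<Longrightarrow> hermitian (a - b)"
  "hermitian a \<Longrightarrow> hermitian (r *\<^sub>R a)"
  by (auto simp: hermitian_def blinfun.bilinear_simps cinner.add_left cinner.add_right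
      cinner.diff_left cinner.diff_right cinner.scaleR_left cinner.scaleR_right)

lemma hermitian_compose:
  "hermitian a \<Longrightarrow> hermitian b \<Longrightarrow> a o\<^sub>L b = b o\<^sub>L a \<Longrightarrow> hermitian (a o\<^sub>L b)"
  by (auto simp: hermitian_def) (metis blinfun_apply_blinfun_compose)

lemma hermitian_limit:
  assumes "\<And>n. hermitian (X n)" "X \<longlonglongrightarrow> a" shows "hermitian a"
proof -
  have lim: "(\<lambda>n. X n x) \<longlonglongrightarrow> a x" for x
    using assms(2) by (rule blinfun.tendsto[OF _ tendsto_const])
  have "a (c *\<^sub>C x) = c *\<^sub>C a x" for c x
  proof (rule LIMSEQ_unique[OF lim])
    show "(\<lambda>n. X n (c *\<^sub>C x)) \<longlonglongrightarrow> c *\<^sub>C a x"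
      using tendsto_scaleC[OF lim[of x], of c] assms(1) by (simp add: bounded_opsD hermitian_bounded_ops)
  qed
  moreover have "cinner (a x) y = cinner x (a y)" for x y
  proof (rule LIMSEQ_unique)
    show "(\<lambda>n. cinner (X n x) y) \<longlonglongrightarrow> cinner (a x) y" by (intro cinner.tendsto lim tendsto_const)
    show "(\<lambda>n. cinner (X n x) y) \<longlonglongrightarrow> cinner x (a y)"
      using cinner.tendsto[OF tendsto_const lim[of y], of x] assms(1) by (simp add: hermitianD)
  qed
  ultimately show ?thesis by (auto simp: hermitian_def bounded_ops_def)
qed

lemma quad_form_simps:
  "quad_form (a + b) x = quad_form a x + quad_form b x"
  "quad_form (a - b) x = quad_form a x - quad_form b x"
  "quad_form (r *\<^sub>R a) x = r * quad_form a x"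
  "quad_form id_blinfun x = (norm x)\<^sup>2"
  "quad_form 0 x = 0"
  "quad_form a 0 = 0"
  by (auto simp: quad_form_def blinfun.bilinear_simps cinner.add_right cinner.diff_right
      cinner.scaleR_right Re_cinner_self cinner.zero_right cinner.zero_left)

lemma quad_form_sum: "quad_form (\<Sum>i\<in>I. f i) x = (\<Sum>i\<in>I. quad_form (f i) x)"
  by (induction I rule: infinite_finite_induct) (auto simp: quad_form_simps)

lemma abs_quad_form_le: "\<bar>quad_form a x\<bar> \<le> norm a * (norm x)\<^sup>2"
proof -
  have "\<bar>quad_form a x\<bar> \<le> norm x * norm (a x)" unfolding quad_form_def by (rule Re_cinner_le_norm)
  also have "\<dots> \<le> norm x * (norm a * norm x)" by (intro mult_left_mono norm_blinfun) auto
  finally show ?thesis by (simp add: power2_eq_square mult_ac)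
qed

lemma hermitian_Re_cinner_swap:
  "hermitian a \<Longrightarrow> Re (cinner x (a y)) = Re (cinner y (a x))"
  by (metis Re_cinner_commute hermitianD)

lemma quad_form_add:
  assumes "hermitian a"
  shows "quad_form a (x + y) = quad_form a x + 2 * Re (cinner x (a y)) + quad_form a y"
  using hermitian_Re_cinner_swap[OF assms, of x y]
  by (simp add: quad_form_def blinfun.bilinear_simps cinner.add_left cinner.add_right)

lemma quad_form_scaleR: "quad_form a (t *\<^sub>R x) = t\<^sup>2 * quad_form a x"
  by (simp add: quad_form_def blinfun.bilinear_simps cinner.scaleR_left cinner.scaleR_right power2_eq_square)

lemma quad_form_eq_imp_eq:
  assumes "hermitian a" "hermitian b" "\<And>x. quad_form a x = quad_form b x"
  shows "a = b"
proof (rule blinfun_eqI)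
  fix x
  let ?d = "a - b"
  have d: "hermitian ?d" using assms by auto
  \<comment> \<open>Polarization against the vector \<open>?d x\<close>: the two square terms
    vanish, and the mixed term is twice its squared norm.\<close>
  have "0 = quad_form ?d (?d x + x)" using assms(3) by (simp add: quad_form_simps)
  also have "\<dots> = 2 * (norm (?d x))\<^sup>2"
    unfolding quad_form_add[OF d] using assms(3) by (simp add: quad_form_simps Re_cinner_self del: blinfun.diff_left)
  finally show "a x = b x" by (simp add: blinfun.diff_left)
qed

text \<open>Cauchy--Schwarz for the form \<open>\<langle>x, a y\<rangle>\<close>, at \<open>y = a x\<close>.\<close>

lemma quad_form_zero_imp_kernel:
  assumes "hermitian a" "\<And>t. 0 \<le> quad_form a (x + t *\<^sub>R a x)" "quad_form a x = 0"
  shows "a x = 0"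
proof -
  have "((norm (a x))\<^sup>2)\<^sup>2 \<le> 0 * \<bar>quad_form a (a x)\<bar>"
  proof (rule quadratic_form_Cauchy_Schwarz)
    fix t :: real
    have "0 \<le> quad_form a x + 2 * t * (norm (a x))\<^sup>2 + t\<^sup>2 * quad_form a (a x)"
      using assms(2)[of t] hermitian_Re_cinner_swap[OF assms(1), of "a x" x]
      by (simp add: quad_form_add[OF assms(1)] quad_form_scaleR blinfun.scaleR_right
          cinner_scaleR_right Re_cinner_self)
    moreover have "t\<^sup>2 * quad_form a (a x) \<le> t\<^sup>2 * \<bar>quad_form a (a x)\<bar>"
      by (intro mult_left_mono) auto
    ultimately show "0 \<le> 0 + 2 * t * (norm (a x))\<^sup>2 + t\<^sup>2 * \<bar>quad_form a (a x)\<bar>"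
      using assms(3) by linarith
  qed auto
  then show ?thesis by simp
qed

section \<open>Projections\<close>

lemma projection_op_iff: "projection_op p \<longleftrightarrow> hermitian p \<and> p o\<^sub>L p = p"
  unfolding projection_op_def hermitian_iff_adj by blast

lemma projection_apply_apply [simp]: "projection_op p \<Longrightarrow> p (p x) = p x"
  by (metis blinfun_apply_blinfun_compose projection_op_iff)

lemma quad_form_projection: "projection_op p \<Longrightarrow> quad_form p x = (norm (p x))\<^sup>2"
  unfolding quad_form_def Re_cinner_self[symmetric]
  by (metis hermitianD projection_op_iff projection_apply_apply)

lemma projection_compl: "projection_op p \<Longrightarrow> projection_op (id_blinfun - p)"
  unfolding projection_op_iff
  by (auto intro!: blinfun_eqI simp: blinfun.bilinear_simps)
     (metis blinfun_apply_blinfun_compose)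

lemma projection_norm_split:
  "projection_op p \<Longrightarrow> (norm x)\<^sup>2 = (norm (p x))\<^sup>2 + (norm (x - p x))\<^sup>2"
  using quad_form_projection[OF projection_compl, of p x] quad_form_projection[of p x]
  by (simp add: quad_form_simps blinfun.bilinear_simps)

lemma projection_norm_le: "projection_op p \<Longrightarrow> norm (p x) \<le> norm x"
  using projection_norm_split[of p x] by (smt (verit) power2_le_imp_le norm_ge_zero zero_le_power2)

lemma projection_0: "projection_op 0" and projection_id: "projection_op id_blinfun"
  by (auto simp: projection_op_iff intro!: blinfun_eqI)

lemma compose_apply_commute: "a o\<^sub>L b = b o\<^sub>L a \<Longrightarrow> a (b x) = b (a x)"
  by (metis blinfun_apply_blinfun_compose)

lemma quad_form_reduced:
  assumes "projection_op p" "hermitian a" "a o\<^sub>L p = p o\<^sub>L a"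
  shows "quad_form (a o\<^sub>L p) x = quad_form a (p x)"
  unfolding quad_form_def
  using assms by (metis blinfun_apply_blinfun_compose hermitianD projection_op_iff projection_apply_apply)

text \<open>The commutation clause is what later places spectral projections in M and makes them
  commute with each other. If \<open>d\<close> commutes with the hermitian \<open>a\<close>, then so
  does \<open>adj d\<close>; hence the kernel is invariant under both, and a projection onto such a
  subspace commutes with \<open>d\<close>.\<close>

lemma kernel_projection:
  assumes a: "hermitian a"
  obtains p where "projection_op p" "\<And>x. a (p x) = 0" "\<And>x. a x = 0 \<Longrightarrow> p x = x"
    "\<And>d. d \<in> bounded_ops \<Longrightarrow> a o\<^sub>L d = d o\<^sub>L a \<Longrightarrow> p o\<^sub>L d = d o\<^sub>L p"
proof -
  define S where "S = {x. a x = 0}"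
  have S: "subspace S" "closed S" "\<And>x c. x \<in> S \<Longrightarrow> c *\<^sub>C x \<in> S"
  proof -
    show "subspace S" by (auto simp: S_def subspace_def blinfun.bilinear_simps)
    show "closed S" unfolding S_def
      by (intro closed_Collect_eq continuous_intros)
    show "\<And>x c. x \<in> S \<Longrightarrow> c *\<^sub>C x \<in> S"
      using a by (auto simp: S_def bounded_opsD hermitian_bounded_ops scaleC_zero_right)
  qed
  obtain p where p: "p \<in> bounded_ops" "\<And>x. p x \<in> S"
      "\<And>x y. y \<in> S \<Longrightarrow> cinner (blinfun_apply p x) y = cinner x y"
    using Riesz_operator[OF S bounded_ops_intros(1)] by auto
  have fixed: "p x = x" if "x \<in> S" for x
  proof -
    have "cinner (p x - x) (p x - x) = 0"
      using p(3)[of "p x - x" x] p(2) that S(1) by (simp add: cinner.diff_left subspace_diff)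
    then show ?thesis by (simp add: cinner_self)
  qed
  have herm: "cinner (p x) y = cinner x (p y)" for x y
    using p(3)[OF p(2), of x y] p(3)[OF p(2), of y x] by (metis cinner_commute)
  have proj: "projection_op p"
    using p herm fixed by (auto simp: projection_op_iff hermitian_def intro!: blinfun_eqI)
  have inv: "d (p x) = p (d (p x))" if "d \<in> bounded_ops" "a o\<^sub>L d = d o\<^sub>L a" for d x
  proof -
    have "a (d (p x)) = d (a (p x))" using that(2) by (rule compose_apply_commute)
    also have "\<dots> = 0" using p(2) by (simp add: S_def blinfun.zero_right)
    finally show ?thesis using fixed by (simp add: S_def)
  qed
  have comm: "p o\<^sub>L d = d o\<^sub>L p" if d: "d \<in> bounded_ops" "a o\<^sub>L d = d o\<^sub>L a" for d
  proof -
    have "cinner ((a o\<^sub>L adj d) x) y = cinner ((adj d o\<^sub>L a) x) y" for x y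
      using a d compose_apply_commute[OF d(2), of y] by (simp add: hermitianD adj)
    then have ad: "a o\<^sub>L adj d = adj d o\<^sub>L a" by (rule blinfun_cinner_eqI)
    have "cinner (p (d x)) y = cinner (d (p x)) y" for x y
    proof -
      have "cinner (p (d x)) y = cinner x (adj d (p y))" using d by (simp add: herm adj_right)
      also have "\<dots> = cinner x (p (adj d (p y)))" using inv[OF adj(2)[OF d(1)] ad] by metis
      also have "\<dots> = cinner (p (d (p x))) y" using d by (metis herm adj_right)
      also have "\<dots> = cinner (d (p x)) y" using inv[OF d] by metis
      finally show ?thesis .
    qed
    then show ?thesis by (intro blinfun_cinner_eqI) simp
  qed
  show thesis
    by (rule that[OF proj _ _ comm]) (use p(2) fixed in \<open>auto simp: S_def\<close>)
qed


section \<open>Square roots and absolute values\<close>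

lemma blinfun_compose_limits:
  fixes d a :: "'h::real_normed_vector \<Rightarrow>\<^sub>L 'h"
  assumes "\<And>n. X n o\<^sub>L d = d o\<^sub>L X n" "X \<longlonglongrightarrow> a"
  shows "a o\<^sub>L d = d o\<^sub>L a"
proof -
  have "(\<lambda>n. X n o\<^sub>L d) \<longlonglongrightarrow> (a o\<^sub>L d)" "(\<lambda>n. d o\<^sub>L X n) \<longlonglongrightarrow> (d o\<^sub>L a)"
    by (intro bounded_bilinear.tendsto[OF bounded_bilinear_blinfun_compose] assms(2) tendsto_const)+
  then show ?thesis using assms(1) LIMSEQ_unique by auto
qed

lemma compose_commute_simps:
  fixes a b d :: "'h::real_normed_vector \<Rightarrow>\<^sub>L 'h"
  shows "a o\<^sub>L d = d o\<^sub>L a \<Longrightarrow> b o\<^sub>L d = d o\<^sub>L b \<Longrightarrow> (a + b) o\<^sub>L d = d o\<^sub>L (a + b)"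
    and "a o\<^sub>L d = d o\<^sub>L a \<Longrightarrow> b o\<^sub>L d = d o\<^sub>L b \<Longrightarrow> (a - b) o\<^sub>L d = d o\<^sub>L (a - b)"
    and "a o\<^sub>L d = d o\<^sub>L a \<Longrightarrow> (r *\<^sub>R a) o\<^sub>L d = d o\<^sub>L (r *\<^sub>R a)"
    and "a o\<^sub>L d = d o\<^sub>L a \<Longrightarrow> b o\<^sub>L d = d o\<^sub>L b \<Longrightarrow> (a o\<^sub>L b) o\<^sub>L d = d o\<^sub>L (a o\<^sub>L b)"
    and "id_blinfun o\<^sub>L d = d o\<^sub>L id_blinfun"
    and "0 o\<^sub>L d = d o\<^sub>L 0"
  by (simp_all add: blinfun_apply_inject[symmetric] fun_eq_iff blinfun.bilinear_simps)

text \<open>The iteration \<open>y \<mapsto> (x + y\<^sup>2)/2\<close> converges to \<open>1 - (1 - x)\<^sup>1\<^sup>/\<^sup>2\<close>; it is dominated in norm by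
  the scalar iteration at \<open>x = 1\<close>, which increases to 1.\<close>

primrec sqrt_iter :: "('h::complex_hilbert_space \<Rightarrow>\<^sub>L 'h) \<Rightarrow> nat \<Rightarrow> 'h \<Rightarrow>\<^sub>L 'h"
  where "sqrt_iter x 0 = 0"
  | "sqrt_iter x (Suc n) = (1/2) *\<^sub>R (x + (sqrt_iter x n o\<^sub>L sqrt_iter x n))"

primrec sqrt_iter_bound :: "nat \<Rightarrow> real"
  where "sqrt_iter_bound 0 = 0"
  | "sqrt_iter_bound (Suc n) = (1 + (sqrt_iter_bound n)\<^sup>2) / 2"

lemma sqrt_iter_bound_range: "0 \<le> sqrt_iter_bound n \<and> sqrt_iter_bound n \<le> 1"
  by (induction n) (auto simp: abs_square_le_1)

lemma sqrt_iter_commute: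
  "x o\<^sub>L d = d o\<^sub>L x \<Longrightarrow> sqrt_iter x n o\<^sub>L d = d o\<^sub>L sqrt_iter x n"
  by (induction n) (simp_all only: sqrt_iter.simps compose_commute_simps)

lemma sqrt_iter_commute_iter: "sqrt_iter x m o\<^sub>L sqrt_iter x n = sqrt_iter x n o\<^sub>L sqrt_iter x m"
  by (rule sqrt_iter_commute, rule sym, rule sqrt_iter_commute) simp

lemma hermitian_sqrt_iter: "hermitian x \<Longrightarrow> hermitian (sqrt_iter x n)"
  by (induction n) (auto intro!: hermitian_compose)

lemma norm_sqrt_iter: "norm x \<le> 1 \<Longrightarrow> norm (sqrt_iter x n) \<le> sqrt_iter_bound n"
proof (induction n)
  case (Suc n)
  let ?y = "sqrt_iter x n"
  have "norm (?y o\<^sub>L ?y) \<le> norm ?y * norm ?y" by (rule norm_blinfun_compose)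
  also have "\<dots> \<le> (sqrt_iter_bound n)\<^sup>2"
    unfolding power2_eq_square using Suc sqrt_iter_bound_range[of n] by (intro mult_mono) auto
  finally have "norm (x + (?y o\<^sub>L ?y)) \<le> 1 + (sqrt_iter_bound n)\<^sup>2"
    using Suc.prems norm_triangle_ineq[of x "?y o\<^sub>L ?y"] by linarith
  then show ?case by simp
qed simp

lemma norm_sqrt_iter_step:
  assumes "norm x \<le> 1"
  shows "norm (sqrt_iter x (Suc n) - sqrt_iter x n) \<le> sqrt_iter_bound (Suc n) - sqrt_iter_bound n"
proof (induction n)
  case 0
  then show ?case using assms by simp
next
  case (Suc n)
  let ?y = "sqrt_iter x n" and ?z = "sqrt_iter x (Suc n)"
  let ?r = "sqrt_iter_bound n" and ?s = "sqrt_iter_bound (Suc n)"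
  have "sqrt_iter x (Suc (Suc n)) - ?z = (1/2) *\<^sub>R ((?z o\<^sub>L ?z) - (?y o\<^sub>L ?y))"
    by (simp only: sqrt_iter.simps(2)[of x "Suc n"]) (simp add: algebra_simps)
  \<comment> \<open>The difference of squares factors because iterates commute; the norm estimate
    then reproduces the scalar recursion exactly.\<close>
  also have "(?z o\<^sub>L ?z) - (?y o\<^sub>L ?y) = (?z - ?y) o\<^sub>L (?z + ?y)"
    using compose_apply_commute[OF sqrt_iter_commute_iter[of x n "Suc n"]]
    by (intro blinfun_eqI) (simp add: blinfun.bilinear_simps del: sqrt_iter.simps)
  finally have "norm (sqrt_iter x (Suc (Suc n)) - ?z) = norm ((?z - ?y) o\<^sub>L (?z + ?y)) / 2"
    by simp
  also have "\<dots> \<le> norm (?z - ?y) * norm (?z + ?y) / 2"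
    by (intro divide_right_mono norm_blinfun_compose) simp
  also have "\<dots> \<le> (?s - ?r) * (?s + ?r) / 2"
  proof (intro divide_right_mono mult_mono Suc.IH)
    show "norm (?z + ?y) \<le> ?s + ?r"
      using norm_triangle_ineq[of ?z ?y] norm_sqrt_iter[OF assms, of n] norm_sqrt_iter[OF assms, of "Suc n"]
      by linarith
    show "0 \<le> ?s - ?r" using Suc.IH norm_ge_zero order.trans by blast
  qed auto
  also have "\<dots> = sqrt_iter_bound (Suc (Suc n)) - ?s"
    by (simp add: power2_eq_square field_simps)
  finally show ?case .
qed

lemma sqrt_iter_bound_mono: "m \<le> n \<Longrightarrow> sqrt_iter_bound m \<le> sqrt_iter_bound n"
proof (rule lift_Suc_mono_le[of sqrt_iter_bound])
  fix n
  \<comment> \<open>The increment of the scalar iteration is half of this square.\<close>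
  have "0 \<le> (1 - sqrt_iter_bound n)\<^sup>2" by simp
  then show "sqrt_iter_bound n \<le> sqrt_iter_bound (Suc n)"
    by (simp add: power2_eq_square algebra_simps)
qed

lemma convergent_sqrt_iter:
  assumes "norm x \<le> 1" shows "convergent (sqrt_iter x)"
proof -
  have step: "norm (sqrt_iter x (m + k) - sqrt_iter x m) \<le> sqrt_iter_bound (m + k) - sqrt_iter_bound m"
    for m k
  proof (induction k)
    case (Suc k)
    have "norm (sqrt_iter x (m + Suc k) - sqrt_iter x m)
      \<le> norm (sqrt_iter x (Suc (m + k)) - sqrt_iter x (m + k)) + norm (sqrt_iter x (m + k) - sqrt_iter x m)"
      using norm_triangle_ineq[of "sqrt_iter x (Suc (m + k)) - sqrt_iter x (m + k)"
          "sqrt_iter x (m + k) - sqrt_iter x m"] by (simp del: sqrt_iter.simps)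
    then show ?case using Suc norm_sqrt_iter_step[OF assms, of "m + k"] by simp
  qed simp
  have "convergent sqrt_iter_bound"
    by (rule Bseq_mono_convergent)
      (use sqrt_iter_bound_range sqrt_iter_bound_mono in \<open>auto intro!: BseqI'[of _ 1]\<close>)
  then have C: "Cauchy sqrt_iter_bound" by (simp add: Cauchy_convergent_iff)
  have "Cauchy (sqrt_iter x)"
  proof (rule CauchyI')
    fix e :: real assume "e > 0"
    then obtain N where N: "\<And>m n. m \<ge> N \<Longrightarrow> n \<ge> N \<Longrightarrow> norm (sqrt_iter_bound m - sqrt_iter_bound n) < e"
      using CauchyD[OF C] by blast
    have "norm (sqrt_iter x m - sqrt_iter x n) < e" if "m \<ge> N" "n > m" for m n
    proof -
      obtain k where k: "n = m + k" using \<open>n > m\<close> less_imp_add_positive by blast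
      show ?thesis
        using step[of m k] N[of n m] that by (simp add: k norm_minus_commute)
    qed
    then show "\<exists>M. \<forall>m\<ge>M. \<forall>n>m. dist (sqrt_iter x m) (sqrt_iter x n) < e" unfolding dist_norm by blast
  qed
  then show ?thesis by (simp add: Cauchy_convergent_iff)
qed

text \<open>\<open>s\<close> is the absolute value of \<open>b\<close>. The fixed point equation
  \<open>y = (x + y^2)/2\<close> for \<open>x = 1 - b^2\<close> rearranges to
  \<open>(1 - y)^2 = b^2\<close>, so \<open>s = 1 - y\<close>, and \<open>norm y \<le> 1\<close>
  makes it positive.\<close>

lemma abs_operator_contraction:
  assumes b: "hermitian b" "norm b \<le> 1"
  obtains s where "hermitian s" "\<And>x. 0 \<le> quad_form s x" "s o\<^sub>L s = b o\<^sub>L b"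
    "\<And>d. b o\<^sub>L d = d o\<^sub>L b \<Longrightarrow> s o\<^sub>L d = d o\<^sub>L s"
proof -
  define x where "x = id_blinfun - (b o\<^sub>L b)"
  have bb: "hermitian (b o\<^sub>L b)" by (rule hermitian_compose[OF b(1) b(1) refl])
  have bx: "norm (b v) \<le> norm v" for v
    using norm_blinfun[of b v] b(2) mult_right_mono[of "norm b" 1 "norm v"] by simp
  have x: "hermitian x" unfolding x_def using bb by blast
  \<comment> \<open>Since \<open>b\<close> is hermitian, the cross term of |v - b^2 v|^2 is -2 |b
    v|^2, and this outweighs |b^2 v|^2 because \<open>b\<close> is a contraction.\<close>
  have "norm (x v) \<le> norm v" for v
  proof -
    have "(norm (v + - b (b v)))\<^sup>2 = (norm v)\<^sup>2 - 2 * (norm (b v))\<^sup>2 + (norm (b (b v)))\<^sup>2"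
      using hermitianD[OF b(1), of v "b v"]
      by (simp only: norm_add_square cinner.minus_right norm_minus_cancel) (simp add: Re_cinner_self[symmetric])
    also have "\<dots> \<le> (norm v)\<^sup>2"
      using power_mono[OF bx[of "b v"], of 2] zero_le_power2[of "norm (b v)"]
      by (smt (verit) norm_ge_zero)
    finally show ?thesis
      by (simp add: x_def blinfun.bilinear_simps abs_le_square_iff[symmetric])
  qed
  then have nx: "norm x \<le> 1" by (intro norm_blinfun_bound) auto
  obtain y where y: "sqrt_iter x \<longlonglongrightarrow> y" using convergent_sqrt_iter[OF nx] by (auto simp: convergent_def)
  have "(\<lambda>n. (1/2) *\<^sub>R (x + (sqrt_iter x n o\<^sub>L sqrt_iter x n))) \<longlonglongrightarrow> (1/2) *\<^sub>R (x + (y o\<^sub>L y))"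
    by (intro tendsto_intros bounded_bilinear.tendsto[OF bounded_bilinear_blinfun_compose] y)
  then have "sqrt_iter x \<longlonglongrightarrow> (1/2) *\<^sub>R (x + (y o\<^sub>L y))"
    by (subst filterlim_sequentially_Suc[symmetric]) simp
  then have fixpoint: "y = (1/2) *\<^sub>R (x + (y o\<^sub>L y))" using y LIMSEQ_unique by blast
  have hy: "hermitian y" by (rule hermitian_limit[OF hermitian_sqrt_iter[OF x] y])
  have ny: "norm y \<le> 1"
  proof (rule LIMSEQ_le_const2[OF tendsto_norm[OF y]])
    have "norm (sqrt_iter x n) \<le> 1" for n
      using norm_sqrt_iter[OF nx, of n] sqrt_iter_bound_range[of n] by linarith
    then show "\<exists>N. \<forall>n\<ge>N. norm (sqrt_iter x n) \<le> 1" by blast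
  qed
  have sq: "(id_blinfun - y) o\<^sub>L (id_blinfun - y) = b o\<^sub>L b"
  proof (rule blinfun_eqI)
    fix v
    have "2 *\<^sub>R y v = x v + y (y v)"
      by (subst fixpoint) (simp add: blinfun.bilinear_simps)
    then show "((id_blinfun - y) o\<^sub>L (id_blinfun - y)) v = (b o\<^sub>L b) v"
      by (simp add: blinfun.bilinear_simps x_def scaleR_2 algebra_simps)
  qed
  have comm: "(id_blinfun - y) o\<^sub>L d = d o\<^sub>L (id_blinfun - y)" if "b o\<^sub>L d = d o\<^sub>L b" for d
  proof -
    have "x o\<^sub>L d = d o\<^sub>L x" unfolding x_def using that by (intro compose_commute_simps)
    then have "y o\<^sub>L d = d o\<^sub>L y" by (intro blinfun_compose_limits[OF _ y] sqrt_iter_commute)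
    then show ?thesis by (intro compose_commute_simps)
  qed
  have pos: "0 \<le> quad_form (id_blinfun - y) v" for v
    using abs_quad_form_le[of y v] mult_right_mono[OF ny, of "(norm v)\<^sup>2"] by (simp add: quad_form_simps)
  show thesis by (rule that[OF _ pos sq comm]) (use hy in blast)
qed

text \<open>The projection onto the kernel of the negative part of \<open>b\<close>.\<close>

lemma nonneg_projection:
  assumes b: "hermitian b"
  obtains p where "projection_op p" "\<And>x. 0 \<le> quad_form b (p x)" "\<And>x. quad_form b (x - p x) \<le> 0"
    "\<And>x. b x = 0 \<Longrightarrow> p x = x"
    "\<And>d. d \<in> bounded_ops \<Longrightarrow> b o\<^sub>L d = d o\<^sub>L b \<Longrightarrow> p o\<^sub>L d = d o\<^sub>L p"
proof -
  \<comment> \<open>Rescaling to a contraction; the summand 1 keeps the factor finite and positive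
    when \<open>b = 0\<close>.\<close>
  define r where "r = 1 / (norm b + 1)"
  have np: "norm b + 1 > 0" by (simp add: add_nonneg_pos)
  have r: "r > 0" unfolding r_def using np by simp
  define b1 where "b1 = r *\<^sub>R b"
  have b1: "hermitian b1" "norm b1 \<le> 1" unfolding b1_def using b np by (auto simp: r_def field_simps)
  obtain s where s: "hermitian s" "\<And>x. 0 \<le> quad_form s x" "s o\<^sub>L s = b1 o\<^sub>L b1"
    "\<And>d. b1 o\<^sub>L d = d o\<^sub>L b1 \<Longrightarrow> s o\<^sub>L d = d o\<^sub>L s"
    using abs_operator_contraction[OF b1] by metis
  have sb: "s o\<^sub>L b1 = b1 o\<^sub>L s" by (rule s(4)) simp
  have h: "hermitian (s - b1)" using s b1 by blast
  obtain p where p: "projection_op p" "\<And>x. (s - b1) (blinfun_apply p x) = 0"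
    "\<And>x. (s - b1) x = 0 \<Longrightarrow> blinfun_apply p x = x"
    "\<And>d. d \<in> bounded_ops \<Longrightarrow> (s - b1) o\<^sub>L d = d o\<^sub>L (s - b1) \<Longrightarrow> p o\<^sub>L d = d o\<^sub>L p"
    using kernel_projection[OF h] by metis
  have ss: "s (s x) = b1 (b1 x)" for x using s(3) by (metis blinfun_apply_blinfun_compose)
  \<comment> \<open>Since \<open>s\<close> and \<open>b1\<close> commute and have equal squares,
    \<open>(s - b1)(s + b1) = 0\<close>. Thus the range of \<open>s + b1\<close> lies in the range
    of \<open>p\<close>.\<close>
  have "(s - b1) (s x + b1 x) = 0" for x
    using ss compose_apply_commute[OF sb] by (simp add: blinfun.bilinear_simps)
  then have ps: "p (s x + b1 x) = s x + b1 x" for x by (rule p(3))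
  have pb: "p o\<^sub>L b1 = b1 o\<^sub>L p"
    using b1 sb by (intro p(4) compose_commute_simps hermitian_bounded_ops) auto
  have psc: "p o\<^sub>L s = s o\<^sub>L p"
    using s(1) sb by (intro p(4) compose_commute_simps hermitian_bounded_ops) auto
  have q_b1: "quad_form b1 x = r * quad_form b x" for x by (simp add: b1_def quad_form_simps)
  have "s (p x) = b1 (p x)" for x using p(2)[of x] by (simp add: blinfun.bilinear_simps)
  then have qs: "quad_form b1 (p x) = quad_form s (p x)" for x by (simp add: quad_form_def)
  have 1: "0 \<le> quad_form b (p x)" for x
  proof -
    have "0 \<le> r * quad_form b (p x)" using s(2)[of "p x"] qs[of x] q_b1 by metis
    then show ?thesis using r by (simp add: zero_le_mult_iff)
  qed
  \<comment> \<open>As \<open>p\<close> fixes the range of \<open>s + b1\<close> and commutes with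
    both operators, \<open>s + b1\<close> vanishes on the complement of \<open>p\<close>; there
    \<open>b1\<close> is minus a positive operator.\<close>
  have "b1 (x - p x) = - s (x - p x)" for x
    using ps[of x] compose_apply_commute[OF pb, of x] compose_apply_commute[OF psc, of x]
    by (simp add: blinfun.bilinear_simps algebra_simps eq_neg_iff_add_eq_0)
  then have "quad_form b1 (x - p x) = - quad_form s (x - p x)" for x
    by (simp add: quad_form_def cinner.minus_right)
  then have 2: "quad_form b (x - p x) \<le> 0" for x
    using s(2)[of "x - p x"] r by (simp add: q_b1) (smt (verit) mult_pos_pos)
  have 3: "p x = x" if "b x = 0" for x
  proof (rule p(3))
    have bx: "b1 x = 0" using that by (simp add: b1_def blinfun.bilinear_simps)
    have "cinner (s x) (s x) = 0"
      using ss[of x] bx s(1) by (simp add: hermitianD blinfun.zero_right cinner.zero_right)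
    then show "(s - b1) x = 0" using bx by (simp add: cinner_self blinfun.bilinear_simps)
  qed
  have 4: "p o\<^sub>L d = d o\<^sub>L p" if "d \<in> bounded_ops" "b o\<^sub>L d = d o\<^sub>L b" for d
  proof -
    have "b1 o\<^sub>L d = d o\<^sub>L b1" unfolding b1_def using that(2) by (rule compose_commute_simps)
    then show ?thesis using that(1) s(4) by (intro p(4) compose_commute_simps)
  qed
  show thesis by (rule that[OF p(1) 1 2 3 4])
qed

section \<open>The spectral resolution\<close>

text \<open>Describes \<open>E {..s}\<close> without a measure. Both the constructed projection and
  the one from any spectral measure satisfy it, and uniqueness identifies them. The strict
  inequality on the complement decides the end point: eigenvectors for the value \<open>s\<close>
  belong to the range of \<open>p\<close>.\<close>

definition spectral_cut :: "('h::complex_hilbert_space \<Rightarrow>\<^sub>L 'h) \<Rightarrow> real \<Rightarrow> ('h \<Rightarrow>\<^sub>L 'h) \<Rightarrow> bool"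
  where "spectral_cut a s p \<longleftrightarrow> projection_op p \<and> a o\<^sub>L p = p o\<^sub>L a \<and>
    (\<forall>x. quad_form a (p x) \<le> s * (norm (p x))\<^sup>2) \<and>
    (\<forall>x. p x = 0 \<longrightarrow> x \<noteq> 0 \<longrightarrow> s * (norm x)\<^sup>2 < quad_form a x)"

lemma projection_commute_apply:
  "p o\<^sub>L q = q o\<^sub>L p \<Longrightarrow> projection_op q \<Longrightarrow> q (p (x - q x)) = 0"
  by (metis blinfun.diff_right compose_apply_commute projection_apply_apply right_minus_eq)

text \<open>A nonzero vector in the range of \<open>p\<close> and the kernel of \<open>q\<close>
  would have its form at most \<open>s\<close> and above \<open>t\<close> times its squared norm.
  Commutation makes \<open>p (x - q x)\<close> such a vector.\<close>

lemma spectral_cut_mono: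
  assumes p: "spectral_cut a s p" and q: "spectral_cut a t q" and "s \<le> t" "p o\<^sub>L q = q o\<^sub>L p"
  shows "q (p x) = p x"
proof -
  have pp: "projection_op p" and qq: "projection_op q" using p q by (auto simp: spectral_cut_def)
  define y where "y = p (x - q x)"
  have qy: "q y = 0" unfolding y_def by (rule projection_commute_apply[OF assms(4) qq])
  have "quad_form a y \<le> s * (norm y)\<^sup>2" using p by (simp add: spectral_cut_def y_def)
  also have "\<dots> \<le> t * (norm y)\<^sup>2" using assms(3) by (intro mult_right_mono) auto
  finally have "y = 0" using q qy by (force simp: spectral_cut_def)
  then show ?thesis
    using compose_apply_commute[OF assms(4), of x] by (simp add: y_def blinfun.bilinear_simps)
qed

lemma spectral_cut_unique:
  assumes "spectral_cut a s p" "spectral_cut a s q" "p o\<^sub>L q = q o\<^sub>L p"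
  shows "p = q"
proof (rule blinfun_eqI)
  fix x
  have "q (p x) = p x" by (rule spectral_cut_mono[OF assms(1,2) order_refl assms(3)])
  moreover have "p (q x) = q x" by (rule spectral_cut_mono[OF assms(2,1) order_refl assms(3)[symmetric]])
  ultimately show "p x = q x" using compose_apply_commute[OF assms(3), of x] by simp
qed

lemma spectral_cut_exists:
  assumes a: "hermitian a"
  shows "\<exists>p. spectral_cut a s p \<and> (\<forall>d\<in>bounded_ops. a o\<^sub>L d = d o\<^sub>L a \<longrightarrow> p o\<^sub>L d = d o\<^sub>L p)"
proof -
  let ?b = "s *\<^sub>R id_blinfun - a"
  have b: "hermitian ?b" using a by blast
  obtain p where p: "projection_op p" "\<And>x. 0 \<le> quad_form ?b (blinfun_apply p x)"
    "\<And>x. quad_form ?b (x - blinfun_apply p x) \<le> 0"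
    "\<And>x. ?b x = 0 \<Longrightarrow> blinfun_apply p x = x"
    "\<And>d. d \<in> bounded_ops \<Longrightarrow> ?b o\<^sub>L d = d o\<^sub>L ?b \<Longrightarrow> p o\<^sub>L d = d o\<^sub>L p"
    using nonneg_projection[OF b] by metis
  have comm: "p o\<^sub>L d = d o\<^sub>L p" if "d \<in> bounded_ops" "a o\<^sub>L d = d o\<^sub>L a" for d
    using that by (intro p(5) compose_commute_simps)
  have pa: "p o\<^sub>L a = a o\<^sub>L p" using a by (intro comm) (auto simp: hermitian_bounded_ops)
  \<comment> \<open>\<open>nonneg_projection\<close> gives only the weak inequality. The kernel of
    \<open>p\<close> is invariant under \<open>a\<close>, and the form of \<open>a - s\<close> is
    nonnegative on it, so equality at \<open>x\<close> would force \<open>a x = s x\<close>; but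
    \<open>p\<close> fixes such vectors.\<close>
  have "s * (norm x)\<^sup>2 < quad_form a x" if x: "p x = 0" "x \<noteq> 0" for x
  proof (rule ccontr)
    assume "\<not> ?thesis"
    then have 0: "quad_form (a - s *\<^sub>R id_blinfun) x = 0"
      using p(3)[of x] x(1) by (simp add: quad_form_simps)
    have "(a - s *\<^sub>R id_blinfun) x = 0"
    proof (rule quad_form_zero_imp_kernel[OF _ _ 0])
      show "hermitian (a - s *\<^sub>R id_blinfun)" using a by blast
      fix t
      have "p (a x) = 0" using compose_apply_commute[OF pa, of x] x(1) by (simp add: blinfun.zero_right)
      then have "p (x + t *\<^sub>R (a - s *\<^sub>R id_blinfun) x) = 0"
        using x(1) by (simp add: blinfun.bilinear_simps)
      then show "0 \<le> quad_form (a - s *\<^sub>R id_blinfun) (x + t *\<^sub>R (a - s *\<^sub>R id_blinfun) x)"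
        using p(3)[of "x + t *\<^sub>R (a - s *\<^sub>R id_blinfun) x"] by (simp add: quad_form_simps)
    qed
    then have "?b x = 0" by (simp add: blinfun.bilinear_simps)
    then have "p x = x" by (rule p(4))
    then show False using x by simp
  qed
  then have "spectral_cut a s p"
    using p(1,2) pa by (auto simp: spectral_cut_def quad_form_simps)
  then show ?thesis using comm by blast
qed

text \<open>The choice includes commutation with everything that commutes with \<open>a\<close>,
  because \<open>spectral_cut_unique\<close> compares only commuting candidates. As every cut
  commutes with \<open>a\<close>, it commutes with this one, whence
  \<open>cut_proj_eqI\<close>.\<close>

definition cut_proj :: "('h::complex_hilbert_space \<Rightarrow>\<^sub>L 'h) \<Rightarrow> real \<Rightarrow> 'h \<Rightarrow>\<^sub>L 'h"
  where "cut_proj a s = (SOME p. spectral_cut a s p \<and>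
    (\<forall>d\<in>bounded_ops. a o\<^sub>L d = d o\<^sub>L a \<longrightarrow> p o\<^sub>L d = d o\<^sub>L p))"

lemma cut_proj:
  assumes "hermitian a"
  shows spectral_cut_cut_proj: "spectral_cut a s (cut_proj a s)"
    and cut_proj_commute: "\<And>d. d \<in> bounded_ops \<Longrightarrow> a o\<^sub>L d = d o\<^sub>L a \<Longrightarrow> cut_proj a s o\<^sub>L d = d o\<^sub>L cut_proj a s"
  using someI_ex[OF spectral_cut_exists[OF assms, of s]] unfolding cut_proj_def by auto

lemma cut_proj_eqI:
  assumes a: "hermitian a" and p: "spectral_cut a s p"
  shows "cut_proj a s = p"
proof (rule spectral_cut_unique[OF spectral_cut_cut_proj[OF a] p])
  show "cut_proj a s o\<^sub>L p = p o\<^sub>L cut_proj a s"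
    using p by (intro cut_proj_commute[OF a]) (auto simp: spectral_cut_def projection_op_iff hermitian_def)
qed

context
  fixes a :: "'h::complex_hilbert_space \<Rightarrow>\<^sub>L 'h"
  assumes a: "hermitian a"
begin

lemma projection_cut_proj: "projection_op (cut_proj a s)"
  and cut_proj_commute_self: "a o\<^sub>L cut_proj a s = cut_proj a s o\<^sub>L a"
  and cut_proj_upper: "quad_form a (cut_proj a s x) \<le> s * (norm (cut_proj a s x))\<^sup>2"
  and cut_proj_lower: "cut_proj a s x = 0 \<Longrightarrow> x \<noteq> 0 \<Longrightarrow> s * (norm x)\<^sup>2 < quad_form a x"
  using spectral_cut_cut_proj[OF a, of s] by (auto simp: spectral_cut_def)

lemma hermitian_cut_proj: "hermitian (cut_proj a s)"
  using projection_cut_proj projection_op_iff by blast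

lemma cut_proj_commute_cut_proj: "cut_proj a s o\<^sub>L cut_proj a t = cut_proj a t o\<^sub>L cut_proj a s"
  by (intro cut_proj_commute[OF a] hermitian_bounded_ops hermitian_cut_proj cut_proj_commute_self)

lemma cut_proj_cut_proj: "s \<le> t \<Longrightarrow> cut_proj a t (cut_proj a s x) = cut_proj a s x"
  by (rule spectral_cut_mono[OF spectral_cut_cut_proj[OF a] spectral_cut_cut_proj[OF a] _ cut_proj_commute_cut_proj])

lemma cut_proj_cut_proj': "s \<le> t \<Longrightarrow> cut_proj a s (cut_proj a t x) = cut_proj a s x"
  by (metis cut_proj_cut_proj compose_apply_commute cut_proj_commute_cut_proj)

text \<open>Strict here but weak in \<open>cut_proj_eq_id\<close>: the half line is closed on the
  right, so an eigenvalue \<open>- norm a\<close> would already be counted at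
  \<open>s = - norm a\<close>.\<close>

lemma cut_proj_eq_0: "s < - norm a \<Longrightarrow> cut_proj a s = 0"
proof (rule blinfun_eqI, rule ccontr)
  fix x assume s: "s < - norm a" and "cut_proj a s x \<noteq> blinfun_apply 0 x"
  then have "0 < (norm (cut_proj a s x))\<^sup>2" by simp
  then have "s * (norm (cut_proj a s x))\<^sup>2 < - norm a * (norm (cut_proj a s x))\<^sup>2"
    using s mult_strict_right_mono by blast
  then show False
    using cut_proj_upper[of s x] abs_quad_form_le[of a "cut_proj a s x"] by auto
qed

lemma cut_proj_eq_id: "norm a \<le> s \<Longrightarrow> cut_proj a s = id_blinfun"
proof (rule blinfun_eqI, rule ccontr)
  fix x assume s: "norm a \<le> s" and *: "cut_proj a s x \<noteq> blinfun_apply id_blinfun x"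
  let ?y = "x - cut_proj a s x"
  have "cut_proj a s ?y = 0" by (simp add: blinfun.bilinear_simps projection_cut_proj)
  then have "s * (norm ?y)\<^sup>2 < quad_form a ?y" using * by (intro cut_proj_lower) auto
  moreover have "norm a * (norm ?y)\<^sup>2 \<le> s * (norm ?y)\<^sup>2" using s by (intro mult_right_mono) auto
  ultimately show False using abs_quad_form_le[of a ?y] by linarith
qed

lemma quad_form_cut_diff:
  assumes "s \<le> t" and y: "y = cut_proj a t x - cut_proj a s x"
  shows "s * (norm y)\<^sup>2 \<le> quad_form a y" "quad_form a y \<le> t * (norm y)\<^sup>2"
proof -
  have "cut_proj a s y = 0" unfolding y
    by (simp add: blinfun.bilinear_simps projection_cut_proj cut_proj_cut_proj'[OF assms(1)])
  then show "s * (norm y)\<^sup>2 \<le> quad_form a y"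
    using cut_proj_lower[of s y] by (cases "y = 0") (auto simp: quad_form_simps)
  have "y = cut_proj a t y" unfolding y
    by (simp add: blinfun.bilinear_simps projection_cut_proj cut_proj_cut_proj[OF assms(1)])
  then show "quad_form a y \<le> t * (norm y)\<^sup>2" using cut_proj_upper[of t y] by metis
qed

lemma projection_cut_diff:
  assumes "s \<le> t" shows "projection_op (cut_proj a t - cut_proj a s)"
  unfolding projection_op_iff
proof
  show "hermitian (cut_proj a t - cut_proj a s)" using hermitian_cut_proj by blast
  show "(cut_proj a t - cut_proj a s) o\<^sub>L (cut_proj a t - cut_proj a s) = cut_proj a t - cut_proj a s"
    by (rule blinfun_eqI)
      (simp add: blinfun.bilinear_simps projection_cut_proj cut_proj_cut_proj[OF assms] cut_proj_cut_proj'[OF assms])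
qed

lemma norm_cut_diff:
  assumes "s \<le> t"
  shows "(norm (cut_proj a t x - cut_proj a s x))\<^sup>2 = (norm (cut_proj a t x))\<^sup>2 - (norm (cut_proj a s x))\<^sup>2"
  using quad_form_projection[OF projection_cut_diff[OF assms], of x]
  by (simp add: quad_form_simps quad_form_projection[OF projection_cut_proj] blinfun.bilinear_simps)

lemma norm_cut_proj_mono: "s \<le> t \<Longrightarrow> (norm (cut_proj a s x))\<^sup>2 \<le> (norm (cut_proj a t x))\<^sup>2"
  using norm_cut_diff[of s t x] zero_le_power2[of "norm (cut_proj a t x - cut_proj a s x)"] by linarith

text \<open>The vectors \<open>y n\<close> are Cauchy because their squared distances are
  differences of a convergent decreasing real sequence. Their limit lies in the kernel of the cut at
  \<open>s\<close> and in the range of every cut to the right of \<open>s\<close>, so its form is at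
  most \<open>s\<close> times its squared norm; the strict lower bound of
  \<open>spectral_cut\<close> leaves only 0.\<close>

lemma cut_proj_right_continuous:
  "continuous (at_right s) (\<lambda>t. (norm (cut_proj a t x))\<^sup>2)"
proof -
  define F where "F t = (norm (cut_proj a t x))\<^sup>2" for t
  define t where "t n = s + inverse (real (Suc n))" for n
  define y where "y n = cut_proj a (t n) x - cut_proj a s x" for n
  have t_mono: "t n \<le> t m" if "m \<le> n" for m n
    unfolding t_def using that by simp
  have st: "s \<le> t n" for n by (simp add: t_def)
  have t_lim: "t \<longlonglongrightarrow> s"
    unfolding t_def using tendsto_add[OF tendsto_const LIMSEQ_inverse_real_of_nat, of s] by simp
  have "decseq (\<lambda>n. F (t n))"
    unfolding decseq_def F_def by (intro allI impI norm_cut_proj_mono t_mono)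
  then have "convergent (\<lambda>n. F (t n))"
    by (rule decseq_convergent[where B = 0]) (auto simp: F_def convergent_def)
  then have C: "Cauchy (\<lambda>n. F (t n))" by (simp add: Cauchy_convergent_iff)
  have "Cauchy y"
  proof (rule CauchyI')
    fix e :: real assume "e > 0"
    then obtain N where N: "\<And>m n. m \<ge> N \<Longrightarrow> n \<ge> N \<Longrightarrow> norm (F (t m) - F (t n)) < e\<^sup>2"
      using CauchyD[OF C, of "e\<^sup>2"] by (meson zero_less_power)
    have "norm (y m - y n) < e" if "m \<ge> N" "n > m" for m n
    proof -
      have "y m - y n = cut_proj a (t m) x - cut_proj a (t n) x" by (simp add: y_def)
      then have "(norm (y m - y n))\<^sup>2 = F (t m) - F (t n)"
        using norm_cut_diff[OF t_mono[of m n], of x] that by (simp add: F_def)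
      also have "\<dots> < e\<^sup>2" using N[of m n] that by auto
      finally show ?thesis using \<open>e > 0\<close> by (simp add: power2_less_imp_less)
    qed
    then show "\<exists>M. \<forall>m\<ge>M. \<forall>n>m. dist (y m) (y n) < e" unfolding dist_norm by blast
  qed
  then obtain z where z: "y \<longlonglongrightarrow> z" by (auto simp: Cauchy_convergent_iff convergent_def)
  have lim: "(\<lambda>n. cut_proj a r (y n)) \<longlonglongrightarrow> cut_proj a r z" for r
    by (intro blinfun.tendsto tendsto_const z)
  have "cut_proj a s (y n) = 0" for n
    by (simp add: y_def blinfun.bilinear_simps projection_cut_proj cut_proj_cut_proj'[OF st])
  then have sz: "cut_proj a s z = 0" using LIMSEQ_unique[OF lim[of s]] by simp
  have upper: "quad_form a z \<le> t m * (norm z)\<^sup>2" for m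
  proof -
    have "cut_proj a (t m) (y n) = y n" if "m \<le> n" for n
      by (simp add: y_def blinfun.bilinear_simps cut_proj_cut_proj[OF st] cut_proj_cut_proj[OF t_mono[OF that]])
    then have "(\<lambda>n. cut_proj a (t m) (y n)) \<longlonglongrightarrow> z"
      by (intro Lim_transform_eventually[OF z] eventually_sequentiallyI[of m]) simp
    then have "cut_proj a (t m) z = z" using LIMSEQ_unique[OF lim] by blast
    then show ?thesis using cut_proj_upper[of "t m" z] by simp
  qed
  have "quad_form a z \<le> s * (norm z)\<^sup>2"
    by (rule LIMSEQ_le_const[OF tendsto_mult[OF t_lim tendsto_const]]) (use upper in blast)
  then have "z = 0" using cut_proj_lower[OF sz] by fastforce
  then have "(\<lambda>n. (norm (y n))\<^sup>2) \<longlonglongrightarrow> 0" using tendsto_power[OF tendsto_norm[OF z], of 2] by simp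
  moreover have "F (t n) = F s + (norm (y n))\<^sup>2" for n
    unfolding y_def norm_cut_diff[OF st] by (simp add: F_def)
  ultimately have Ft: "(\<lambda>n. F (t n)) \<longlonglongrightarrow> F s" using tendsto_add[OF tendsto_const, of _ 0 sequentially "F s"] by simp
  have "(F \<longlongrightarrow> F s) (at_right s)"
  proof (rule order_tendstoI)
    fix l assume "l < F s"
    then have "\<forall>r>s. l < F r"
      unfolding F_def by (meson less_imp_le less_le_trans norm_cut_proj_mono)
    then show "\<forall>\<^sub>F r in at_right s. l < F r" by (auto simp: eventually_at_right_field intro: exI[of _ "s + 1"])
  next
    fix u assume "F s < u"
    then obtain n where n: "F (t n) < u"
      using order_tendstoD(2)[OF Ft] by (auto simp: eventually_sequentially)
    have "F r < u" if "r < t n" for r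
      unfolding F_def
      by (rule order.strict_trans1[OF norm_cut_proj_mono n[unfolded F_def]]) (use that in simp)
    moreover have "s < t n" by (simp add: t_def)
    ultimately show "\<forall>\<^sub>F r in at_right s. F r < u" by (auto simp: eventually_at_right_field)
  qed
  then show ?thesis unfolding continuous_within F_def .
qed

end


section \<open>Sums of orthogonal projections\<close>

lemma quad_form_le_norm_imp_orthogonal:
  assumes "projection_op p" "projection_op q" "\<And>x. quad_form p x + quad_form q x \<le> (norm x)\<^sup>2"
  shows "p (q x) = 0"
  using assms(3)[of "q x"] by (simp add: quad_form_projection assms(1,2))

text \<open>The bound on the forms forces the projections to be pairwise orthogonal, for on the
  range of one of them it already uses up the whole norm. By Pythagoras, convergence at each vector
  then reduces to that of a series of nonnegative reals.\<close>

lemma projection_sum: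
  fixes p :: "nat \<Rightarrow> 'h::complex_hilbert_space \<Rightarrow>\<^sub>L 'h"
  assumes p: "\<And>i. projection_op (p i)" and le: "\<And>n x. (\<Sum>i<n. quad_form (p i) x) \<le> (norm x)\<^sup>2"
  obtains q where "projection_op q" "\<And>x. (\<lambda>i. p i x) sums (blinfun_apply q x)"
proof -
  have orth: "p i (p j x) = 0" if "i \<noteq> j" for i j x
  proof (rule quad_form_le_norm_imp_orthogonal[OF p p])
    fix x
    have "(\<Sum>k\<in>{i, j}. quad_form (p k) x) \<le> (\<Sum>k<Suc (max i j). quad_form (p k) x)"
      by (rule sum_mono2) (auto simp: quad_form_projection p)
    then show "quad_form (p i) x + quad_form (p j) x \<le> (norm x)\<^sup>2"
      using le[of x "Suc (max i j)"] that by simp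
  qed
  have orthog: "cinner (p i x) (p j x) = 0" if "i \<noteq> j" for i j x
  proof -
    have "cinner (p i x) (p j x) = cinner x (p i (p j x))"
      using p[of i] by (simp add: projection_op_iff hermitianD)
    then show ?thesis using orth[OF that] by (simp add: cinner.zero_right)
  qed
  have norm_sum: "(norm (\<Sum>i\<in>I. p i x))\<^sup>2 = (\<Sum>i\<in>I. quad_form (p i) x)" if "finite I" for I x
    using that
  proof (induction I rule: finite_induct)
    case (insert j I)
    have "cinner (p j x) (\<Sum>i\<in>I. p i x) = 0"
      unfolding cinner.sum_right using insert(2) by (intro sum.neutral) (metis orthog)
    then show ?case
      using insert by (simp add: norm_add_square quad_form_projection[OF p])
  qed simp
  have summ: "summable (\<lambda>i. p i x)" for x
  proof -
    have "summable (\<lambda>i. quad_form (p i) x)"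
      by (rule summableI_nonneg_bounded[OF _ le]) (simp add: quad_form_projection p)
    then have C: "\<And>e. e > 0 \<Longrightarrow> \<exists>N. \<forall>m\<ge>N. \<forall>n. norm (\<Sum>i=m..<n. quad_form (p i) x) < e"
      unfolding summable_Cauchy by blast
    show ?thesis
      unfolding summable_Cauchy
    proof (intro allI impI)
      fix e :: real assume "e > 0"
      then obtain N where N: "\<And>m n. m \<ge> N \<Longrightarrow> norm (\<Sum>i=m..<n. quad_form (p i) x) < e\<^sup>2"
        using C[of "e\<^sup>2"] by auto
      have "norm (\<Sum>i=m..<n. p i x) < e" if "m \<ge> N" for m n
      proof -
        have "(norm (\<Sum>i=m..<n. p i x))\<^sup>2 < e\<^sup>2"
          unfolding norm_sum[OF finite_atLeastLessThan] using N[OF that, of n] by simp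
        then show ?thesis using \<open>e > 0\<close> by (simp add: power2_less_imp_less)
      qed
      then show "\<exists>N. \<forall>m\<ge>N. \<forall>n. norm (\<Sum>i=m..<n. p i x) < e" by blast
    qed
  qed
  define Q where "Q x = (\<Sum>i. p i x)" for x
  have Q: "(\<lambda>i. p i x) sums Q x" for x unfolding Q_def by (rule summable_sums[OF summ])
  have "bounded_linear Q"
  proof (rule bounded_linear_intro[where K = 1])
    show "Q (x + y) = Q x + Q y" for x y
      using sums_add[OF Q Q, of x y] sums_unique2[OF Q] by (simp add: blinfun.add_right)
    show "Q (r *\<^sub>R x) = r *\<^sub>R Q x" for r x
      using bounded_linear.sums[OF bounded_linear_scaleR_right Q, of r x] sums_unique2[OF Q]
      by (simp add: blinfun.scaleR_right)
    fix x
    have "norm (\<Sum>i<n. p i x) \<le> norm x" for n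
      by (rule power2_le_imp_le) (use norm_sum[of "{..<n}" x] le[of x n] in auto)
    then show "norm (Q x) \<le> norm x * 1"
      using LIMSEQ_le_const2[OF tendsto_norm[OF Q[unfolded sums_def]]] by fastforce
  qed
  then have QB: "blinfun_apply (Blinfun Q) = Q" by (rule bounded_linear_Blinfun_apply)
  have Qc: "Q (c *\<^sub>C x) = c *\<^sub>C Q x" for c x
  proof -
    have "(\<lambda>i. c *\<^sub>C p i x) sums (c *\<^sub>C Q x)"
      by (rule bounded_linear.sums[OF bounded_linear_scaleC Q])
    moreover have "p i (c *\<^sub>C x) = c *\<^sub>C p i x" for i
      using p[of i] by (auto simp: projection_op_iff hermitian_def bounded_opsD)
    ultimately show ?thesis using sums_unique2[OF Q[of "c *\<^sub>C x"]] by simp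
  qed
  have Qh: "cinner (Q x) y = cinner x (Q y)" for x y
  proof (rule sums_unique2)
    show "(\<lambda>i. cinner (p i x) y) sums cinner (Q x) y"
      by (rule bounded_linear.sums[OF cinner.bounded_linear_left Q])
    have "(\<lambda>i. cinner x (p i y)) sums cinner x (Q y)"
      by (rule bounded_linear.sums[OF cinner.bounded_linear_right Q])
    then show "(\<lambda>i. cinner (p i x) y) sums cinner x (Q y)"
      using p by (simp add: projection_op_iff hermitianD)
  qed
  have "p i (Q x) = p i x" for i x
  proof (rule sums_unique2)
    show "(\<lambda>j. p i (p j x)) sums p i (Q x)"
      by (rule bounded_linear.sums[OF blinfun.bounded_linear_right Q])
    have "(\<lambda>j. if j = i then p j x else 0) sums p i x" by (rule sums_single)
    moreover have "(if j = i then p j x else 0) = p i (p j x)" for j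
      using orth p by simp
    ultimately show "(\<lambda>j. p i (p j x)) sums p i x" by simp
  qed
  then have QQ: "Q (Q x) = Q x" for x using sums_unique2[OF Q Q[of x]] sums_unique2[OF Q[of "Q x"]] Q[of x] by simp
  have "projection_op (Blinfun Q)"
    unfolding projection_op_iff hermitian_def bounded_ops_def
    by (auto simp: QB Qc Qh QQ intro!: blinfun_eqI)
  then show thesis by (rule that) (simp add: QB Q)
qed

section \<open>The spectral measure\<close>

lemma sum_le_sums:
  fixes f :: "nat \<Rightarrow> real"
  shows "(\<And>i. 0 \<le> f i) \<Longrightarrow> f sums s \<Longrightarrow> (\<Sum>i<n. f i) \<le> s"
  by (metis finite_lessThan sum_le_suminf sums_iff)

lemma hermitian_projection: "projection_op p \<Longrightarrow> hermitian p"
  by (simp add: projection_op_iff)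

lemma projection_eqI:
  "projection_op p \<Longrightarrow> projection_op q \<Longrightarrow> (\<And>x. quad_form p x = quad_form q x) \<Longrightarrow> p = q"
  by (intro quad_form_eq_imp_eq hermitian_projection)

lemma quad_form_sums:
  "(\<lambda>i. blinfun_apply (p i) x) sums blinfun_apply q x \<Longrightarrow> (\<lambda>i. quad_form (p i) x) sums quad_form q x"
  unfolding quad_form_def
  by (intro bounded_linear.sums[OF bounded_linear_Re] bounded_linear.sums[OF cinner.bounded_linear_right])

context
  fixes a :: "'h::complex_hilbert_space \<Rightarrow>\<^sub>L 'h"
  assumes a: "hermitian a"
begin

text \<open>The future scalar measure of \<open>x\<close>, available before any projection is
  attached to a general Borel set.\<close>

definition cut_measure :: "'h \<Rightarrow> real measure"
  where "cut_measure x = interval_measure (\<lambda>s. (norm (cut_proj a s x))\<^sup>2)"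

lemma tendsto_norm_cut_proj:
  "((\<lambda>s. (norm (cut_proj a s x))\<^sup>2) \<longlongrightarrow> 0) at_bot"
  "((\<lambda>s. (norm (cut_proj a s x))\<^sup>2) \<longlongrightarrow> (norm x)\<^sup>2) at_top"
proof -
  have "\<forall>\<^sub>F s in at_bot. (norm (cut_proj a s x))\<^sup>2 = 0"
    using eventually_gt_at_bot[of "- norm a"] eventually_at_bot_dense[of "\<lambda>s. s < - norm a"]
    by (auto simp: eventually_at_bot_dense cut_proj_eq_0[OF a] intro!: exI[of _ "- norm a"])
  then show "((\<lambda>s. (norm (cut_proj a s x))\<^sup>2) \<longlongrightarrow> 0) at_bot" by (rule tendsto_eventually)
  have "\<forall>\<^sub>F s in at_top. (norm (cut_proj a s x))\<^sup>2 = (norm x)\<^sup>2"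
    using eventually_ge_at_top[of "norm a"] by eventually_elim (simp add: cut_proj_eq_id[OF a])
  then show "((\<lambda>s. (norm (cut_proj a s x))\<^sup>2) \<longlongrightarrow> (norm x)\<^sup>2) at_top" by (rule tendsto_eventually)
qed

lemma cut_measure:
  shows finite_measure_cut_measure: "finite_measure (cut_measure x)"
    and cut_measure_UNIV: "measure (cut_measure x) UNIV = (norm x)\<^sup>2"
    and cut_measure_Iic: "measure (cut_measure x) {..s} = quad_form (cut_proj a s) x"
    and sets_cut_measure: "sets (cut_measure x) = sets borel"
    and space_cut_measure: "space (cut_measure x) = UNIV"
proof -
  note F = norm_cut_proj_mono[OF a] cut_proj_right_continuous[OF a] tendsto_norm_cut_proj
  show "finite_measure (cut_measure x)"
    unfolding cut_measure_def
    by (rule finite_borel_measure.axioms(1), rule finite_borel_measure_interval_measure[OF F zero_le_power2])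
  show "measure (cut_measure x) UNIV = (norm x)\<^sup>2"
    unfolding cut_measure_def measure_def by (subst interval_measure_UNIV[OF F zero_le_power2]) auto
  show "measure (cut_measure x) {..s} = quad_form (cut_proj a s) x"
    unfolding cut_measure_def quad_form_projection[OF projection_cut_proj[OF a]]
    by (rule measure_interval_measure_Iic[OF F(1-3)])
qed (simp_all add: cut_measure_def)

text \<open>The sets whose measure is, for all \<open>x\<close>, the form of one projection form a
  Dynkin system. Complements correspond to \<open>id_blinfun - p\<close>; for disjoint unions
  \<open>projection_sum\<close> applies because the partial sums stay below the total mass, which is
  the squared norm of \<open>x\<close>.\<close>

lemma spectral_measure_exists:
  assumes "B \<in> sets borel"
  shows "\<exists>p. projection_op p \<and> (\<forall>x. quad_form p x = measure (cut_measure x) B)"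
proof -
  let ?P = "\<lambda>B. \<exists>p. projection_op p \<and> (\<forall>x. quad_form p x = measure (cut_measure x) B)"
  have borel_eq: "sets borel = sigma_sets UNIV (range (\<lambda>s::real. {..s}))"
    by (simp add: borel_eq_atMost)
  have "Int_stable (range (\<lambda>s::real. {..s}))"
    by (auto simp: Int_stable_def intro: exI[of _ "min _ _"])
  moreover have "range (\<lambda>s::real. {..s}) \<subseteq> Pow UNIV" by simp
  moreover have "B \<in> sigma_sets UNIV (range (\<lambda>s::real. {..s}))" using assms borel_eq by simp
  ultimately show ?thesis
  proof (induction B rule: sigma_sets_induct_disjoint)
    case (basic A)
    then obtain s where "A = {..s}" by blast
    then show ?case using cut_measure_Iic projection_cut_proj[OF a, of s] by metis
  next
    case empty
    then show ?case using projection_0 by (auto intro!: exI[of _ 0] simp: quad_form_simps)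
  next
    case (compl A)
    then obtain p where p: "projection_op p" "\<And>x. quad_form p x = measure (cut_measure x) A" by blast
    have "measure (cut_measure x) (UNIV - A) = (norm x)\<^sup>2 - measure (cut_measure x) A" for x
      using finite_measure.finite_measure_compl[OF finite_measure_cut_measure, of A x] compl(1)
      by (simp add: sets_cut_measure space_cut_measure cut_measure_UNIV borel_eq)
    then show ?case
      using p projection_compl[OF p(1)] by (auto intro!: exI[of _ "id_blinfun - p"] simp: quad_form_simps)
  next
    case (union A)
    then obtain p where p: "\<And>i::nat. projection_op (p i)" "\<And>i x. quad_form (p i) x = measure (cut_measure x) (A i)"
      by metis
    have sums: "(\<lambda>i. measure (cut_measure x) (A i)) sums measure (cut_measure x) (\<Union>i. A i)" for x
      using union(1,2) finite_measure.finite_measure_UNION[OF finite_measure_cut_measure]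
      by (simp add: sets_cut_measure borel_eq)
    have "(\<Sum>i<n. quad_form (p i) x) \<le> (norm x)\<^sup>2" for n x
    proof -
      have "(\<Sum>i<n. quad_form (p i) x) \<le> measure (cut_measure x) (\<Union>i. A i)"
        using sum_le_sums[OF _ sums[of x], of n] by (simp add: p(2))
      also have "\<dots> \<le> (norm x)\<^sup>2"
        unfolding cut_measure_UNIV[symmetric] space_cut_measure[of x, symmetric]
        by (rule finite_measure.bounded_measure[OF finite_measure_cut_measure])
      finally show ?thesis .
    qed
    then obtain q where q: "projection_op q" "\<And>x. (\<lambda>i. p i x) sums (blinfun_apply q x)"
      using projection_sum[of p, OF p(1)] by blast
    have "quad_form q x = measure (cut_measure x) (\<Union>i. A i)" for x
      using quad_form_sums[OF q(2), of x] sums[of x] by (simp add: p(2) sums_unique2)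
    then show ?case using q(1) by blast
  qed
qed

definition spectral_measure_of :: "real set \<Rightarrow> 'h \<Rightarrow>\<^sub>L 'h"
  where "spectral_measure_of B = (SOME p. projection_op p \<and> (\<forall>x. quad_form p x = measure (cut_measure x) B))"

lemma spectral_measure_of:
  assumes "B \<in> sets borel"
  shows projection_spectral_measure_of: "projection_op (spectral_measure_of B)"
    and quad_form_spectral_measure_of: "quad_form (spectral_measure_of B) x = measure (cut_measure x) B"
  using someI_ex[OF spectral_measure_exists[OF assms]] unfolding spectral_measure_of_def by auto

lemma spectral_measure_of_disjoint:
  assumes AB: "A \<in> sets borel" "B \<in> sets borel" "A \<inter> B = {}"
  shows "spectral_measure_of (A \<union> B) = spectral_measure_of A + spectral_measure_of B"
    and "spectral_measure_of A (spectral_measure_of B x) = 0"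
proof -
  have Un: "measure (cut_measure x) (A \<union> B) = measure (cut_measure x) A + measure (cut_measure x) B" for x
    using finite_measure.finite_measure_Union[OF finite_measure_cut_measure] AB
    by (simp add: sets_cut_measure)
  show "spectral_measure_of (A \<union> B) = spectral_measure_of A + spectral_measure_of B"
    using AB by (intro quad_form_eq_imp_eq hermitian_intros(3) hermitian_projection projection_spectral_measure_of)
      (auto simp: quad_form_simps quad_form_spectral_measure_of Un)
  show "spectral_measure_of A (spectral_measure_of B x) = 0"
  proof (rule quad_form_le_norm_imp_orthogonal)
    fix x
    show "quad_form (spectral_measure_of A) x + quad_form (spectral_measure_of B) x \<le> (norm x)\<^sup>2"
      using Un[of x] AB finite_measure.bounded_measure[OF finite_measure_cut_measure, of x "A \<union> B"]
      by (simp add: quad_form_spectral_measure_of space_cut_measure cut_measure_UNIV)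
  qed (use AB projection_spectral_measure_of in auto)
qed

lemma projection_valued_measure_spectral_measure_of: "projection_valued_measure spectral_measure_of"
  unfolding projection_valued_measure_def
proof (intro conjI ballI allI impI)
  show "projection_op (spectral_measure_of B)" if "B \<in> sets borel" for B
    by (rule projection_spectral_measure_of[OF that])
  show "spectral_measure_of {} = 0"
    by (intro projection_eqI projection_spectral_measure_of projection_0)
      (auto simp: quad_form_spectral_measure_of quad_form_simps)
  show "spectral_measure_of UNIV = id_blinfun"
    by (intro projection_eqI projection_spectral_measure_of projection_id)
      (auto simp: quad_form_spectral_measure_of quad_form_simps cut_measure_UNIV)
  show "spectral_measure_of (A \<inter> B) = spectral_measure_of A o\<^sub>L spectral_measure_of B"
    if AB: "A \<in> sets borel" "B \<in> sets borel" for A B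
  proof (rule blinfun_eqI)
    fix x
    \<comment> \<open>Multiplicativity from additivity: both sets are split along
      \<open>A \<inter> B\<close>, and projections of disjoint pieces annihilate each other.\<close>
    have A: "spectral_measure_of A = spectral_measure_of (A \<inter> B) + spectral_measure_of (A - B)"
      using spectral_measure_of_disjoint(1)[of "A \<inter> B" "A - B"] AB by (auto simp: Int_Diff_Un)
    have "(A \<inter> B) \<union> (B - A) = B" by blast
    then have B: "spectral_measure_of B = spectral_measure_of (A \<inter> B) + spectral_measure_of (B - A)"
      using spectral_measure_of_disjoint(1)[of "A \<inter> B" "B - A"] AB by auto
    have 0: "spectral_measure_of (A \<inter> B) (spectral_measure_of (B - A) x) = 0"
      "spectral_measure_of (A - B) (spectral_measure_of (A \<inter> B) x) = 0"
      "spectral_measure_of (A - B) (spectral_measure_of (B - A) x) = 0"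
      using AB by (intro spectral_measure_of_disjoint(2); auto)+
    have "spectral_measure_of A (spectral_measure_of B x)
      = spectral_measure_of (A \<inter> B) (spectral_measure_of (A \<inter> B) x)"
      unfolding A B using 0 by (simp add: blinfun.bilinear_simps)
    then show "spectral_measure_of (A \<inter> B) x = (spectral_measure_of A o\<^sub>L spectral_measure_of B) x"
      using AB by (simp add: projection_spectral_measure_of)
  qed
  show "(\<lambda>n. spectral_measure_of (B n) x) sums spectral_measure_of (\<Union>n. B n) x"
    if B: "range B \<subseteq> sets borel" "disjoint_family B" for B :: "nat \<Rightarrow> real set" and x
  proof -
    have Bn: "B n \<in> sets borel" "(\<Union>n. B n) \<in> sets borel" for n using B(1) by auto
    have sums: "(\<lambda>i. quad_form (spectral_measure_of (B i)) x) sums quad_form (spectral_measure_of (\<Union>i. B i)) x" for x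
      using B finite_measure.finite_measure_UNION[OF finite_measure_cut_measure]
      by (simp add: sets_cut_measure quad_form_spectral_measure_of Bn)
    have "(\<Sum>i<n. quad_form (spectral_measure_of (B i)) x) \<le> (norm x)\<^sup>2" for n x
    proof -
      have "(\<Sum>i<n. quad_form (spectral_measure_of (B i)) x) \<le> quad_form (spectral_measure_of (\<Union>i. B i)) x"
        by (rule sum_le_sums[OF _ sums]) (simp add: quad_form_spectral_measure_of Bn)
      also have "\<dots> \<le> (norm x)\<^sup>2"
        using projection_norm_le[OF projection_spectral_measure_of[OF Bn(2)], of x]
        by (simp add: quad_form_projection[OF projection_spectral_measure_of[OF Bn(2)]])
      finally show ?thesis .
    qed
    then obtain q where q: "projection_op q" "\<And>x. (\<lambda>i. spectral_measure_of (B i) x) sums (blinfun_apply q x)"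
      using projection_sum[of "\<lambda>i. spectral_measure_of (B i)"] projection_spectral_measure_of[OF Bn(1)] by blast
    have "q = spectral_measure_of (\<Union>i. B i)"
      using sums_unique2[OF quad_form_sums[OF q(2)] sums]
      by (intro projection_eqI q(1) projection_spectral_measure_of Bn)
    then show ?thesis using q(2) by simp
  qed
qed

lemma spectral_measure_of_Iic: "spectral_measure_of {..s} = cut_proj a s"
  by (intro projection_eqI projection_spectral_measure_of projection_cut_proj a)
    (auto simp: quad_form_spectral_measure_of cut_measure_Iic)

end

section \<open>Arbitrary projection-valued measures and their scalar measures\<close>

lemma projection_valued_measureD:
  assumes "projection_valued_measure E"
  shows "B \<in> sets borel \<Longrightarrow> projection_op (E B)" and "E {} = 0" and "E UNIV = id_blinfun"
    and "A \<in> sets borel \<Longrightarrow> B \<in> sets borel \<Longrightarrow> E (A \<inter> B) = E A o\<^sub>L E B"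
    and "range C \<subseteq> sets borel \<Longrightarrow> disjoint_family C \<Longrightarrow> (\<lambda>n::nat. E (C n) x) sums E (\<Union>n. C n) x"
  using assms unfolding projection_valued_measure_def by blast+

context
  fixes E :: "real set \<Rightarrow> 'h::complex_hilbert_space \<Rightarrow>\<^sub>L 'h"
  assumes E: "projection_valued_measure E"
begin

lemma sets_scalar_spectral_measure [measurable_cong]: "sets (scalar_spectral_measure E x) = sets borel"
  and space_scalar_spectral_measure: "space (scalar_spectral_measure E x) = UNIV"
  unfolding scalar_spectral_measure_def
  by (simp_all add: sets.sigma_sets_eq[of borel, simplified])

lemma emeasure_scalar_spectral_measure:
  assumes "B \<in> sets borel"
  shows "emeasure (scalar_spectral_measure E x) B = ennreal (quad_form (E B) x)"
  unfolding scalar_spectral_measure_def quad_form_def[symmetric]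
proof (rule emeasure_measure_of_sigma[OF _ _ _ assms])
  show "sigma_algebra UNIV (sets (borel :: real measure))"
    using sets.sigma_algebra_axioms[of borel] by simp
  show "positive (sets borel) (\<lambda>B. ennreal (quad_form (E B) x))"
    by (simp add: positive_def projection_valued_measureD(2)[OF E] quad_form_simps)
  show "countably_additive (sets borel) (\<lambda>B. ennreal (quad_form (E B) x))"
    unfolding countably_additive_def
  proof (intro allI impI)
    fix A :: "nat \<Rightarrow> real set" assume A: "range A \<subseteq> sets borel" "disjoint_family A"
    then have nonneg: "0 \<le> quad_form (E (A i)) x" for i
      by (subst quad_form_projection) (auto intro!: projection_valued_measureD(1)[OF E])
    have "(\<lambda>i. quad_form (E (A i)) x) sums quad_form (E (\<Union>i. A i)) x"
      by (rule quad_form_sums[OF projection_valued_measureD(5)[OF E A]])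
    then show "(\<Sum>i. ennreal (quad_form (E (A i)) x)) = ennreal (quad_form (E (\<Union>i. A i)) x)"
      using nonneg by (auto simp: sums_iff suminf_ennreal2)
  qed
qed

lemma measure_scalar_spectral_measure:
  assumes "B \<in> sets borel"
  shows "measure (scalar_spectral_measure E x) B = quad_form (E B) x"
  unfolding measure_def emeasure_scalar_spectral_measure[OF assms]
  by (simp add: quad_form_projection projection_valued_measureD(1)[OF E assms])

lemma finite_scalar_spectral_measure: "finite_measure (scalar_spectral_measure E x)"
  by (rule finite_measureI) (simp add: space_scalar_spectral_measure emeasure_scalar_spectral_measure)

lemma measure_scalar_spectral_measure_UNIV: "measure (scalar_spectral_measure E x) UNIV = (norm x)\<^sup>2"
  by (simp add: measure_scalar_spectral_measure projection_valued_measureD(3)[OF E] quad_form_simps)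

lemma pvm_compl: "B \<in> sets borel \<Longrightarrow> E (- B) = id_blinfun - E B"
proof (rule projection_eqI)
  fix x assume B: "B \<in> sets borel"
  show "quad_form (E (- B)) x = quad_form (id_blinfun - E B) x"
    using finite_measure.finite_measure_compl[OF finite_scalar_spectral_measure, of B x] B
    by (simp add: sets_scalar_spectral_measure space_scalar_spectral_measure Compl_eq_Diff_UNIV[symmetric]
        measure_scalar_spectral_measure projection_valued_measureD(3)[OF E] quad_form_simps)
qed (auto intro: projection_valued_measureD(1)[OF E] projection_compl)

text \<open>Turns an integral over \<open>C\<close> into a full integral for the vector
  \<open>E C x\<close>, to which the formula defining a spectral measure of \<open>a\<close>
  applies.\<close>

lemma scalar_spectral_measure_restrict:
  assumes C: "C \<in> sets borel"
  shows "scalar_spectral_measure E (E C x) = density (scalar_spectral_measure E x) (indicator C)"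
proof (rule measure_eqI)
  fix B assume "B \<in> sets (scalar_spectral_measure E (E C x))"
  then have B: "B \<in> sets borel" by (simp add: sets_scalar_spectral_measure)
  have "quad_form (E B) (E C x) = quad_form (E (B \<inter> C)) x"
    using quad_form_projection[OF projection_valued_measureD(1)[OF E B], of "E C x"]
      quad_form_projection[OF projection_valued_measureD(1)[OF E sets.Int[OF B C]], of x]
    by (simp add: projection_valued_measureD(4)[OF E B C])
  then show "emeasure (scalar_spectral_measure E (E C x)) B
      = emeasure (density (scalar_spectral_measure E x) (indicator C)) B"
    using B C
    by (simp add: emeasure_restricted emeasure_scalar_spectral_measure sets_scalar_spectral_measure
        Int_commute)
qed (simp add: sets_scalar_spectral_measure)

context
  fixes R :: real
  assumes R: "E {-R..R} = id_blinfun"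
begin

lemma AE_scalar_spectral_measure_bounded: "AE t in scalar_spectral_measure E x. \<bar>t\<bar> \<le> R"
proof (rule AE_I[of _ _ "- {-R..R}"])
  show "emeasure (scalar_spectral_measure E x) (- {-R..R}) = 0"
    by (subst emeasure_scalar_spectral_measure) (auto simp: pvm_compl R quad_form_simps)
qed (auto simp: sets_scalar_spectral_measure space_scalar_spectral_measure)

lemma integrable_scalar_spectral_measure: "integrable (scalar_spectral_measure E x) (\<lambda>t. t)"
  by (rule finite_measure.integrable_const_bound[OF finite_scalar_spectral_measure, where B = R])
    (use AE_scalar_spectral_measure_bounded in \<open>auto simp: measurable_cong_sets[OF sets_scalar_spectral_measure refl]\<close>)

lemma integral_scalar_spectral_measure_restrict:
  assumes C: "C \<in> sets borel"
  shows "(\<integral>t. t \<partial>scalar_spectral_measure E (E C x)) = (\<integral>t. indicator C t * t \<partial>scalar_spectral_measure E x)"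
  unfolding scalar_spectral_measure_restrict[OF C]
  using C integral_density[of "\<lambda>t. t" "scalar_spectral_measure E x" "indicator C :: real \<Rightarrow> real"]
  by (simp add: measurable_cong_sets[OF sets_scalar_spectral_measure refl] ennreal_indicator)

lemma integrable_indicator_scalar_spectral_measure:
  "C \<in> sets borel \<Longrightarrow> integrable (scalar_spectral_measure E x) (\<lambda>t. indicator C t * t)"
  using integrable_real_mult_indicator[OF _ integrable_scalar_spectral_measure, of C x]
  by (simp add: sets_scalar_spectral_measure mult.commute)

end

end


text \<open>Over n equal pieces the errors telescope to \<open>(t - s) * (F t - F s) / n\<close>.
  This replaces an explicit Riemann approximation in the existence proof, where \<open>F\<close> is
  the distribution function of the scalar measure.\<close>

lemma telescoping_increments_eq:
  fixes I F :: "real \<Rightarrow> real"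
  assumes inc: "\<And>s t. s \<le> t \<Longrightarrow> \<bar>I t - I s\<bar> \<le> (t - s) * (F t - F s)" and "s \<le> t"
  shows "I t = I s"
proof -
  have step: "\<bar>I (s + real n * d) - I s\<bar> \<le> d * (F (s + real n * d) - F s)" if "0 \<le> d" for n d
  proof (induction n)
    case (Suc n)
    have "\<bar>I (s + real (Suc n) * d) - I (s + real n * d)\<bar>
      \<le> (s + real (Suc n) * d - (s + real n * d)) * (F (s + real (Suc n) * d) - F (s + real n * d))"
      by (rule inc) (use that in \<open>auto simp: algebra_simps\<close>)
    then show ?case using Suc by (simp add: algebra_simps)
  qed simp
  have le: "\<bar>I t - I s\<bar> \<le> (t - s) * (F t - F s) * inverse (real (Suc n))" for n
    using step[of "(t - s) / real (Suc n)" "Suc n"] assms(2)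
    by (simp add: field_simps del: of_nat_Suc)
  have "(\<lambda>n. (t - s) * (F t - F s) * inverse (real (Suc n))) \<longlonglongrightarrow> (t - s) * (F t - F s) * 0"
    by (intro tendsto_intros LIMSEQ_inverse_real_of_nat)
  then have "\<bar>I t - I s\<bar> \<le> (t - s) * (F t - F s) * 0"
    by (rule LIMSEQ_le_const) (use le in blast)
  then show ?thesis by simp
qed

lemma id_blinfun_compose: "id_blinfun o\<^sub>L a = a" "a o\<^sub>L id_blinfun = a"
  by (auto intro!: blinfun_eqI)

lemma hermitian_sandwich:
  assumes "hermitian a" "hermitian p"
  shows "hermitian (p o\<^sub>L a o\<^sub>L p)" "quad_form (p o\<^sub>L a o\<^sub>L p) x = quad_form a (p x)"
  using assms by (auto simp: hermitian_def quad_form_def)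

context
  fixes E :: "real set \<Rightarrow> 'h::complex_hilbert_space \<Rightarrow>\<^sub>L 'h" and R :: real
  assumes E: "projection_valued_measure E" and R: "E {-R..R} = id_blinfun"
begin

lemma AE_scalar_spectral_measure_restrict:
  assumes C: "C \<in> sets borel"
  shows "AE u in scalar_spectral_measure E (E C x). u \<in> C"
proof (rule AE_I[of _ _ "- C"])
  have "(id_blinfun - E C) (E C x) = 0"
    using projection_valued_measureD(1)[OF E C] by (simp add: blinfun.bilinear_simps)
  then show "emeasure (scalar_spectral_measure E (E C x)) (- C) = 0"
    using C by (simp add: emeasure_scalar_spectral_measure[OF E] pvm_compl[OF E] quad_form_def cinner.zero_right)
qed (use C in \<open>auto simp: sets_scalar_spectral_measure[OF E] space_scalar_spectral_measure[OF E]\<close>)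

lemma integral_const_scalar_spectral_measure:
  "(\<integral>u. s \<partial>scalar_spectral_measure E x) = s * (norm x)\<^sup>2"
  by (simp add: space_scalar_spectral_measure[OF E] measure_scalar_spectral_measure_UNIV[OF E])

lemma scalar_spectral_measure_integral_bounds:
  assumes C: "C \<in> sets borel"
  shows "C \<subseteq> {..t} \<Longrightarrow> (\<integral>u. u \<partial>scalar_spectral_measure E (E C x)) \<le> t * (norm (E C x))\<^sup>2"
    and "C \<subseteq> {s..} \<Longrightarrow> s * (norm (E C x))\<^sup>2 \<le> (\<integral>u. u \<partial>scalar_spectral_measure E (E C x))"
proof -
  note mono = integral_mono_AE[OF _ _ eventually_mono[OF AE_scalar_spectral_measure_restrict[OF C, of x]]]
    and int = integrable_scalar_spectral_measure[OF E R]
      finite_measure.integrable_const[OF finite_scalar_spectral_measure[OF E]]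
  show "(\<integral>u. u \<partial>scalar_spectral_measure E (E C x)) \<le> t * (norm (E C x))\<^sup>2" if "C \<subseteq> {..t}"
    unfolding integral_const_scalar_spectral_measure[symmetric]
    by (rule mono) (use that in \<open>auto intro: int\<close>)
  show "s * (norm (E C x))\<^sup>2 \<le> (\<integral>u. u \<partial>scalar_spectral_measure E (E C x))" if "C \<subseteq> {s..}"
    unfolding integral_const_scalar_spectral_measure[symmetric]
    by (rule mono) (use that in \<open>auto intro: int\<close>)
qed

end

lemma is_spectral_measureD:
  assumes "is_spectral_measure a E"
  shows "projection_valued_measure E" "\<exists>R. E {-R..R} = id_blinfun"
    "quad_form a x = (\<integral>t. t \<partial>scalar_spectral_measure E x)"
  using assms by (auto simp: is_spectral_measure_def quad_form_def)

section \<open>Uniqueness and existence\<close>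

text \<open>Only the diagonal values of the form of \<open>a\<close> are given. Splitting the
  integral over \<open>C\<close> and its complement shows that \<open>a\<close> has the same form as
  its two diagonal blocks together, so it is block diagonal with respect to
  \<open>E C\<close>.\<close>

lemma is_spectral_measure_commute:
  assumes a: "hermitian a" and aE: "is_spectral_measure a E" and C: "C \<in> sets borel"
  shows "a o\<^sub>L E C = E C o\<^sub>L a"
proof -
  note E = is_spectral_measureD(1)[OF aE]
  obtain R where R: "E {-R..R} = id_blinfun" using is_spectral_measureD(2)[OF aE] by blast
  let ?p = "E C" and ?q = "E (- C)"
  have C': "- C \<in> sets borel" using C by auto
  have p: "projection_op ?p" and q: "projection_op ?q"
    using projection_valued_measureD(1)[OF E] C C' by auto
  have q_eq: "?q = id_blinfun - ?p" by (rule pvm_compl[OF E C])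
  have eq: "a = (?p o\<^sub>L a o\<^sub>L ?p) + (?q o\<^sub>L a o\<^sub>L ?q)"
  proof (rule quad_form_eq_imp_eq[OF a])
    show "hermitian ((?p o\<^sub>L a o\<^sub>L ?p) + (?q o\<^sub>L a o\<^sub>L ?q))"
      using p q by (intro hermitian_intros hermitian_sandwich a hermitian_projection)
    fix x
    let ?\<mu> = "scalar_spectral_measure E x"
    have "quad_form a x = (\<integral>u. indicator C u * u + indicator (- C) u * u \<partial>?\<mu>)"
      unfolding is_spectral_measureD(3)[OF aE]
      by (rule Bochner_Integration.integral_cong) (auto simp: indicator_def)
    also have "\<dots> = (\<integral>u. indicator C u * u \<partial>?\<mu>) + (\<integral>u. indicator (- C) u * u \<partial>?\<mu>)"
      using C C' by (intro Bochner_Integration.integral_add integrable_indicator_scalar_spectral_measure[OF E R])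
    also have "\<dots> = quad_form a (?p x) + quad_form a (?q x)"
      using C C' by (simp add: is_spectral_measureD(3)[OF aE] integral_scalar_spectral_measure_restrict[OF E R])
    finally show "quad_form a x = quad_form ((?p o\<^sub>L a o\<^sub>L ?p) + (?q o\<^sub>L a o\<^sub>L ?q)) x"
      using p q a by (simp add: quad_form_simps hermitian_sandwich hermitian_projection)
  qed
  have qp: "?q (?p x) = 0" "?p (?q x) = 0" for x
    using p by (simp_all add: q_eq blinfun.bilinear_simps)
  show ?thesis
  proof (rule blinfun_eqI)
    fix x
    have 1: "a (?p x) = ?p (a (?p x))"
      using p qp by (subst eq) (simp add: blinfun.bilinear_simps)
    have 2: "?p (a x) = ?p (a (?p x))"
      using p qp by (subst eq) (simp add: blinfun.bilinear_simps)
    show "(a o\<^sub>L ?p) x = (?p o\<^sub>L a) x" using 1 2 by simp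
  qed
qed

lemma is_spectral_measure_cut:
  assumes a: "hermitian a" and aE: "is_spectral_measure a E"
  shows "spectral_cut a s (E {..s})"
  unfolding spectral_cut_def
proof (intro conjI allI impI)
  note E = is_spectral_measureD(1)[OF aE]
  obtain R where R: "E {-R..R} = id_blinfun" using is_spectral_measureD(2)[OF aE] by blast
  show "projection_op (E {..s})" by (rule projection_valued_measureD(1)[OF E]) simp
  show "a o\<^sub>L E {..s} = E {..s} o\<^sub>L a" by (rule is_spectral_measure_commute[OF a aE]) simp
  show "quad_form a (E {..s} x) \<le> s * (norm (E {..s} x))\<^sup>2" for x
    unfolding is_spectral_measureD(3)[OF aE]
    by (rule scalar_spectral_measure_integral_bounds(1)[OF E R]) auto
  fix x assume x: "E {..s} x = 0" "x \<noteq> 0"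
  let ?\<mu> = "scalar_spectral_measure E x"
  have Ex: "E {s<..} x = x"
    using pvm_compl[OF E, of "{..s}"] x by (simp add: blinfun.bilinear_simps)
  have AE: "AE u in ?\<mu>. s < u"
    using AE_scalar_spectral_measure_restrict[OF E R, of "{s<..}" x] unfolding Ex by simp
  \<comment> \<open>If it failed, \<open>u - s\<close> would be almost everywhere positive with
    integral 0, so the scalar measure would vanish although its mass is the squared norm of
    \<open>x\<close>.\<close>
  show "s * (norm x)\<^sup>2 < quad_form a x"
  proof (rule ccontr)
    assume "\<not> ?thesis"
    then have le: "(\<integral>u. u \<partial>?\<mu>) \<le> (\<integral>u. s \<partial>?\<mu>)"
      by (simp only: is_spectral_measureD(3)[OF aE] integral_const_scalar_spectral_measure[OF E R] not_less)
    have int: "integrable ?\<mu> (\<lambda>u. u - s)"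
      by (intro Bochner_Integration.integrable_diff integrable_scalar_spectral_measure[OF E R]
          finite_measure.integrable_const[OF finite_scalar_spectral_measure[OF E]])
    have nonneg: "AE u in ?\<mu>. 0 \<le> u - s" using AE by eventually_elim simp
    have "(\<integral>u. u - s \<partial>?\<mu>) = (\<integral>u. u \<partial>?\<mu>) - (\<integral>u. s \<partial>?\<mu>)"
      by (intro Bochner_Integration.integral_diff integrable_scalar_spectral_measure[OF E R]
          finite_measure.integrable_const[OF finite_scalar_spectral_measure[OF E]])
    then have "(\<integral>u. u - s \<partial>?\<mu>) = 0"
      using le integral_nonneg_AE[OF nonneg] by linarith
    then have "AE u in ?\<mu>. u - s = 0"
      using integral_nonneg_eq_0_iff_AE[OF int nonneg] by simp
    then have "AE u in ?\<mu>. False" using AE by eventually_elim simp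
    then have "measure ?\<mu> UNIV = 0"
      using AE_iff_measurable[of UNIV ?\<mu> "\<lambda>_. False"]
      by (simp add: measure_def space_scalar_spectral_measure[OF E] sets_scalar_spectral_measure[OF E])
    then show False using x by (simp add: measure_scalar_spectral_measure_UNIV[OF E])
  qed
qed

lemma is_spectral_measure_spectral_measure_of:
  assumes a: "hermitian a"
  shows "is_spectral_measure a (spectral_measure_of a)"
proof -
  let ?E = "spectral_measure_of a" and ?G = "cut_proj a"
  \<comment> \<open>The summand 1 supplies the strict inequality that \<open>cut_proj_eq_0\<close>
    wants at \<open>- R\<close>.\<close>
  define R where "R = norm a + 1"
  note E = projection_valued_measure_spectral_measure_of[OF a]
  have G0: "?G (- R) = 0" by (rule cut_proj_eq_0[OF a]) (simp add: R_def)
  have G1: "?G R = id_blinfun" by (rule cut_proj_eq_id[OF a]) (simp add: R_def)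
  have Ioc: "?E {s<..t} = ?G t - ?G s" if "s \<le> t" for s t
  proof -
    have "{..s} \<union> {s<..t} = {..t}" using that by auto
    then show ?thesis
      using spectral_measure_of_disjoint(1)[OF a, of "{..s}" "{s<..t}"]
      by (simp add: spectral_measure_of_Iic[OF a] algebra_simps disjoint_iff)
  qed
  have "- R \<le> R" by (simp add: R_def)
  then have "?E ({-R<..R} \<inter> {-R..R}) = id_blinfun"
    using Ioc[of "-R" R] by (simp add: G0 G1 Int_absorb2 greaterThanAtMost_subseteq_atLeastAtMost_iff)
  then have RR: "?E {-R..R} = id_blinfun"
    using projection_valued_measureD(4)[OF E, of "{-R<..R}" "{-R..R}"] Ioc[OF \<open>- R \<le> R\<close>]
    by (simp add: G0 G1 id_blinfun_compose)
  have "quad_form a x = (\<integral>u. u \<partial>scalar_spectral_measure ?E x)" for x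
  proof -
    let ?\<mu> = "scalar_spectral_measure ?E x"
    \<comment> \<open>The gap between the two sides, truncated at \<open>t\<close>. Both increments
      over \<open>{s<..t}\<close> lie between \<open>s\<close> and \<open>t\<close> times the same
      squared norm, so \<open>I\<close> is constant; it is 0 at \<open>- R\<close>, and at
      \<open>R\<close> it is the difference of the full integral and the form of
      \<open>a\<close>.\<close>
    define I where "I t = (\<integral>u. indicator {..t} u * u \<partial>?\<mu>) - quad_form (a o\<^sub>L ?G t) x" for t
    have "\<bar>I t - I s\<bar> \<le> (t - s) * ((norm (?G t x))\<^sup>2 - (norm (?G s x))\<^sup>2)" if st: "s \<le> t" for s t
    proof -
      let ?y = "?G t x - ?G s x"
      have Ey: "?E {s<..t} x = ?y" using Ioc[OF st] by (simp add: blinfun.bilinear_simps)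
      have "(\<integral>u. indicator {..t} u * u \<partial>?\<mu>) - (\<integral>u. indicator {..s} u * u \<partial>?\<mu>)
        = (\<integral>u. indicator {..t} u * u - indicator {..s} u * u \<partial>?\<mu>)"
        by (intro Bochner_Integration.integral_diff[symmetric] integrable_indicator_scalar_spectral_measure[OF E RR]) auto
      also have "\<dots> = (\<integral>u. indicator {s<..t} u * u \<partial>?\<mu>)"
        using st by (intro Bochner_Integration.integral_cong) (auto simp: indicator_def)
      also have "\<dots> = (\<integral>u. u \<partial>scalar_spectral_measure ?E ?y)"
        by (subst integral_scalar_spectral_measure_restrict[OF E RR, symmetric]) (auto simp: Ey)
      finally have 1: "(\<integral>u. indicator {..t} u * u \<partial>?\<mu>) - (\<integral>u. indicator {..s} u * u \<partial>?\<mu>)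
        = (\<integral>u. u \<partial>scalar_spectral_measure ?E ?y)" .
      have comm: "a o\<^sub>L (?G t - ?G s) = (?G t - ?G s) o\<^sub>L a"
        by (rule compose_commute_simps(2)[symmetric]; rule cut_proj_commute_self[OF a, symmetric])
      have "quad_form (a o\<^sub>L ?G t) x - quad_form (a o\<^sub>L ?G s) x = quad_form (a o\<^sub>L (?G t - ?G s)) x"
        by (simp add: quad_form_def blinfun.bilinear_simps cinner.diff_right)
      also have "\<dots> = quad_form a ?y"
        using quad_form_reduced[OF projection_cut_diff[OF a st] a comm, of x] by (simp add: blinfun.bilinear_simps)
      finally have 2: "quad_form (a o\<^sub>L ?G t) x - quad_form (a o\<^sub>L ?G s) x = quad_form a ?y" .
      have 3: "(\<integral>u. u \<partial>scalar_spectral_measure ?E ?y) \<le> t * (norm ?y)\<^sup>2"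
        using scalar_spectral_measure_integral_bounds(1)[OF E RR, of "{s<..t}" t x] by (simp add: Ey subset_iff)
      have 4: "s * (norm ?y)\<^sup>2 \<le> (\<integral>u. u \<partial>scalar_spectral_measure ?E ?y)"
        using scalar_spectral_measure_integral_bounds(2)[OF E RR, of "{s<..t}" s x] by (simp add: Ey subset_iff)
      have "\<bar>I t - I s\<bar> \<le> t * (norm ?y)\<^sup>2 - s * (norm ?y)\<^sup>2"
        using 1 2 3 4 quad_form_cut_diff[OF a st refl, of x] unfolding I_def by linarith
      then show ?thesis unfolding norm_cut_diff[OF a st] by (simp add: algebra_simps)
    qed
    then have "I R = I (- R)"
      by (rule telescoping_increments_eq) (use \<open>- R \<le> R\<close> in auto)
    moreover have "(\<integral>u. indicator {..R} u * u \<partial>?\<mu>) = (\<integral>u. u \<partial>?\<mu>)"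
      by (subst integral_scalar_spectral_measure_restrict[OF E RR, symmetric])
        (auto simp: spectral_measure_of_Iic[OF a] G1)
    moreover have "(\<integral>u. indicator {..-R} u * u \<partial>?\<mu>) = 0"
    proof -
      let ?\<nu> = "scalar_spectral_measure ?E (?E {..-R} x)"
      have "AE u in ?\<nu>. u = 0"
      proof (rule AE_I[of _ _ UNIV])
        show "emeasure ?\<nu> UNIV = 0"
          by (simp add: emeasure_scalar_spectral_measure[OF E] spectral_measure_of_Iic[OF a] G0 quad_form_simps)
      qed (auto simp: sets_scalar_spectral_measure[OF E])
      then show ?thesis
        by (subst integral_scalar_spectral_measure_restrict[OF E RR, symmetric])
          (auto intro: integral_eq_zero_AE)
    qed
    ultimately show ?thesis by (simp add: I_def G0 G1 quad_form_def cinner.zero_right)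
  qed
  then show ?thesis
    unfolding is_spectral_measure_def using E RR hermitian_cinner_eq[OF a] by auto
qed

text \<open>Every spectral measure of \<open>a\<close> has the same cut at \<open>s\<close>, and one
  exists, so the definite description is resolved. Half lines suffice because they are the only sets
  that enter \<open>choquet_trace_pos\<close>.\<close>

lemma spectral_projection_eq:
  assumes a: "hermitian a"
  shows "spectral_projection {s<..} a = id_blinfun - cut_proj a s"
  unfolding spectral_projection_def
proof (rule the_equality)
  have eq: "E {s<..} = id_blinfun - cut_proj a s" if "is_spectral_measure a E" for E
    using pvm_compl[OF is_spectral_measureD(1)[OF that], of "{..s}"]
      cut_proj_eqI[OF a is_spectral_measure_cut[OF a that]] by simp
  show "\<exists>E. is_spectral_measure a E \<and> id_blinfun - cut_proj a s = E {s<..}"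
    using eq is_spectral_measure_spectral_measure_of[OF a] by metis
  show "p = id_blinfun - cut_proj a s" if "\<exists>E. is_spectral_measure a E \<and> p = E {s<..}" for p
    using that eq by metis
qed


section \<open>Slopes of concave functions and Riemann sums\<close>

text \<open>Chord slopes of a concave function decrease to the right. Both slopes are compared with
  the slope \<open>D\<close> over \<open>[y, v]\<close>, which shares its left end with one interval
  and its right end with the other. If \<open>u = v\<close>, then \<open>x = 0\<close>.\<close>

lemma concave_chord_slope:
  fixes f :: "real \<Rightarrow> real"
  assumes f: "concave_on {0..1} f"
    and "0 \<le> y" "y \<le> u" "y + x \<le> v" "0 \<le> x" "x \<le> v - u" "v \<le> 1"
  shows "(f v - f u) / (v - u) * x \<le> f (y + x) - f y"
proof (cases "x = 0")
  case False
  then have x: "x > 0" "u < v" using assms by auto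
  define L where "L = v - y"
  define D where "D = (f v - f y) / L"
  have L: "L > 0" using x assms by (simp add: L_def)
  have "f ((1 - x / L) *\<^sub>R y + (x / L) *\<^sub>R v) \<ge> (1 - x / L) * f y + (x / L) * f v"
    by (rule concave_onD[OF f]) (use assms x L in \<open>auto simp: L_def\<close>)
  moreover have "(1 - x / L) *\<^sub>R y + (x / L) *\<^sub>R v = y + x"
  proof -
    have "(1 - x / L) * y + (x / L) * v = y + (x / L) * L" unfolding L_def by (simp add: algebra_simps diff_divide_distrib)
    then show ?thesis using L by simp
  qed
  moreover have "(1 - x / L) * f y + (x / L) * f v = f y + x * D" by (simp add: D_def algebra_simps diff_divide_distrib)
  ultimately have 1: "x * D \<le> f (y + x) - f y" by simp
  let ?r = "(v - u) / L"
  have "f ((1 - ?r) *\<^sub>R v + ?r *\<^sub>R y) \<ge> (1 - ?r) * f v + ?r * f y"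
    by (rule concave_onD[OF f]) (use assms x L in \<open>auto simp: L_def\<close>)
  moreover have "(1 - ?r) *\<^sub>R v + ?r *\<^sub>R y = u"
  proof -
    have "(1 - ?r) * v + ?r * y = v - ?r * L" unfolding L_def by (simp add: algebra_simps diff_divide_distrib add_divide_distrib)
    then show ?thesis using L by simp
  qed
  moreover have "(1 - ?r) * f v + ?r * f y = f v - (v - u) * D" by (simp add: D_def algebra_simps diff_divide_distrib)
  ultimately have "f v - f u \<le> (v - u) * D" by simp
  then have "(f v - f u) / (v - u) \<le> D" using x by (simp add: divide_le_eq mult.commute)
  then have "(f v - f u) / (v - u) * x \<le> D * x" using x by (intro mult_right_mono) auto
  then show ?thesis using 1 by (simp add: mult.commute)
qed simp

text \<open>The scalar core of the domination on projections: \<open>u j\<close> stands for the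
  trace of the staircase projection and \<open>x j\<close> for the share of a given projection in
  step \<open>j\<close>. Stacking the lengths \<open>x j\<close> from the last step backwards, the
  piece for step \<open>n\<close> starts no further right than \<open>u (Suc n)\<close>, so
  \<open>f\<close> gains at least the slope of that step on it.\<close>

lemma concave_slopes_sum_le:
  fixes f :: "real \<Rightarrow> real" and u x :: "nat \<Rightarrow> real"
  assumes f: "concave_on {0..1} f" "f 0 = 0"
    and u: "\<And>j. j \<le> m \<Longrightarrow> u j \<le> 1" "u m = 0"
    and x: "\<And>j. j < m \<Longrightarrow> 0 \<le> x j" "\<And>j. j < m \<Longrightarrow> x j \<le> u j - u (Suc j)"
  shows "(\<Sum>j<m. (f (u j) - f (u (Suc j))) / (u j - u (Suc j)) * x j) \<le> f (\<Sum>j<m. x j)"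
proof -
  let ?w = "\<lambda>j. (f (u j) - f (u (Suc j))) / (u j - u (Suc j))"
  have "0 \<le> (\<Sum>j=n..<m. x j) \<and> (\<Sum>j=n..<m. x j) \<le> u n
      \<and> (\<Sum>j=n..<m. ?w j * x j) \<le> f (\<Sum>j=n..<m. x j)" if "n \<le> m" for n
    using that
  proof (induction n rule: inc_induct)
    case base
    then show ?case using f u by simp
  next
    case (step n)
    have split: "(\<Sum>j=n..<m. h j) = h n + (\<Sum>j=Suc n..<m. h j)" for h :: "nat \<Rightarrow> real"
      using step(2) by (simp add: sum.atLeast_Suc_lessThan)
    let ?y = "\<Sum>j=Suc n..<m. x j"
    have "?w n * x n \<le> f (?y + x n) - f ?y"
      by (rule concave_chord_slope[OF f(1)]) (use step u(1)[of n] x(1)[of n] x(2)[of n] in auto)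
    then show ?case
      unfolding split using step x(1)[of n] x(2)[of n] by (simp add: add.commute)
  qed
  from this[of 0] show ?thesis by (simp add: atLeast0LessThan)
qed

text \<open>Used twice: for the forms of the staircase projections at a vector, and for the values
  of \<alpha> at their traces.\<close>

lemma sum_index_times_decrement:
  fixes f :: "nat \<Rightarrow> real"
  shows "(\<Sum>j<m. real j * (f j - f (Suc j))) = (\<Sum>j<m. f (Suc j)) - real m * f m"
  by (induction m) (auto simp: algebra_simps)

lemma antimono_integral_Ico:
  fixes g :: "real \<Rightarrow> real"
  assumes g: "\<And>s t. s \<le> t \<Longrightarrow> g t \<le> g s" and "0 \<le> d"
  shows "d * (\<Sum>j<n. g (real (Suc j) * d)) \<le> (LBINT s:{0..<real n * d}. g s)"
    and "(LBINT s:{0..<real n * d}. g s) \<le> d * (\<Sum>j<n. g (real j * d))"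
proof -
  have meas: "g \<in> borel_measurable borel"
  proof -
    have "(\<lambda>x. - g x) \<in> borel_measurable borel"
      by (rule borel_measurable_mono) (auto simp: mono_def g)
    then have "(\<lambda>x. - (- g x)) \<in> borel_measurable borel" by (rule borel_measurable_uminus)
    then show ?thesis by simp
  qed
  have int: "set_integrable lborel {s..<t} g" for s t
    unfolding set_integrable_def
  proof (rule Bochner_Integration.integrable_bound)
    show "integrable lborel (\<lambda>x. indicator {s..<t} x * (\<bar>g s\<bar> + \<bar>g t\<bar>))"
      by (cases "s \<le> t") auto
    show "AE x in lborel. norm (indicator {s..<t} x *\<^sub>R g x) \<le> norm (indicator {s..<t} x * (\<bar>g s\<bar> + \<bar>g t\<bar>))"
    proof (rule AE_I2)
      fix x
      show "norm (indicator {s..<t} x *\<^sub>R g x) \<le> norm (indicator {s..<t} x * (\<bar>g s\<bar> + \<bar>g t\<bar>))"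
        using g[of s x] g[of x t] by (auto simp: indicator_def)
    qed
  qed (use meas in auto)
  have const: "(LBINT x:{s..<t}. c) = (t - s) * c" if "s \<le> t" for s t c :: real
    using that by (simp add: set_lebesgue_integral_def)
  have intc: "set_integrable lborel {s..<t} (\<lambda>x. c)" for s t c :: real
    by (cases "s \<le> t") (auto simp: set_integrable_def)
  have step: "(LBINT s:{0..<real (Suc n) * d}. g s)
      = (LBINT s:{0..<real n * d}. g s) + (LBINT s:{real n * d..<real (Suc n) * d}. g s)" for n
  proof -
    have "{0..<real (Suc n) * d} = {0..<real n * d} \<union> {real n * d..<real (Suc n) * d}"
      using \<open>0 \<le> d\<close> by (intro ivl_disj_un_two(3)[symmetric] mult_right_mono) auto
    then show ?thesis by (simp add: set_integral_Un int del: of_nat_Suc)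
  qed
  have piece: "d * g (real (Suc n) * d) \<le> (LBINT s:{real n * d..<real (Suc n) * d}. g s)"
    "(LBINT s:{real n * d..<real (Suc n) * d}. g s) \<le> d * g (real n * d)" for n
  proof -
    have le: "real n * d \<le> real (Suc n) * d" using \<open>0 \<le> d\<close> by (simp add: algebra_simps)
    have "(LBINT s:{real n * d..<real (Suc n) * d}. g (real (Suc n) * d)) \<le> (LBINT s:{real n * d..<real (Suc n) * d}. g s)"
      by (rule set_integral_mono[OF intc int]) (auto intro: g)
    then show "d * g (real (Suc n) * d) \<le> (LBINT s:{real n * d..<real (Suc n) * d}. g s)"
      unfolding const[OF le] by (simp add: algebra_simps)
    have "(LBINT s:{real n * d..<real (Suc n) * d}. g s) \<le> (LBINT s:{real n * d..<real (Suc n) * d}. g (real n * d))"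
      by (rule set_integral_mono[OF int intc]) (auto intro: g)
    then show "(LBINT s:{real n * d..<real (Suc n) * d}. g s) \<le> d * g (real n * d)"
      unfolding const[OF le] by (simp add: algebra_simps)
  qed
  show "d * (\<Sum>j<n. g (real (Suc j) * d)) \<le> (LBINT s:{0..<real n * d}. g s)"
  proof (induction n)
    case (Suc n)
    then show ?case unfolding step sum.lessThan_Suc distrib_left using piece(1)[of n] by linarith
  qed (simp add: set_lebesgue_integral_def)
  show "(LBINT s:{0..<real n * d}. g s) \<le> d * (\<Sum>j<n. g (real j * d))"
  proof (induction n)
    case (Suc n)
    then show ?case unfolding step sum.lessThan_Suc distrib_left using piece(2)[of n] by linarith
  qed (simp add: set_lebesgue_integral_def)
qed

text \<open>Upper and lower Riemann sums differ by \<open>d * g 0\<close>, since the intermediate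
  values telescope. The error is thus governed by the mesh, however many steps there are.\<close>

lemma antimono_integral_Ici:
  fixes g :: "real \<Rightarrow> real"
  assumes g: "\<And>s t. s \<le> t \<Longrightarrow> g t \<le> g s" and d: "0 \<le> d"
    and g0: "g 0 \<le> 1" and zero: "\<And>s. real m * d \<le> s \<Longrightarrow> g s = 0"
  shows "d * (\<Sum>j<m. g (real (Suc j) * d)) \<le> (LBINT s:{0..}. g s)"
    and "(LBINT s:{0..}. g s) \<le> d * (\<Sum>j<m. g (real (Suc j) * d)) + d"
proof -
  have eq: "(LBINT s:{0..}. g s) = (LBINT s:{0..<real m * d}. g s)"
    unfolding set_lebesgue_integral_def
    by (rule Bochner_Integration.integral_cong) (auto simp: indicator_def zero not_less)
  have "(\<Sum>j<m. g (real j * d)) - (\<Sum>j<m. g (real (Suc j) * d)) = g 0 - g (real m * d)"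
    using sum_lessThan_telescope'[of "\<lambda>j. g (real j * d)" m] by (simp add: sum_subtractf)
  then have "(\<Sum>j<m. g (real j * d)) \<le> (\<Sum>j<m. g (real (Suc j) * d)) + 1"
    using g0 zero[of "real m * d"] by simp
  then have "d * (\<Sum>j<m. g (real j * d)) \<le> d * (\<Sum>j<m. g (real (Suc j) * d)) + d"
    using mult_left_mono[OF _ d] by (fastforce simp: distrib_left)
  then show "(LBINT s:{0..}. g s) \<le> d * (\<Sum>j<m. g (real (Suc j) * d)) + d"
    using antimono_integral_Ico(2)[of g d m, OF g d] unfolding eq by linarith
  show "d * (\<Sum>j<m. g (real (Suc j) * d)) \<le> (LBINT s:{0..}. g s)"
    unfolding eq by (rule antimono_integral_Ico(1)[of g d m, OF g d])
qed

section \<open>Spectral staircases\<close>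

text \<open>For positive \<open>j\<close> these are the spectral projections for half lines. At 0
  the identity takes the place of the one for \<open>{0<..}\<close>, so that the steps add up to the
  identity even if \<open>a\<close> has a kernel.\<close>

definition staircase :: "('h::complex_hilbert_space \<Rightarrow>\<^sub>L 'h) \<Rightarrow> real \<Rightarrow> nat \<Rightarrow> 'h \<Rightarrow>\<^sub>L 'h"
  where "staircase a d j = (if j = 0 then id_blinfun else id_blinfun - cut_proj a (real j * d))"

context
  fixes a :: "'h::complex_hilbert_space \<Rightarrow>\<^sub>L 'h" and d :: real and m :: nat
  assumes a: "hermitian a" and pos: "\<And>x. 0 \<le> quad_form a x"
    and d: "0 < d" and m: "norm a \<le> real m * d" "0 < m"
begin

lemma staircase_ends: "staircase a d 0 = id_blinfun" "staircase a d m = 0"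
  using m by (auto simp: staircase_def cut_proj_eq_id[OF a])

lemma projection_staircase: "projection_op (staircase a d j)"
  by (simp add: staircase_def projection_id projection_compl projection_cut_proj[OF a])

lemma staircase_diff:
  "staircase a d j - staircase a d (Suc j) =
    (if j = 0 then cut_proj a d else cut_proj a (real (Suc j) * d) - cut_proj a (real j * d))"
  by (simp add: staircase_def)

lemma step_le: "real j * d \<le> real (Suc j) * d"
  using d by (simp add: algebra_simps)

lemma projection_staircase_diff: "projection_op (staircase a d j - staircase a d (Suc j))"
  unfolding staircase_diff by (simp add: projection_cut_proj[OF a] projection_cut_diff[OF a step_le] del: of_nat_Suc)

lemma staircase_diff_commute:
  "a o\<^sub>L (staircase a d j - staircase a d (Suc j)) = (staircase a d j - staircase a d (Suc j)) o\<^sub>L a"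
  unfolding staircase_diff
  using compose_commute_simps(2)[OF cut_proj_commute_self[OF a, symmetric] cut_proj_commute_self[OF a, symmetric]]
    cut_proj_commute_self[OF a] by simp

lemma quad_form_staircase_diff:
  assumes "y = (staircase a d j - staircase a d (Suc j)) x"
  shows "real j * d * (norm y)\<^sup>2 \<le> quad_form a y" "quad_form a y \<le> real (Suc j) * d * (norm y)\<^sup>2"
proof -
  have "real j * d * (norm y)\<^sup>2 \<le> quad_form a y \<and> quad_form a y \<le> real (Suc j) * d * (norm y)\<^sup>2"
  proof (cases "j = 0")
    \<comment> \<open>The bottom step is a whole cut and not a strip, so its lower bound 0 is the
      positivity of \<open>a\<close>.\<close>
    case True
    then have "y = cut_proj a d x" using assms by (simp add: staircase_diff)
    then show ?thesis using True pos cut_proj_upper[OF a, of d x] by simp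
  next
    case False
    then have "y = cut_proj a (real (Suc j) * d) x - cut_proj a (real j * d) x"
      using assms unfolding staircase_diff by (simp add: blinfun.diff_left del: of_nat_Suc)
    from quad_form_cut_diff[OF a step_le this] show ?thesis by simp
  qed
  then show "real j * d * (norm y)\<^sup>2 \<le> quad_form a y" "quad_form a y \<le> real (Suc j) * d * (norm y)\<^sup>2"
    by auto
qed

text \<open>The steps add up to the identity and commute with \<open>a\<close>, so the form of
  \<open>a\<close> decomposes over them. On step \<open>j\<close> it lies between
  \<open>j * d\<close> and \<open>(j + 1) * d\<close> times the squared norm, and summation by parts
  turns the lower sum into the staircase sum.\<close>

lemma quad_form_staircase_approx:
  shows "0 \<le> quad_form (a - d *\<^sub>R (\<Sum>j<m. staircase a d (Suc j))) x"
    and "quad_form (a - d *\<^sub>R (\<Sum>j<m. staircase a d (Suc j))) x \<le> d * (norm x)\<^sup>2"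
proof -
  let ?p = "staircase a d"
  let ?q = "\<lambda>j. ?p j - ?p (Suc j)"
  define f where "f j = quad_form (?p j) x" for j
  have f_ends: "f 0 = (norm x)\<^sup>2" "f m = 0" by (simp_all add: f_def staircase_ends quad_form_simps)
  have nq: "(norm (?q j x))\<^sup>2 = f j - f (Suc j)" for j
    by (simp add: quad_form_projection[OF projection_staircase_diff, symmetric] quad_form_simps f_def)
  have "(\<Sum>j<m. ?q j) = id_blinfun"
    unfolding sum_lessThan_telescope' by (simp add: staircase_ends)
  then have "blinfun_apply (\<Sum>j<m. ?q j) x = x" by simp
  then have "x = (\<Sum>j<m. ?q j x)" unfolding blinfun.sum_left by (rule sym)
  then have "a x = (\<Sum>j<m. a (?q j x))" unfolding blinfun.sum_right[symmetric] by (rule arg_cong)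
  then have "quad_form a x = (\<Sum>j<m. quad_form (a o\<^sub>L ?q j) x)"
    by (simp add: quad_form_def cinner.sum_right)
  then have qa: "quad_form a x = (\<Sum>j<m. quad_form a (?q j x))"
    by (simp add: quad_form_reduced[OF projection_staircase_diff a staircase_diff_commute])
  have "d * (\<Sum>j<m. real j * (f j - f (Suc j))) = (\<Sum>j<m. real j * d * (norm (?q j x))\<^sup>2)"
    unfolding nq by (simp add: sum_distrib_left mult_ac)
  also have "\<dots> \<le> quad_form a x"
    unfolding qa by (intro sum_mono quad_form_staircase_diff(1)[OF refl])
  finally have 1: "d * (\<Sum>j<m. f (Suc j)) \<le> quad_form a x"
    by (simp add: sum_index_times_decrement f_ends)
  have "quad_form a x \<le> (\<Sum>j<m. real (Suc j) * d * (norm (?q j x))\<^sup>2)"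
    unfolding qa by (intro sum_mono quad_form_staircase_diff(2)[OF refl])
  also have "\<dots> = d * (\<Sum>j<m. real j * (f j - f (Suc j))) + d * (\<Sum>j<m. f j - f (Suc j))"
    unfolding nq by (simp add: sum_distrib_left algebra_simps sum.distrib sum_subtractf)
  finally have 2: "quad_form a x \<le> d * (\<Sum>j<m. f (Suc j)) + d * (norm x)\<^sup>2"
    by (simp add: sum_index_times_decrement f_ends sum_lessThan_telescope')
  have eq: "quad_form (a - d *\<^sub>R (\<Sum>j<m. ?p (Suc j))) x = quad_form a x - d * (\<Sum>j<m. f (Suc j))"
    by (simp add: quad_form_simps quad_form_sum f_def)
  show "0 \<le> quad_form (a - d *\<^sub>R (\<Sum>j<m. ?p (Suc j))) x"
    "quad_form (a - d *\<^sub>R (\<Sum>j<m. ?p (Suc j))) x \<le> d * (norm x)\<^sup>2"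
    unfolding eq using 1 2 by auto
qed

end


section \<open>Tracial states\<close>

lemma hermitian_sum: "(\<And>i. i \<in> I \<Longrightarrow> hermitian (f i)) \<Longrightarrow> hermitian (\<Sum>i\<in>I. f i)"
  by (induction I rule: infinite_finite_induct) auto

lemma self_adjoints_iff:
  assumes "von_neumann_algebra M"
  shows "a \<in> self_adjoints M \<longleftrightarrow> a \<in> M \<and> hermitian a"
  using assms by (auto simp: self_adjoints_def hermitian_iff_adj von_neumann_algebra_def)

text \<open>The double commutant condition read as a membership test: closure properties of M,
  including \<open>cut_proj_in_vna\<close>, become commutation relations.\<close>

lemma vna_iff:
  assumes "von_neumann_algebra M"
  shows "a \<in> M \<longleftrightarrow> a \<in> bounded_ops \<and> (\<forall>b\<in>commutant M. b o\<^sub>L a = a o\<^sub>L b)"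
  using assms unfolding von_neumann_algebra_def commutant_def[of "commutant M"] by blast

lemma vna_bounded_ops: "von_neumann_algebra M \<Longrightarrow> a \<in> M \<Longrightarrow> a \<in> bounded_ops"
  by (auto simp: von_neumann_algebra_def)

lemma vna_intros:
  assumes "von_neumann_algebra M"
  shows "id_blinfun \<in> M" "0 \<in> M"
    "a \<in> M \<Longrightarrow> b \<in> M \<Longrightarrow> a + b \<in> M" "a \<in> M \<Longrightarrow> b \<in> M \<Longrightarrow> a - b \<in> M"
    "a \<in> M \<Longrightarrow> r *\<^sub>R a \<in> M" "a \<in> M \<Longrightarrow> b \<in> M \<Longrightarrow> a o\<^sub>L b \<in> M"
  by (auto simp: vna_iff[OF assms] compose_commute_simps[symmetric] intro: bounded_ops_intros)

lemma vna_sum: "von_neumann_algebra M \<Longrightarrow> (\<And>i. i \<in> I \<Longrightarrow> f i \<in> M) \<Longrightarrow> (\<Sum>i\<in>I. f i) \<in> M"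
  by (induction I rule: infinite_finite_induct) (auto intro: vna_intros)

lemma vna_adj: "von_neumann_algebra M \<Longrightarrow> a \<in> M \<Longrightarrow> adj a \<in> M"
  by (simp add: von_neumann_algebra_def)

lemma cut_proj_in_vna:
  assumes M: "von_neumann_algebra M" and a: "a \<in> M" "hermitian a"
  shows "cut_proj a s \<in> M"
  unfolding vna_iff[OF M]
proof (intro conjI ballI)
  show "cut_proj a s \<in> bounded_ops" by (rule hermitian_bounded_ops[OF hermitian_cut_proj[OF a(2)]])
  fix b assume "b \<in> commutant M"
  then show "b o\<^sub>L cut_proj a s = cut_proj a s o\<^sub>L b"
    using a(1) by (intro cut_proj_commute[OF a(2), symmetric]) (auto simp: commutant_def)
qed

text \<open>Real linearity lets the real part of a state be an instance, so the same estimates serve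
  the trace and the weighted functionals \<open>T\<close> built from it.\<close>

definition real_positive_functional :: "('h::complex_hilbert_space \<Rightarrow>\<^sub>L 'h) set \<Rightarrow> (('h \<Rightarrow>\<^sub>L 'h) \<Rightarrow> real) \<Rightarrow> bool"
  where "real_positive_functional M T \<longleftrightarrow>
    (\<forall>a\<in>M. \<forall>b\<in>M. T (a + b) = T a + T b) \<and> (\<forall>r. \<forall>a\<in>M. T (r *\<^sub>R a) = r * T a) \<and>
    (\<forall>a\<in>M. hermitian a \<longrightarrow> (\<forall>x. 0 \<le> quad_form a x) \<longrightarrow> 0 \<le> T a) \<and> T id_blinfun = 1"

context
  fixes M :: "('h::complex_hilbert_space \<Rightarrow>\<^sub>L 'h) set" and T
  assumes M: "von_neumann_algebra M" and T: "real_positive_functional M T"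
begin

lemma
  shows functional_add: "a \<in> M \<Longrightarrow> b \<in> M \<Longrightarrow> T (a + b) = T a + T b"
    and functional_scaleR: "a \<in> M \<Longrightarrow> T (r *\<^sub>R a) = r * T a"
    and functional_nonneg: "a \<in> M \<Longrightarrow> hermitian a \<Longrightarrow> (\<And>x. 0 \<le> quad_form a x) \<Longrightarrow> 0 \<le> T a"
    and functional_id: "T id_blinfun = 1"
  using T by (auto simp: real_positive_functional_def)

lemma functional_0: "T 0 = 0"
  using functional_scaleR[of 0 0] vna_intros(2)[OF M] by simp

lemma functional_diff: "a \<in> M \<Longrightarrow> b \<in> M \<Longrightarrow> T (a - b) = T a - T b"
  using functional_add[of "a - b" b] vna_intros(4)[OF M, of a b] by simp

lemma functional_sum: "(\<And>i. i \<in> I \<Longrightarrow> f i \<in> M) \<Longrightarrow> T (\<Sum>i\<in>I. f i) = (\<Sum>i\<in>I. T (f i))"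
  by (induction I rule: infinite_finite_induct) (auto simp: functional_0 functional_add vna_sum[OF M])

lemma functional_mono:
  assumes "a \<in> M" "hermitian a" "b \<in> M" "hermitian b" "\<And>x. quad_form a x \<le> quad_form b x"
  shows "T a \<le> T b"
proof -
  have "0 \<le> T (b - a)"
    using assms by (intro functional_nonneg vna_intros[OF M] hermitian_intros) (auto simp: quad_form_simps)
  then show ?thesis using assms by (simp add: functional_diff)
qed

lemma functional_abs_le:
  assumes "a \<in> M" "hermitian a" "\<And>x. \<bar>quad_form a x\<bar> \<le> K * (norm x)\<^sup>2"
  shows "\<bar>T a\<bar> \<le> K"
proof -
  have K: "K *\<^sub>R id_blinfun \<in> M" "hermitian (K *\<^sub>R id_blinfun)" "(- K) *\<^sub>R id_blinfun \<in> M" "hermitian ((- K) *\<^sub>R id_blinfun)"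
    using vna_intros[OF M] by blast+
  have "T a \<le> T (K *\<^sub>R id_blinfun)"
    by (rule functional_mono[OF assms(1,2) K(1,2)]) (use assms(3) in \<open>auto simp: quad_form_simps abs_le_iff\<close>)
  moreover have "T ((- K) *\<^sub>R id_blinfun) \<le> T a"
  proof (rule functional_mono[OF K(3,4) assms(1,2)])
    fix x show "quad_form ((- K) *\<^sub>R id_blinfun) x \<le> quad_form a x"
      using assms(3)[of x] unfolding quad_form_simps by linarith
  qed
  ultimately show ?thesis
    using vna_intros(1)[OF M] by (simp add: functional_scaleR functional_id abs_le_iff del: scaleR_minus_left)
qed

lemma functional_projection:
  assumes "p \<in> M" "projection_op p"
  shows "0 \<le> T p" "T p \<le> 1"
proof -
  show "0 \<le> T p"
    using assms by (intro functional_nonneg) (auto simp: hermitian_projection quad_form_projection)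
  have "T p \<le> T id_blinfun"
    using assms projection_norm_le[OF assms(2)]
    by (intro functional_mono vna_intros[OF M]) (auto simp: hermitian_projection quad_form_projection quad_form_simps hermitian_intros)
  then show "T p \<le> 1" by (simp add: functional_id)
qed

end

lemma state_real_positive_functional:
  assumes M: "von_neumann_algebra M" and "state_on M \<tau>"
  shows "real_positive_functional M (\<lambda>a. Re (\<tau> a))"
proof -
  have add: "\<And>a b. a \<in> M \<Longrightarrow> b \<in> M \<Longrightarrow> \<tau> (a + b) = \<tau> a + \<tau> b"
    and scale: "\<And>c a. a \<in> M \<Longrightarrow> \<tau> (scalar_op c o\<^sub>L a) = c * \<tau> a"
    and pos: "\<And>a. a \<in> M \<Longrightarrow> positive_op a \<Longrightarrow> \<tau> a \<in> \<real>\<^sub>\<ge>\<^sub>0" and id: "\<tau> id_blinfun = 1"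
    using assms by (auto simp: state_on_def)
  have "scalar_op (complex_of_real r) o\<^sub>L a = r *\<^sub>R a" for r and a :: "'a \<Rightarrow>\<^sub>L 'a"
    by (rule blinfun_eqI) (simp add: scaleC_of_real blinfun.scaleR_left)
  then have "Re (\<tau> (r *\<^sub>R a)) = r * Re (\<tau> a)" if "a \<in> M" for r a
    using scale[OF that, of "complex_of_real r"] by simp
  moreover have "0 \<le> Re (\<tau> a)" if "a \<in> M" "hermitian a" "\<forall>x. 0 \<le> quad_form a x" for a
    using pos[OF that(1)] that by (simp add: positive_op_iff complex_nonneg_Reals_iff)
  ultimately show ?thesis
    using add id by (simp add: real_positive_functional_def)
qed

section \<open>Linear functionals dominated by the Choquet trace\<close>

context
  fixes M :: "('h::complex_hilbert_space \<Rightarrow>\<^sub>L 'h) set" and \<tau> :: "('h \<Rightarrow>\<^sub>L 'h) \<Rightarrow> complex" and \<alpha> :: "real \<Rightarrow> real"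
  assumes M: "von_neumann_algebra M" and \<tau>: "state_on M \<tau>"
    and tracial: "\<And>a b. a \<in> M \<Longrightarrow> b \<in> M \<Longrightarrow> \<tau> (a o\<^sub>L b) = \<tau> (b o\<^sub>L a)"
    and \<alpha>_range: "\<alpha> ` {0..1} \<subseteq> {0..1}" and \<alpha>_mono: "mono_on {0..1} \<alpha>"
    and \<alpha>_ends: "\<alpha> 0 = 0" "\<alpha> 1 = 1"
begin

lemmas trace = state_real_positive_functional[OF M \<tau>]

lemma \<alpha>_le: "0 \<le> s \<Longrightarrow> s \<le> t \<Longrightarrow> t \<le> 1 \<Longrightarrow> \<alpha> s \<le> \<alpha> t"
  using \<alpha>_mono by (auto simp: mono_on_def)

text \<open>Although \<open>a\<close> and \<open>q\<close> need not commute, the trace sees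
  \<open>a q\<close> as the compression \<open>q a q\<close>. This is why weighting by projections
  preserves positivity.\<close>

lemma trace_compose_projection:
  assumes "a \<in> M" "q \<in> M" "projection_op q"
  shows "Re (\<tau> (a o\<^sub>L q)) = Re (\<tau> (q o\<^sub>L a o\<^sub>L q))"
proof -
  have "a o\<^sub>L q = (a o\<^sub>L q) o\<^sub>L q" using assms(3) by (auto intro!: blinfun_eqI)
  then have "\<tau> (a o\<^sub>L q) = \<tau> (q o\<^sub>L (a o\<^sub>L q))"
    using tracial[of "a o\<^sub>L q" q] assms vna_intros(6)[OF M] by simp
  moreover have "q o\<^sub>L (a o\<^sub>L q) = q o\<^sub>L a o\<^sub>L q" by (auto intro!: blinfun_eqI)
  ultimately show ?thesis by simp
qed

lemma trace_compose_bounds: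
  assumes a: "a \<in> M" "hermitian a" and q: "q \<in> M" "projection_op q"
  shows "(\<And>x. l * (norm (q x))\<^sup>2 \<le> quad_form a (q x)) \<Longrightarrow> l * Re (\<tau> q) \<le> Re (\<tau> (a o\<^sub>L q))"
    and "(\<And>x. quad_form a (q x) \<le> l * (norm (q x))\<^sup>2) \<Longrightarrow> Re (\<tau> (a o\<^sub>L q)) \<le> l * Re (\<tau> q)"
proof -
  note hq = hermitian_projection[OF q(2)]
  have lq: "l * Re (\<tau> q) = Re (\<tau> (l *\<^sub>R q))" by (simp add: functional_scaleR[OF M trace q(1)])
  have in_M: "q o\<^sub>L a o\<^sub>L q \<in> M" "l *\<^sub>R q \<in> M" and herm: "hermitian (q o\<^sub>L a o\<^sub>L q)" "hermitian (l *\<^sub>R q)"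
    using a q hq by (auto intro!: vna_intros[OF M] hermitian_sandwich hermitian_intros)
  have qf: "quad_form (q o\<^sub>L a o\<^sub>L q) x = quad_form a (q x)" "quad_form (l *\<^sub>R q) x = l * (norm (q x))\<^sup>2" for x
    by (simp_all add: hermitian_sandwich[OF a(2) hq] quad_form_simps quad_form_projection[OF q(2)])
  show "l * Re (\<tau> q) \<le> Re (\<tau> (a o\<^sub>L q))" if "\<And>x. l * (norm (q x))\<^sup>2 \<le> quad_form a (q x)"
    unfolding trace_compose_projection[OF a(1) q] lq
    by (rule functional_mono[OF M trace in_M(2) herm(2) in_M(1) herm(1)]) (simp add: qf that)
  show "Re (\<tau> (a o\<^sub>L q)) \<le> l * Re (\<tau> q)" if "\<And>x. quad_form a (q x) \<le> l * (norm (q x))\<^sup>2"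
    unfolding trace_compose_projection[OF a(1) q] lq
    by (rule functional_mono[OF M trace in_M(1) herm(1) in_M(2) herm(2)]) (simp add: qf that)
qed

lemma choquet_trace_pos_staircase:
  assumes a: "a \<in> M" "hermitian a" "\<And>x. 0 \<le> quad_form a x"
    and d: "0 < d" and m: "norm a \<le> real m * d"
  shows "d * (\<Sum>j<m. \<alpha> (Re (\<tau> (staircase a d (Suc j))))) \<le> choquet_trace_pos \<tau> \<alpha> a"
    and "choquet_trace_pos \<tau> \<alpha> a \<le> d * (\<Sum>j<m. \<alpha> (Re (\<tau> (staircase a d (Suc j))))) + d"
proof -
  let ?e = "\<lambda>s. id_blinfun - cut_proj a s"
  define g where "g s = \<alpha> (Re (\<tau> (?e s)))" for s
  have e: "?e s \<in> M" "projection_op (?e s)" for s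
    using a by (auto intro!: vna_intros[OF M] cut_proj_in_vna[OF M] projection_compl projection_cut_proj)
  have anti: "g t \<le> g s" if "s \<le> t" for s t
    unfolding g_def
  proof (rule \<alpha>_le)
    show "0 \<le> Re (\<tau> (?e t))" "Re (\<tau> (?e s)) \<le> 1" by (intro functional_projection[OF M trace] e)+
    show "Re (\<tau> (?e t)) \<le> Re (\<tau> (?e s))"
      using norm_cut_proj_mono[OF a(2) that]
      by (intro functional_mono[OF M trace] e hermitian_projection)
        (simp add: quad_form_simps quad_form_projection[OF projection_cut_proj[OF a(2)]])
  qed
  have "g 0 \<in> {0..1}" unfolding g_def
    using \<alpha>_range functional_projection[OF M trace e] by (auto simp: image_subset_iff)
  then have g0: "g 0 \<le> 1" by simp
  have zero: "g s = 0" if "real m * d \<le> s" for s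
    using that m by (simp add: g_def cut_proj_eq_id[OF a(2)] functional_0[OF M trace] \<alpha>_ends)
  have eq: "choquet_trace_pos \<tau> \<alpha> a = (LBINT s:{0..}. g s)"
    by (simp add: choquet_trace_pos_def spectral_projection_eq[OF a(2)] g_def)
  \<comment> \<open>Only indices \<open>Suc j\<close> occur, so the exceptional value of the
    staircase at 0 stays out and the sum is the lower Riemann sum.\<close>
  have sc: "\<alpha> (Re (\<tau> (staircase a d (Suc j)))) = g (real (Suc j) * d)" for j
    by (simp add: staircase_def g_def)
  show "d * (\<Sum>j<m. \<alpha> (Re (\<tau> (staircase a d (Suc j))))) \<le> choquet_trace_pos \<tau> \<alpha> a"
    unfolding eq sc by (rule antimono_integral_Ici(1)) (use anti d g0 zero in auto)
  show "choquet_trace_pos \<tau> \<alpha> a \<le> d * (\<Sum>j<m. \<alpha> (Re (\<tau> (staircase a d (Suc j))))) + d"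
    unfolding eq sc by (rule antimono_integral_Ici(2)) (use anti d g0 zero in auto)
qed

lemma staircase_in_vna: "a \<in> M \<Longrightarrow> hermitian a \<Longrightarrow> staircase a d j \<in> M"
  by (auto simp: staircase_def intro!: vna_intros[OF M] cut_proj_in_vna[OF M])

text \<open>Up to the mesh, \<open>T a\<close> is the staircase sum of the values of
  \<open>T\<close>, and the Choquet trace is the same sum with \<alpha> of the trace. Domination on
  projections compares them term by term.\<close>

lemma dominated_functional_le_pos:
  fixes \<sigma> :: real
  assumes T: "real_positive_functional M T"
    and dom: "\<And>e. e \<in> M \<Longrightarrow> projection_op e \<Longrightarrow> \<sigma> * T e \<le> \<sigma> * \<alpha> (Re (\<tau> e))" and \<sigma>: "\<bar>\<sigma>\<bar> = 1"
    and a: "a \<in> M" "hermitian a" "\<And>x. 0 \<le> quad_form a x"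
  shows "\<sigma> * T a \<le> \<sigma> * choquet_trace_pos \<tau> \<alpha> a"
proof (rule field_le_epsilon)
  fix e :: real assume "0 < e"
  \<comment> \<open>One mesh for replacing \<open>a\<close> by its staircase under \<open>T\<close>,
    one for the Riemann sum of the Choquet trace.\<close>
  define d where "d = e / 2"
  have d: "0 < d" using \<open>0 < e\<close> by (simp add: d_def)
  obtain m0 :: nat where "norm a / d \<le> real m0" using real_arch_simple by blast
  then have m: "norm a \<le> real (Suc m0) * d" using d by (simp add: field_simps)
  define m where "m = Suc m0"
  let ?p = "staircase a d"
  let ?A = "d *\<^sub>R (\<Sum>j<m. ?p (Suc j))"
  have m: "norm a \<le> real m * d" "0 < m" using m by (auto simp: m_def)
  note sc = staircase_in_vna[OF a(1,2), of d]
  have sum_in: "(\<Sum>j<m. ?p (Suc j)) \<in> M" by (intro vna_sum[OF M] sc)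
  have A_in: "?A \<in> M" by (intro vna_intros[OF M] sum_in)
  have A_herm: "hermitian ?A"
    by (intro hermitian_intros hermitian_sum hermitian_projection projection_staircase[OF a(2,3) d m])
  have aA: "a - ?A \<in> M" "hermitian (a - ?A)" using a A_in A_herm vna_intros[OF M] by blast+
  have "\<bar>T (a - ?A)\<bar> \<le> d"
    using quad_form_staircase_approx[OF a(2,3) d m] by (intro functional_abs_le[OF M T aA]) simp
  then have 1: "\<bar>T a - T ?A\<bar> \<le> d" by (simp add: functional_diff[OF M T a(1) A_in])
  let ?S = "d * (\<Sum>j<m. \<alpha> (Re (\<tau> (?p (Suc j)))))"
  have "T ?A = d * (\<Sum>j<m. T (?p (Suc j)))"
    by (simp add: functional_scaleR[OF M T sum_in] functional_sum[OF M T sc])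
  then have "\<sigma> * T ?A = d * (\<Sum>j<m. \<sigma> * T (?p (Suc j)))" by (simp add: sum_distrib_left mult_ac)
  also have "\<dots> \<le> d * (\<Sum>j<m. \<sigma> * \<alpha> (Re (\<tau> (?p (Suc j)))))"
    using d by (intro mult_left_mono sum_mono dom sc projection_staircase[OF a(2,3) d m]) auto
  also have "\<dots> = \<sigma> * ?S" by (simp add: sum_distrib_left mult_ac)
  finally have 2: "\<sigma> * T ?A \<le> \<sigma> * ?S" .
  have 3: "\<bar>choquet_trace_pos \<tau> \<alpha> a - ?S\<bar> \<le> d"
    using choquet_trace_pos_staircase[OF a d m(1)] by linarith
  have de: "e = d + d" by (simp add: d_def)
  have "\<sigma> = 1 \<or> \<sigma> = -1" using \<sigma> by linarith
  then show "\<sigma> * T a \<le> \<sigma> * choquet_trace_pos \<tau> \<alpha> a + e"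
  proof
    assume "\<sigma> = 1"
    then show ?thesis using 1 2 3 unfolding de by simp
  next
    assume "\<sigma> = -1"
    then show ?thesis using 1 2 3 unfolding de by simp
  qed
qed

lemma dominated_functional_exists_pos:
  fixes \<sigma> :: real
  assumes conc: "concave_on {0..1} (\<lambda>u. \<sigma> * \<alpha> u)"
    and c: "c \<in> M" "hermitian c" "\<And>x. 0 \<le> quad_form c x" and d: "0 < d"
  obtains T where "real_positive_functional M T"
    "\<And>e. e \<in> M \<Longrightarrow> projection_op e \<Longrightarrow> \<sigma> * T e \<le> \<sigma> * \<alpha> (Re (\<tau> e))"
    "\<bar>T c - choquet_trace_pos \<tau> \<alpha> c\<bar> \<le> d"
proof -
  obtain m0 :: nat where "norm c / d \<le> real m0" using real_arch_simple by blast
  then have m': "norm c \<le> real (Suc m0) * d" using d by (simp add: field_simps)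
  define m where "m = Suc m0"
  have m: "norm c \<le> real m * d" "0 < m" using m' by (auto simp: m_def)
  let ?p = "staircase c d"
  let ?q = "\<lambda>j. ?p j - ?p (Suc j)"
  define u where "u j = Re (\<tau> (?p j))" for j
  \<comment> \<open>A step of trace 0 gets weight 0, since division by 0 yields 0; its increment of
    \<alpha> is 0 too, so \<open>wu\<close> holds for every step.\<close>
  define w where "w j = (\<alpha> (u j) - \<alpha> (u (Suc j))) / (u j - u (Suc j))" for j
  have pM: "?p j \<in> M" for j by (rule staircase_in_vna[OF c(1,2)])
  have pp: "projection_op (?p j)" for j by (rule projection_staircase[OF c(2,3) d m])
  have qM: "?q j \<in> M" for j by (intro vna_intros[OF M] pM)
  have qq: "projection_op (?q j)" for j by (rule projection_staircase_diff[OF c(2,3) d m])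
  have tq: "Re (\<tau> (?q j)) = u j - u (Suc j)" for j
    by (simp add: u_def functional_diff[OF M trace pM pM])
  have u01: "0 \<le> u j" "u j \<le> 1" for j unfolding u_def by (intro functional_projection[OF M trace pM pp])+
  have u_dec: "u (Suc j) \<le> u j" for j using functional_projection(1)[OF M trace qM qq, of j] tq[of j] by simp
  have u_ends: "u 0 = 1" "u m = 0"
    by (simp_all add: u_def staircase_ends[OF c(2,3) d m] functional_id[OF M trace] functional_0[OF M trace])
  have w_nonneg: "0 \<le> w j" for j
    unfolding w_def using u_dec[of j] u01 by (intro divide_nonneg_nonneg) (auto intro: \<alpha>_le)
  have wu: "w j * (u j - u (Suc j)) = \<alpha> (u j) - \<alpha> (u (Suc j))" for j by (simp add: w_def)
  define T where "T a = (\<Sum>j<m. w j * Re (\<tau> (a o\<^sub>L ?q j)))" for a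
  have aq: "a o\<^sub>L ?q j \<in> M" if "a \<in> M" for a j using that by (intro vna_intros(6)[OF M] qM)
  have "real_positive_functional M T"
    unfolding real_positive_functional_def
  proof (intro conjI ballI allI impI)
    fix a b assume ab: "a \<in> M" "b \<in> M"
    have "(a + b) o\<^sub>L ?q j = (a o\<^sub>L ?q j) + (b o\<^sub>L ?q j)" for j
      by (rule blinfun_eqI) (simp add: blinfun.bilinear_simps)
    then show "T (a + b) = T a + T b"
      unfolding T_def by (simp only: functional_add[OF M trace aq[OF ab(1)] aq[OF ab(2)]] distrib_left sum.distrib)
  next
    fix r a assume a: "a \<in> M"
    have "(r *\<^sub>R a) o\<^sub>L ?q j = r *\<^sub>R (a o\<^sub>L ?q j)" for j
      by (rule blinfun_eqI) (simp add: blinfun.scaleR_left)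
    then show "T (r *\<^sub>R a) = r * T a"
      unfolding T_def by (simp only: functional_scaleR[OF M trace aq[OF a]] sum_distrib_left mult.left_commute)
  next
    fix a assume a: "a \<in> M" "hermitian a" "\<forall>x. 0 \<le> quad_form a x"
    have "0 * Re (\<tau> (?q j)) \<le> Re (\<tau> (a o\<^sub>L ?q j))" for j
      by (rule trace_compose_bounds(1)[OF a(1,2) qM qq]) (simp add: a(3))
    then show "0 \<le> T a" unfolding T_def by (intro sum_nonneg mult_nonneg_nonneg w_nonneg) simp
  next
    have "T id_blinfun = (\<Sum>j<m. \<alpha> (u j) - \<alpha> (u (Suc j)))"
      unfolding T_def id_blinfun_compose tq wu ..
    then show "T id_blinfun = 1"
      using sum_lessThan_telescope'[of "\<lambda>j. \<alpha> (u j)" m] by (simp add: u_ends \<alpha>_ends)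
  qed
  moreover have "\<sigma> * T e \<le> \<sigma> * \<alpha> (Re (\<tau> e))" if e: "e \<in> M" "projection_op e" for e
  proof -
    \<comment> \<open>The share of \<open>e\<close> in step \<open>j\<close>: it lies between 0 and
      the trace of the step, and the shares add up to the trace of \<open>e\<close>, as
      \<open>concave_slopes_sum_le\<close> demands.\<close>
    define x where "x j = Re (\<tau> (e o\<^sub>L ?q j))" for j
    note he = hermitian_projection[OF e(2)]
    have "0 * Re (\<tau> (?q j)) \<le> x j" for j
      unfolding x_def by (rule trace_compose_bounds(1)[OF e(1) he qM qq]) (simp add: quad_form_projection[OF e(2)])
    then have x0: "0 \<le> x j" for j by simp
    have "x j \<le> 1 * Re (\<tau> (?q j))" for j
      unfolding x_def
      by (rule trace_compose_bounds(2)[OF e(1) he qM qq])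
        (use projection_norm_le[OF e(2)] in \<open>simp add: quad_form_projection[OF e(2)]\<close>)
    then have x1: "x j \<le> u j - u (Suc j)" for j by (simp add: tq)
    have "(\<Sum>j<m. x j) = Re (\<tau> (\<Sum>j<m. e o\<^sub>L ?q j))"
      unfolding x_def by (rule functional_sum[OF M trace, symmetric]) (rule aq[OF e(1)])
    also have "(\<Sum>j<m. e o\<^sub>L ?q j) = e o\<^sub>L (\<Sum>j<m. ?q j)"
      by (rule blinfun_eqI) (simp only: blinfun.sum_left blinfun.sum_right blinfun_apply_blinfun_compose)
    also have "(\<Sum>j<m. ?q j) = id_blinfun"
      unfolding sum_lessThan_telescope' by (simp add: staircase_ends[OF c(2,3) d m])
    finally have sum_x: "(\<Sum>j<m. x j) = Re (\<tau> e)" by (simp add: id_blinfun_compose)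
    have "\<sigma> * T e = (\<Sum>j<m. (\<sigma> * \<alpha> (u j) - \<sigma> * \<alpha> (u (Suc j))) / (u j - u (Suc j)) * x j)"
      unfolding T_def x_def w_def sum_distrib_left by (simp add: right_diff_distrib[symmetric] mult.assoc)
    also have "\<dots> \<le> \<sigma> * \<alpha> (\<Sum>j<m. x j)"
      by (rule concave_slopes_sum_le[OF conc]) (use x0 x1 u01 u_ends \<alpha>_ends in auto)
    finally show ?thesis by (simp add: sum_x)
  qed
  moreover have "\<bar>T c - choquet_trace_pos \<tau> \<alpha> c\<bar> \<le> d"
  proof -
    \<comment> \<open>Both \<open>T c\<close> and the Choquet trace of \<open>c\<close> lie in the
      interval from \<open>S\<close> to \<open>S + d\<close>, so they differ by at most
      \<open>d\<close>.\<close>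
    define S where "S = d * (\<Sum>j<m. \<alpha> (u (Suc j)))"
    have abel: "(\<Sum>j<m. real j * (\<alpha> (u j) - \<alpha> (u (Suc j)))) = (\<Sum>j<m. \<alpha> (u (Suc j)))"
      using sum_index_times_decrement[of "\<lambda>j. \<alpha> (u j)" m] by (simp add: u_ends \<alpha>_ends)
    have "S = (\<Sum>j<m. w j * (real j * d * Re (\<tau> (?q j))))"
      unfolding S_def abel[symmetric] tq wu[symmetric] by (simp add: sum_distrib_left mult_ac)
    also have "\<dots> \<le> T c"
      unfolding T_def
      by (intro sum_mono mult_left_mono w_nonneg trace_compose_bounds(1)[OF c(1,2) qM qq]
          quad_form_staircase_diff(1)[OF c(2,3) d m refl])
    finally have 1: "S \<le> T c" .
    have "T c \<le> (\<Sum>j<m. w j * (real (Suc j) * d * Re (\<tau> (?q j))))"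
      unfolding T_def
      by (intro sum_mono mult_left_mono w_nonneg trace_compose_bounds(2)[OF c(1,2) qM qq]
          quad_form_staircase_diff(2)[OF c(2,3) d m refl])
    also have "\<dots> = (\<Sum>j<m. d * (real j * (\<alpha> (u j) - \<alpha> (u (Suc j)))) + d * (\<alpha> (u j) - \<alpha> (u (Suc j))))"
      unfolding tq wu[symmetric] by (intro sum.cong refl) (simp add: algebra_simps)
    also have "\<dots> = S + d"
      using sum_lessThan_telescope'[of "\<lambda>j. \<alpha> (u j)" m]
      unfolding sum.distrib sum_distrib_left[symmetric] abel by (simp add: u_ends \<alpha>_ends S_def)
    finally have 2: "T c \<le> S + d" .
    show ?thesis
      using 1 2 choquet_trace_pos_staircase[OF c d m(1)] by (simp add: S_def u_def abs_le_iff)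
  qed
  ultimately show thesis by (rule that)
qed

text \<open>Exposes the shift chosen by \<open>SOME\<close> together with the positivity it
  guarantees. A normalised functional moves by the same constant (\<open>functional_shift\<close>),
  so estimates for the shifted positive operator carry over.\<close>

lemma choquet_trace_shift:
  assumes a: "a \<in> M" "hermitian a"
  obtains c where "a + c *\<^sub>R id_blinfun \<in> M" "hermitian (a + c *\<^sub>R id_blinfun)"
    "\<And>x. 0 \<le> quad_form (a + c *\<^sub>R id_blinfun) x"
    "choquet_trace \<tau> \<alpha> a = choquet_trace_pos \<tau> \<alpha> (a + c *\<^sub>R id_blinfun) - c"
proof -
  have herm: "hermitian (a + c *\<^sub>R id_blinfun)" for c using a(2) by blast
  have "positive_op (a + norm a *\<^sub>R id_blinfun)"
    using abs_quad_form_le[of a] by (auto simp: positive_op_iff[OF herm] quad_form_simps abs_le_iff) (smt (verit))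
  then have pos: "positive_op (a + (SOME c. positive_op (a + c *\<^sub>R id_blinfun)) *\<^sub>R id_blinfun)"
    by (rule someI)
  show thesis
    by (rule that[of "SOME c. positive_op (a + c *\<^sub>R id_blinfun)"])
      (use a pos herm in \<open>auto simp: positive_op_iff[OF herm] choquet_trace_def Let_def intro!: vna_intros[OF M]\<close>)
qed

lemma functional_shift:
  assumes "real_positive_functional M T" "a \<in> M"
  shows "T (a + c *\<^sub>R id_blinfun) = T a + c"
  using assms vna_intros[OF M]
  by (simp add: functional_add[OF M assms(1)] functional_scaleR[OF M assms(1)] functional_id[OF M assms(1)])

lemma dominated_functional_le:
  fixes \<sigma> :: real
  assumes T: "real_positive_functional M T"
    and dom: "\<And>e. e \<in> M \<Longrightarrow> projection_op e \<Longrightarrow> \<sigma> * T e \<le> \<sigma> * \<alpha> (Re (\<tau> e))" and \<sigma>: "\<bar>\<sigma>\<bar> = 1"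
    and a: "a \<in> M" "hermitian a"
  shows "\<sigma> * T a \<le> \<sigma> * choquet_trace \<tau> \<alpha> a"
proof -
  obtain c where c: "a + c *\<^sub>R id_blinfun \<in> M" "hermitian (a + c *\<^sub>R id_blinfun)"
    "\<And>x. 0 \<le> quad_form (a + c *\<^sub>R id_blinfun) x"
    "choquet_trace \<tau> \<alpha> a = choquet_trace_pos \<tau> \<alpha> (a + c *\<^sub>R id_blinfun) - c"
    using choquet_trace_shift[OF a] by metis
  show ?thesis
    using dominated_functional_le_pos[OF T dom \<sigma> c(1-3)]
    by (simp add: c(4) functional_shift[OF T a(1)] algebra_simps)
qed

lemma dominated_functional_exists:
  fixes \<sigma> :: real
  assumes conc: "concave_on {0..1} (\<lambda>u. \<sigma> * \<alpha> u)" and a: "a \<in> M" "hermitian a" and d: "0 < d"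
  obtains T where "real_positive_functional M T"
    "\<And>e. e \<in> M \<Longrightarrow> projection_op e \<Longrightarrow> \<sigma> * T e \<le> \<sigma> * \<alpha> (Re (\<tau> e))"
    "\<bar>T a - choquet_trace \<tau> \<alpha> a\<bar> \<le> d"
proof -
  obtain c where c: "a + c *\<^sub>R id_blinfun \<in> M" "hermitian (a + c *\<^sub>R id_blinfun)"
    "\<And>x. 0 \<le> quad_form (a + c *\<^sub>R id_blinfun) x"
    "choquet_trace \<tau> \<alpha> a = choquet_trace_pos \<tau> \<alpha> (a + c *\<^sub>R id_blinfun) - c"
    using choquet_trace_shift[OF a] by metis
  obtain T where T: "real_positive_functional M T"
    "\<And>e. e \<in> M \<Longrightarrow> projection_op e \<Longrightarrow> \<sigma> * T e \<le> \<sigma> * \<alpha> (Re (\<tau> e))"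
    "\<bar>T (a + c *\<^sub>R id_blinfun) - choquet_trace_pos \<tau> \<alpha> (a + c *\<^sub>R id_blinfun)\<bar> \<le> d"
    using dominated_functional_exists_pos[OF conc c(1-3) d] by metis
  show thesis
    by (rule that[OF T(1,2)]) (use T(3) in \<open>simp_all add: c(4) functional_shift[OF T(1) a(1)]\<close>)
qed

end


section \<open>Powers of the averages\<close>

lemma power_op_Suc: "power_op a (Suc k) = a o\<^sub>L power_op a k"
  by (simp add: power_op_def)

lemma power_op_0: "power_op a 0 = id_blinfun"
  by (simp add: power_op_def)

lemma hermitian_power_op:
  assumes "hermitian a" shows "hermitian (power_op a k)"
proof -
  have comm: "power_op a k o\<^sub>L a = a o\<^sub>L power_op a k" for k
    by (induction k) (simp_all only: power_op_0 power_op_Suc compose_commute_simps)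
  show ?thesis
    by (induction k) (auto simp: power_op_0 power_op_Suc assms comm intro!: hermitian_compose)
qed

text \<open>Without commutativity the power expands over words: one product for each list of length
  \<open>k\<close>, with its order kept.\<close>

lemma power_op_scaled_sum:
  assumes "finite I"
  shows "power_op (r *\<^sub>R (\<Sum>i\<in>I. a i)) k = r ^ k *\<^sub>R (\<Sum>js | set js \<subseteq> I \<and> length js = k. prod_ops (map a js))"
proof (induction k)
  case 0
  have "{js. set js \<subseteq> I \<and> length js = 0} = {[]}" by auto
  then show ?case by (simp add: power_op_0 prod_ops_def)
next
  case (Suc k)
  let ?L = "{js. set js \<subseteq> I \<and> length js = k}"
  have inj: "inj_on (\<lambda>(xs, n). n # xs) (?L \<times> I)" by (auto simp: inj_on_def)
  have "(\<Sum>js | set js \<subseteq> I \<and> length js = Suc k. prod_ops (map a js))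
    = (\<Sum>(xs, n)\<in>?L \<times> I. a n o\<^sub>L prod_ops (map a xs))"
    unfolding lists_length_Suc_eq sum.reindex[OF inj]
    by (rule sum.cong) (auto simp: prod_ops_def)
  also have "\<dots> = (\<Sum>xs\<in>?L. \<Sum>n\<in>I. a n o\<^sub>L prod_ops (map a xs))"
    by (rule sum.cartesian_product[symmetric])
  also have "\<dots> = (\<Sum>n\<in>I. a n) o\<^sub>L (\<Sum>xs\<in>?L. prod_ops (map a xs))"
    by (rule blinfun_eqI) (simp add: blinfun.sum_left blinfun.sum_right)
  finally show ?case
    unfolding power_op_Suc Suc
    by (intro blinfun_eqI) (simp add: blinfun.scaleR_left blinfun.scaleR_right)
qed

text \<open>Because the form is unchanged, a hermitian sum of products keeps its value when each
  product is replaced by its real part.\<close>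

lemma hermitian_Re_op:
  assumes "b \<in> bounded_ops"
  shows "hermitian (Re_op b)" "quad_form (Re_op b) x = quad_form b x"
proof -
  have b: "Re_op b \<in> bounded_ops" unfolding Re_op_def using adj(2)[OF assms] assms by blast
  show "hermitian (Re_op b)"
    unfolding hermitian_def
  proof (intro conjI allI b)
    show "cinner (Re_op b x) y = cinner x (Re_op b y)" for x y
      using assms by (simp add: Re_op_def blinfun.bilinear_simps cinner_scaleR_left cinner_scaleR_right
          cinner_add_left cinner_add_right adj adj_right add.commute)
  qed
  have "Re (cinner x (adj b x)) = Re (cinner x (b x))"
    using adj_right[OF assms, of x x] Re_cinner_commute[of "b x" x] by simp
  then show "quad_form (Re_op b) x = quad_form b x"
    by (simp add: quad_form_def Re_op_def blinfun.bilinear_simps cinner_scaleR_right cinner_add_right)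
qed

lemma norm_prod_ops_le:
  assumes "0 \<le> B" "\<And>b. b \<in> set bs \<Longrightarrow> norm b \<le> B"
  shows "norm (prod_ops bs) \<le> B ^ length bs"
  using assms(2)
proof (induction bs)
  case Nil
  show ?case by (rule norm_blinfun_bound) (auto simp: prod_ops_def)
next
  case (Cons b bs)
  have "norm (prod_ops (b # bs)) \<le> norm b * norm (prod_ops bs)"
    by (simp add: prod_ops_def norm_blinfun_compose)
  also have "\<dots> \<le> B * B ^ length bs" using Cons assms(1) by (intro mult_mono) auto
  finally show ?case by simp
qed

lemma prod_ops_in_vna:
  "von_neumann_algebra M \<Longrightarrow> set bs \<subseteq> M \<Longrightarrow> prod_ops bs \<in> M"
  by (induction bs) (auto simp: prod_ops_def intro: vna_intros)

text \<open>A falling factorial over a power is a product of the \<open>k\<close> factors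
  \<open>1 - i / n\<close>, each tending to 1.\<close>

lemma distinct_lists_density:
  "(\<lambda>n. real (card {js. length js = k \<and> distinct js \<and> set js \<subseteq> {1..n}}) / real n ^ k) \<longlonglongrightarrow> 1"
proof -
  have eq: "real (card {js. length js = k \<and> distinct js \<and> set js \<subseteq> {1..n}}) / real n ^ k
      = (\<Prod>i<k. 1 - real i / real n)" if n: "n \<ge> k" "n > 0" for n
  proof -
    have "card {js. length js = k \<and> distinct js \<and> set js \<subseteq> {1..n}} = \<Prod>{n - k + 1..n}"
      using card_lists_distinct_length_eq[of "{1..n}" k] n by simp
    also have "\<dots> = (\<Prod>i<k. n - i)"
      by (rule prod.reindex_bij_witness[of _ "\<lambda>i. n - i" "\<lambda>i. n - i"]) (use n in auto)
    finally have "real (card {js. length js = k \<and> distinct js \<and> set js \<subseteq> {1..n}}) = (\<Prod>i<k. real n - real i)"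
      using n by (simp add: of_nat_diff)
    also have "\<dots> / real n ^ k = (\<Prod>i<k. (real n - real i) / real n)"
      by (simp add: prod_dividef)
    also have "\<dots> = (\<Prod>i<k. 1 - real i / real n)"
      using n by (intro prod.cong) (auto simp: diff_divide_distrib)
    finally show ?thesis .
  qed
  have "(\<lambda>n. \<Prod>i<k. 1 - real i / real n) \<longlonglongrightarrow> (\<Prod>i<k. 1 - 0)"
    by (intro tendsto_intros lim_const_over_n)
  then have lim: "(\<lambda>n. \<Prod>i<k. 1 - real i / real n) \<longlonglongrightarrow> 1" by simp
  show ?thesis
    by (rule Lim_transform_eventually[OF lim])
      (use eq in \<open>auto intro!: eventually_sequentiallyI[of "Suc k"]\<close>)
qed

text \<open>After passing to \<open>T\<close>, the average is taken word by word. Words without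
  repetition have proportion \<open>D\<close> and contribute at most \<open>C\<close> each; the
  others are controlled by the norm bound \<open>B ^ k\<close>. The tolerance \<open>e\<close> drops
  out, as the bound does not involve \<open>T\<close>.\<close>

lemma choquet_trace_average_power_le:
  fixes M :: "('h::complex_hilbert_space \<Rightarrow>\<^sub>L 'h) set" and \<sigma> :: real
  assumes M: "von_neumann_algebra M" and \<tau>: "state_on M \<tau>"
    and tracial: "\<And>a b. a \<in> M \<Longrightarrow> b \<in> M \<Longrightarrow> \<tau> (a o\<^sub>L b) = \<tau> (b o\<^sub>L a)"
    and \<alpha>: "\<alpha> ` {0..1} \<subseteq> {0..1}" "mono_on {0..1} \<alpha>" "\<alpha> 0 = 0" "\<alpha> 1 = 1"
    and \<sigma>: "\<bar>\<sigma>\<bar> = 1" "concave_on {0..1} (\<lambda>u. \<sigma> * \<alpha> u)"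
    and a: "\<And>i. i \<ge> 1 \<Longrightarrow> a i \<in> self_adjoints M" "\<And>i. i \<ge> 1 \<Longrightarrow> norm (a i) \<le> B"
    and C: "\<And>js. length js = k \<Longrightarrow> distinct js \<Longrightarrow> set js \<subseteq> {1..} \<Longrightarrow>
          \<sigma> * choquet_trace \<tau> \<alpha> (Re_op (prod_ops (map a js))) \<le> C"
    and n: "n \<ge> 1"
  defines "D \<equiv> real (card {js. length js = k \<and> distinct js \<and> set js \<subseteq> {1..n}}) / real n ^ k"
  shows "\<sigma> * choquet_trace \<tau> \<alpha> (power_op ((1 / real n) *\<^sub>R (\<Sum>i=1..n. a i)) k) \<le> D * C + (1 - D) * B ^ k"
proof (rule field_le_epsilon)
  fix e :: real assume e: "0 < e"
  note \<alpha>M = M \<tau> tracial \<alpha>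
  define L where "L = {js. set js \<subseteq> {1..n} \<and> length js = k}"
  define L' where "L' = {js. length js = k \<and> distinct js \<and> set js \<subseteq> {1..n}}"
  define b where "b js = prod_ops (map a js)" for js
  define P where "P = power_op ((1 / real n) *\<^sub>R (\<Sum>i=1..n. a i)) k"
  have finL: "finite L" unfolding L_def by (rule finite_lists_length_eq) simp
  have L': "L' \<subseteq> L" by (auto simp: L_def L'_def)
  have B0: "0 \<le> B" using a(2)[OF n] norm_ge_zero order.trans by blast
  have aM: "a i \<in> M" "hermitian (a i)" if "i \<ge> 1" for i using a(1)[OF that] by (auto simp: self_adjoints_iff[OF M])
  have bM: "b js \<in> M" if "js \<in> L" for js
    unfolding b_def by (rule prod_ops_in_vna[OF M]) (use that aM in \<open>auto simp: L_def subset_iff\<close>)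
  have bb: "b js \<in> bounded_ops" if "js \<in> L" for js using vna_bounded_ops[OF M bM[OF that]] .
  have RbM: "Re_op (b js) \<in> M" if "js \<in> L" for js
    unfolding Re_op_def using bM[OF that] vna_adj[OF M] by (intro vna_intros[OF M]) auto
  have b_norm: "norm (b js) \<le> B ^ k" if "js \<in> L" for js
  proof -
    have "norm (b js) \<le> B ^ length (map a js)"
      unfolding b_def by (rule norm_prod_ops_le[OF B0]) (use that a(2) in \<open>auto simp: L_def subset_iff\<close>)
    then show ?thesis using that by (simp add: L_def)
  qed
  have hP: "hermitian P"
    unfolding P_def by (intro hermitian_power_op hermitian_intros hermitian_sum aM(2)) simp
  have P_sum: "P = (1 / real n) ^ k *\<^sub>R (\<Sum>js\<in>L. b js)"
    unfolding P_def L_def b_def by (rule power_op_scaled_sum) simp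
  have PM: "P \<in> M" unfolding P_sum by (intro vna_intros[OF M] vna_sum[OF M] bM)
  have P_Re: "P = (1 / real n) ^ k *\<^sub>R (\<Sum>js\<in>L. Re_op (b js))"
  proof (rule quad_form_eq_imp_eq[OF hP])
    show "hermitian ((1 / real n) ^ k *\<^sub>R (\<Sum>js\<in>L. Re_op (b js)))"
      by (intro hermitian_intros hermitian_sum hermitian_Re_op bb)
    show "quad_form P x = quad_form ((1 / real n) ^ k *\<^sub>R (\<Sum>js\<in>L. Re_op (b js))) x" for x
      unfolding P_sum by (simp add: quad_form_simps quad_form_sum hermitian_Re_op bb)
  qed
  obtain T where T: "real_positive_functional M T"
    and dom: "\<And>e. e \<in> M \<Longrightarrow> projection_op e \<Longrightarrow> \<sigma> * T e \<le> \<sigma> * \<alpha> (Re (\<tau> e))"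
    and TP: "\<bar>T P - choquet_trace \<tau> \<alpha> P\<bar> \<le> e"
    using dominated_functional_exists[OF \<alpha>M \<sigma>(2) PM hP e] by metis
  have distinct: "\<sigma> * T (Re_op (b js)) \<le> C" if "js \<in> L'" for js
  proof -
    have js: "js \<in> L" using that L' by blast
    have "\<sigma> * T (Re_op (b js)) \<le> \<sigma> * choquet_trace \<tau> \<alpha> (Re_op (b js))"
      using dominated_functional_le[OF \<alpha>M T dom \<sigma>(1)] RbM[OF js] hermitian_Re_op(1)[OF bb[OF js]] by blast
    also have "\<dots> \<le> C" unfolding b_def by (rule C) (use that in \<open>auto simp: L'_def\<close>)
    finally show ?thesis .
  qed
  have general: "\<sigma> * T (Re_op (b js)) \<le> B ^ k" if js: "js \<in> L" for js
  proof -
    have "\<bar>T (Re_op (b js))\<bar> \<le> B ^ k"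
    proof (rule functional_abs_le[OF M T RbM[OF js] hermitian_Re_op(1)[OF bb[OF js]]])
      fix x
      have "\<bar>quad_form (b js) x\<bar> \<le> norm (b js) * (norm x)\<^sup>2" by (rule abs_quad_form_le)
      also have "\<dots> \<le> B ^ k * (norm x)\<^sup>2" by (intro mult_right_mono b_norm js) simp
      finally show "\<bar>quad_form (Re_op (b js)) x\<bar> \<le> B ^ k * (norm x)\<^sup>2"
        by (simp add: hermitian_Re_op(2)[OF bb[OF js]])
    qed
    then have "\<bar>\<sigma> * T (Re_op (b js))\<bar> \<le> B ^ k" using \<sigma>(1) by (simp add: abs_mult)
    then show ?thesis by linarith
  qed
  have "(\<Sum>js\<in>L. \<sigma> * T (Re_op (b js))) = (\<Sum>js\<in>L'. \<sigma> * T (Re_op (b js))) + (\<Sum>js\<in>L - L'. \<sigma> * T (Re_op (b js)))"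
    using sum.subset_diff[OF L' finL] by (simp add: add.commute)
  also have "\<dots> \<le> (\<Sum>js\<in>L'. C) + (\<Sum>js\<in>L - L'. B ^ k)"
    by (intro add_mono sum_mono distinct general) auto
  also have "\<dots> = real (card L') * C + (real (card L) - real (card L')) * B ^ k"
    using card_Diff_subset[OF finite_subset[OF L' finL] L'] card_mono[OF finL L'] by (simp add: of_nat_diff)
  also have "card L = n ^ k" unfolding L_def by (subst card_lists_length_eq) auto
  also have "real (card L') = D * real n ^ k" using n by (simp add: D_def L'_def)
  finally have sum_le: "(\<Sum>js\<in>L. \<sigma> * T (Re_op (b js))) \<le> real n ^ k * (D * C + (1 - D) * B ^ k)"
    by (simp add: algebra_simps)
  have "T P = (1 / real n) ^ k * (\<Sum>js\<in>L. T (Re_op (b js)))"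
    unfolding P_Re by (simp add: functional_scaleR[OF M T vna_sum[OF M RbM]] functional_sum[OF M T RbM])
  then have "\<sigma> * T P = (1 / real n) ^ k * (\<Sum>js\<in>L. \<sigma> * T (Re_op (b js)))"
    by (simp add: sum_distrib_left mult_ac)
  also have "\<dots> \<le> (1 / real n) ^ k * (real n ^ k * (D * C + (1 - D) * B ^ k))"
    by (intro mult_left_mono sum_le) simp
  also have "\<dots> = D * C + (1 - D) * B ^ k" using n by (simp add: power_one_over)
  finally have "\<sigma> * T P \<le> D * C + (1 - D) * B ^ k" .
  moreover have "\<sigma> = 1 \<or> \<sigma> = -1" using \<sigma>(1) by linarith
  ultimately show "\<sigma> * choquet_trace \<tau> \<alpha> P \<le> D * C + (1 - D) * B ^ k + e"
    using TP by (auto simp: abs_le_iff)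
qed

lemma limsup_choquet_trace_average_power:
  fixes M :: "('h::complex_hilbert_space \<Rightarrow>\<^sub>L 'h) set" and \<sigma> :: real
  assumes M: "von_neumann_algebra M" and \<tau>: "state_on M \<tau>"
    and tracial: "\<And>a b. a \<in> M \<Longrightarrow> b \<in> M \<Longrightarrow> \<tau> (a o\<^sub>L b) = \<tau> (b o\<^sub>L a)"
    and \<alpha>: "\<alpha> ` {0..1} \<subseteq> {0..1}" "mono_on {0..1} \<alpha>" "\<alpha> 0 = 0" "\<alpha> 1 = 1"
    and \<sigma>: "\<bar>\<sigma>\<bar> = 1" "concave_on {0..1} (\<lambda>u. \<sigma> * \<alpha> u)"
    and a: "\<And>i. i \<ge> 1 \<Longrightarrow> a i \<in> self_adjoints M" "bounded (a ` {1..})"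
    and C: "\<And>js. length js = k \<Longrightarrow> distinct js \<Longrightarrow> set js \<subseteq> {1..} \<Longrightarrow>
          \<sigma> * choquet_trace \<tau> \<alpha> (Re_op (prod_ops (map a js))) \<le> C"
  shows "limsup (\<lambda>n. ereal (\<sigma> * choquet_trace \<tau> \<alpha> (power_op ((1 / real n) *\<^sub>R (\<Sum>i=1..n. a i)) k))) \<le> ereal C"
proof -
  obtain B where B: "\<And>i. i \<ge> 1 \<Longrightarrow> norm (a i) \<le> B"
    using a(2) unfolding bounded_iff by auto
  define D where "D n = real (card {js. length js = k \<and> distinct js \<and> set js \<subseteq> {1..n}}) / real n ^ k" for n :: nat
  have "(\<lambda>n. D n * C + (1 - D n) * B ^ k) \<longlonglongrightarrow> 1 * C + (1 - 1) * B ^ k"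
    unfolding D_def by (intro tendsto_intros distinct_lists_density)
  then have "(\<lambda>n. ereal (D n * C + (1 - D n) * B ^ k)) \<longlonglongrightarrow> ereal C" by simp
  then have "limsup (\<lambda>n. ereal (D n * C + (1 - D n) * B ^ k)) = ereal C"
    by (intro lim_imp_Limsup) auto
  moreover have "limsup (\<lambda>n. ereal (\<sigma> * choquet_trace \<tau> \<alpha> (power_op ((1 / real n) *\<^sub>R (\<Sum>i=1..n. a i)) k)))
    \<le> limsup (\<lambda>n. ereal (D n * C + (1 - D n) * B ^ k))"
  proof (intro Limsup_mono eventually_sequentiallyI[of 1])
    fix n :: nat assume "1 \<le> n"
    then show "ereal (\<sigma> * choquet_trace \<tau> \<alpha> (power_op ((1 / real n) *\<^sub>R (\<Sum>i=1..n. a i)) k))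
      \<le> ereal (D n * C + (1 - D n) * B ^ k)"
      unfolding D_def using choquet_trace_average_power_le[OF M \<tau> tracial \<alpha> \<sigma> a(1) B C] by simp
  qed
  ultimately show ?thesis by simp
qed

theorem theorem4p2:
  fixes M :: "('h::complex_hilbert_space \<Rightarrow>\<^sub>L 'h) set"
    and \<tau> :: "('h \<Rightarrow>\<^sub>L 'h) \<Rightarrow> complex"
    and \<alpha> :: "real \<Rightarrow> real"
    and a :: "nat \<Rightarrow> 'h \<Rightarrow>\<^sub>L 'h"
  assumes "type_II1_factor M"
    and "faithful_normal_tracial_state M \<tau>"
    and "\<alpha> ` {0..1} \<subseteq> {0..1}"
    and "mono_on {0..1} \<alpha>"
    and "continuous_on {0..1} \<alpha>"
    and "\<alpha> 0 = 0"
    and "\<alpha> 1 = 1"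
    and "\<And>n. n \<ge> 1 \<Longrightarrow> a n \<in> self_adjoints M"
    and "bounded (a ` {1..})"
  shows "(concave_on {0..1} \<alpha> \<longrightarrow>
      (\<forall>k\<ge>1. \<forall>C::real.
        (\<forall>js. length js = k \<and> distinct js \<and> set js \<subseteq> {1..} \<longrightarrow>
          choquet_trace \<tau> \<alpha> (Re_op (prod_ops (map a js))) \<le> C) \<longrightarrow>
        limsup (\<lambda>n. ereal (choquet_trace \<tau> \<alpha>
          (power_op ((1 / real n) *\<^sub>R (\<Sum>i=1..n. a i)) k))) \<le> ereal C)) \<and>
    (convex_on {0..1} \<alpha> \<longrightarrow>
      (\<forall>k\<ge>1. \<forall>C::real.
        (\<forall>js. length js = k \<and> distinct js \<and> set js \<subseteq> {1..} \<longrightarrow>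
          choquet_trace \<tau> \<alpha> (Re_op (prod_ops (map a js))) \<ge> C) \<longrightarrow>
        liminf (\<lambda>n. ereal (choquet_trace \<tau> \<alpha>
          (power_op ((1 / real n) *\<^sub>R (\<Sum>i=1..n. a i)) k))) \<ge> ereal C))"
proof (intro conjI impI allI)
  have M: "von_neumann_algebra M" using assms(1) by (simp add: type_II1_factor_def factor_def)
  have \<tau>: "state_on M \<tau>" and tracial: "\<And>a b. a \<in> M \<Longrightarrow> b \<in> M \<Longrightarrow> \<tau> (a o\<^sub>L b) = \<tau> (b o\<^sub>L a)"
    using assms(2) by (auto simp: faithful_normal_tracial_state_def)
  note limsup_le = limsup_choquet_trace_average_power[OF M \<tau> tracial assms(3,4,6,7)]
  fix k C
  show "limsup (\<lambda>n. ereal (choquet_trace \<tau> \<alpha> (power_op ((1 / real n) *\<^sub>R (\<Sum>i=1..n. a i)) k))) \<le> ereal C"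
    if "concave_on {0..1} \<alpha>" and "\<forall>js. length js = k \<and> distinct js \<and> set js \<subseteq> {1..} \<longrightarrow>
          choquet_trace \<tau> \<alpha> (Re_op (prod_ops (map a js))) \<le> C"
    using limsup_le[of 1 a k C] that assms(8,9) by simp
  show "ereal C \<le> liminf (\<lambda>n. ereal (choquet_trace \<tau> \<alpha> (power_op ((1 / real n) *\<^sub>R (\<Sum>i=1..n. a i)) k)))"
    if "convex_on {0..1} \<alpha>" and "\<forall>js. length js = k \<and> distinct js \<and> set js \<subseteq> {1..} \<longrightarrow>
          C \<le> choquet_trace \<tau> \<alpha> (Re_op (prod_ops (map a js)))"
  proof -
    \<comment> \<open>With \<sigma> = -1, convexity of \<alpha> becomes concavity and the lower
      bound \<open>C\<close> becomes the upper bound \<open>- C\<close>; negation then exchanges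
      limsup and liminf.\<close>
    have "limsup (\<lambda>n. - ereal (choquet_trace \<tau> \<alpha> (power_op ((1 / real n) *\<^sub>R (\<Sum>i=1..n. a i)) k))) \<le> - ereal C"
      using limsup_le[of "-1" a k "- C"] that assms(8,9) by (simp add: concave_on_def)
    then show ?thesis
      unfolding ereal_Limsup_uminus by (simp only: ereal_minus_le_minus)
  qed
qed

end
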